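(* Let $\mathcal{K}$ be a finite connected simplicial complex with $n$ simplices, let $p\ge 0$ be an integer, and let $g=\dim\mathsf{H}_p(\mathcal{K})$ (homology with $\mathbb{Z}_2$ coefficients). After a preprocessing of $\mathcal{K}$ taking $O(n^{\omega})$ time (the computation of an annotation for the $p$-simplices), the following queries can be answered: (1) given a $p$-cycle $z$ with $t$ $p$-simplices, decide whether $z$ is null homologous, in $O(tg)$ time; (2) given two $p$-cycles $z_1,z_2$ with $t_1$ and $t_2$ $p$-simplices respectively, decide whether $z_1$ and $z_2$ are homologous, in $O((t_1+t_2)g)$ time.
   Context: All homology is simplicial with $\mathbb{Z}_2$ coefficients. A $p$-cycle is identified with (and given as a list of) the $p$-simplices having coefficient $1$ in it. A $p$-cycle $z$ is null homologous if its homology class $[z]\in\mathsf{H}_p(\mathcal{K})$ is $0$; two $p$-cycles are homologous if they represent the same class. Annotation: an annotation for $p$-simplices is a function $\mathrm{a}$ from the set of $p$-simplices of $\mathcal{K}$ to $(\mathbb{Z}_2)^g$ such that any two $p$-cycles $z,z'$ belong to the same homology class if and only if $\sum_{\sigma\in z}\mathrm{a}(\sigma)=\sum_{\sigma\in z'}\mathrm{a}(\sigma)$. $\omega>2$ denotes a real number such that two $n\times n$ matrices (over $\mathbb{Z}_2$) can be multiplied in $O(n^{\omega})$ time. Time is counted in unit-cost elementary operations. *)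

theory Defs
  imports Complex_Main "HOL-Library.Z2" "HOL-Algebra.AbelCoset"
    "Jordan_Normal_Form.Matrix" "Jordan_Normal_Form.VS_Connect"
begin

section \<open>Simplicial homology with coefficients in the two-element field\<close>

text \<open>Abstract simplicial complexes; the empty set is not counted as a simplex, so that
  homology is unreduced and the number of simplices is the cardinality of the complex.\<close>

definition simplicial_complex :: "'v set set \<Rightarrow> bool" where
  "simplicial_complex K \<longleftrightarrow>
     (\<forall>\<sigma>\<in>K. finite \<sigma> \<and> \<sigma> \<noteq> {} \<and> (\<forall>\<tau>. \<tau> \<subseteq> \<sigma> \<and> \<tau> \<noteq> {} \<longrightarrow> \<tau> \<in> K))"

definition connected_complex :: "'v set set \<Rightarrow> bool" where
  "connected_complex K \<longleftrightarrow> K \<noteq> {} \<and>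
     (\<forall>u\<in>\<Union>K. \<forall>v\<in>\<Union>K. (u, v) \<in> {(a, b). {a, b} \<in> K}\<^sup>*)"

definition simplices :: "'v set set \<Rightarrow> nat \<Rightarrow> 'v set set" where
  "simplices K p = {\<sigma>\<in>K. card \<sigma> = p + 1}"

text \<open>A chain is the set of the simplices that have coefficient 1 in it, so addition is
  symmetric difference. The fields \<open>mult\<close> and \<open>one\<close> of a module record carry no
  meaning for a module.\<close>

definition chain_space :: "'v set set \<Rightarrow> nat \<Rightarrow> (bit, 'v set set) module" where
  "chain_space K p =
     \<lparr>carrier = Pow (simplices K p), mult = undefined, one = undefined,
      zero = {}, add = sym_diff,
      smult = (\<lambda>a c. if a = 1 then c else {})\<rparr>"

text \<open>Since \<open>{}\<close> is not a simplex, the boundary of a chain of vertices is zero.\<close>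

definition boundary :: "'v set set \<Rightarrow> 'v set set \<Rightarrow> 'v set set" where
  "boundary K c = {\<tau>\<in>K. odd (card {\<sigma>\<in>c. \<tau> \<subseteq> \<sigma> \<and> card \<sigma> = card \<tau> + 1})}"

definition cycles :: "'v set set \<Rightarrow> nat \<Rightarrow> 'v set set set" where
  "cycles K p = {c \<in> carrier (chain_space K p). boundary K c = {}}"

definition boundaries :: "'v set set \<Rightarrow> nat \<Rightarrow> 'v set set set" where
  "boundaries K p = boundary K ` carrier (chain_space K (p + 1))"

definition cycle_space :: "'v set set \<Rightarrow> nat \<Rightarrow> (bit, 'v set set) module" where
  "cycle_space K p = (chain_space K p)\<lparr>carrier := cycles K p\<rparr>"

definition homology_class :: "'v set set \<Rightarrow> nat \<Rightarrow> 'v set set \<Rightarrow> 'v set set set" where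
  "homology_class K p z = boundaries K p +>\<^bsub>cycle_space K p\<^esub> z"

text \<open>The quotient of the space of cycles by the subspace of boundaries.\<close>

definition homology :: "'v set set \<Rightarrow> nat \<Rightarrow> (bit, 'v set set set) module" where
  "homology K p =
     \<lparr>carrier = a_rcosets\<^bsub>cycle_space K p\<^esub> (boundaries K p),
      mult = undefined, one = undefined,
      zero = boundaries K p, add = set_add (cycle_space K p),
      smult = (\<lambda>a X. \<Union>z\<in>X. homology_class K p (a \<odot>\<^bsub>cycle_space K p\<^esub> z))\<rparr>"

definition betti :: "'v set set \<Rightarrow> nat \<Rightarrow> nat" where
  "betti K p = vectorspace.dim class_ring (homology K p)"

definition null_homologous :: "'v set set \<Rightarrow> nat \<Rightarrow> 'v set set \<Rightarrow> bool" where
  "null_homologous K p z \<longleftrightarrow> homology_class K p z = \<zero>\<^bsub>homology K p\<^esub>"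

definition homologous :: "'v set set \<Rightarrow> nat \<Rightarrow> 'v set set \<Rightarrow> 'v set set \<Rightarrow> bool" where
  "homologous K p z z' \<longleftrightarrow> homology_class K p z = homology_class K p z'"

definition annotation :: "'v set set \<Rightarrow> nat \<Rightarrow> ('v set \<Rightarrow> bit vec) \<Rightarrow> bool" where
  "annotation K p a \<longleftrightarrow>
     (\<forall>\<sigma>\<in>simplices K p. a \<sigma> \<in> carrier_vec (betti K p)) \<and>
     (\<forall>z\<in>cycles K p. \<forall>z'\<in>cycles K p.
        homologous K p z z' \<longleftrightarrow>
        finsum_vec TYPE(bit) (betti K p) a z = finsum_vec TYPE(bit) (betti K p) a z')"


section \<open>A random access machine with unit-cost operations\<close>

text \<open>
  A structured word RAM. The memory consists of arrays of words, indexed by \<open>nat\<close>; a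
  program is finite and so names finitely many of them. Cell \<open>0\<close> of an array serves as
  a register. There is a sequential input and a sequential output, and a procedure call runs
  a program on a private memory, initially zero, so that all communication with the callee is
  word by word and is paid for: \<open>Pass\<close> queues a word for the input of the next callee,
  \<open>Fetch\<close> takes the next word from the output of the last one. \<open>Call Q\<close> runs
  \<open>Q\<close>, and \<open>Recur\<close> runs the innermost enclosing procedure again.
\<close>

datatype arith = OAdd | OSub | OMul | ODiv | OMod | OLess | OEq

fun apply_arith :: "arith \<Rightarrow> nat \<Rightarrow> nat \<Rightarrow> nat" where
  "apply_arith OAdd x y = x + y"
| "apply_arith OSub x y = x - y"
| "apply_arith OMul x y = x * y"
| "apply_arith ODiv x y = x div y"
| "apply_arith OMod x y = x mod y"
| "apply_arith OLess x y = of_bool (x < y)"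
| "apply_arith OEq x y = of_bool (x = y)"

datatype exp =
    Num nat
  | Cell nat exp
  | Bin arith exp exp

datatype com =
    Skip
  | Assign nat exp exp
  | Read nat exp
  | Write exp
  | Pass exp
  | Fetch nat exp
  | Seq com com
  | Cond exp com com
  | While exp com
  | Call com
  | Recur

type_synonym store = "nat \<Rightarrow> nat \<Rightarrow> nat"

record state =
  store :: store
  inp :: "nat list"
  out :: "nat list"
  arg :: "nat list"
  res :: "nat list"

definition start :: "store \<Rightarrow> nat list \<Rightarrow> state" where
  "start M xs = \<lparr>store = M, inp = xs, out = [], arg = [], res = []\<rparr>"

definition zero_store :: store where
  "zero_store = (\<lambda>k i. 0)"

definition set_cell :: "nat \<Rightarrow> nat \<Rightarrow> nat \<Rightarrow> state \<Rightarrow> state" where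
  "set_cell k i x s = s\<lparr>store := (store s)(k := (store s k)(i := x))\<rparr>"

fun val :: "exp \<Rightarrow> state \<Rightarrow> nat" where
  "val (Num c) s = c"
| "val (Cell k e) s = store s k (val e s)"
| "val (Bin f e1 e2) s = apply_arith f (val e1 s) (val e2 s)"

text \<open>Number of elementary operations needed to evaluate an expression.\<close>

fun cost :: "exp \<Rightarrow> nat" where
  "cost (Num c) = 1"
| "cost (Cell k e) = 1 + cost e"
| "cost (Bin f e1 e2) = 1 + cost e1 + cost e2"

text \<open>Unit cost is only reasonable for words of bounded size: an execution gets stuck as soon
  as a word (also an address or an intermediate result) exceeds the bound \<open>W\<close>.\<close>

fun fits :: "nat \<Rightarrow> exp \<Rightarrow> state \<Rightarrow> bool" where
  "fits W (Num c) s \<longleftrightarrow> c \<le> W"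
| "fits W (Cell k e) s \<longleftrightarrow> fits W e s \<and> val (Cell k e) s \<le> W"
| "fits W (Bin f e1 e2) s \<longleftrightarrow> fits W e1 s \<and> fits W e2 s \<and> val (Bin f e1 e2) s \<le> W"

text \<open>\<open>exec W P c s t s'\<close>: inside procedure \<open>P\<close> and with word bound \<open>W\<close>, command
  \<open>c\<close> takes state \<open>s\<close> to state \<open>s'\<close> in time \<open>t\<close>.\<close>

inductive exec :: "nat \<Rightarrow> com \<Rightarrow> com \<Rightarrow> state \<Rightarrow> nat \<Rightarrow> state \<Rightarrow> bool" for W where
  Skip: "exec W P Skip s 1 s"
| Assign: "fits W i s \<Longrightarrow> fits W e s \<Longrightarrow>
    exec W P (Assign k i e) s (1 + cost i + cost e) (set_cell k (val i s) (val e s) s)"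
| Read: "fits W i s \<Longrightarrow> inp s = x # xs \<Longrightarrow> x \<le> W \<Longrightarrow>
    exec W P (Read k i) s (1 + cost i) (set_cell k (val i s) x s\<lparr>inp := xs\<rparr>)"
| Write: "fits W e s \<Longrightarrow>
    exec W P (Write e) s (1 + cost e) (s\<lparr>out := out s @ [val e s]\<rparr>)"
| Pass: "fits W e s \<Longrightarrow>
    exec W P (Pass e) s (1 + cost e) (s\<lparr>arg := arg s @ [val e s]\<rparr>)"
| Fetch: "fits W i s \<Longrightarrow> res s = x # xs \<Longrightarrow> x \<le> W \<Longrightarrow>
    exec W P (Fetch k i) s (1 + cost i) (set_cell k (val i s) x s\<lparr>res := xs\<rparr>)"
| Seq: "exec W P c1 s t1 s' \<Longrightarrow> exec W P c2 s' t2 s'' \<Longrightarrow>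
    exec W P (Seq c1 c2) s (t1 + t2) s''"
| CondT: "fits W e s \<Longrightarrow> val e s \<noteq> 0 \<Longrightarrow> exec W P c1 s t s' \<Longrightarrow>
    exec W P (Cond e c1 c2) s (1 + cost e + t) s'"
| CondF: "fits W e s \<Longrightarrow> val e s = 0 \<Longrightarrow> exec W P c2 s t s' \<Longrightarrow>
    exec W P (Cond e c1 c2) s (1 + cost e + t) s'"
| WhileF: "fits W e s \<Longrightarrow> val e s = 0 \<Longrightarrow>
    exec W P (While e c) s (1 + cost e) s"
| WhileT: "fits W e s \<Longrightarrow> val e s \<noteq> 0 \<Longrightarrow> exec W P c s t1 s' \<Longrightarrow>
    exec W P (While e c) s' t2 s'' \<Longrightarrow>
    exec W P (While e c) s (1 + cost e + t1 + t2) s''"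
| Call: "exec W Q Q (start zero_store (arg s)) t s' \<Longrightarrow>
    exec W P (Call Q) s (1 + t) (s\<lparr>arg := [], res := out s'\<rparr>)"
| Recur: "exec W P P (start zero_store (arg s)) t s' \<Longrightarrow>
    exec W P Recur s (1 + t) (s\<lparr>arg := [], res := out s'\<rparr>)"

text \<open>Started on memory \<open>M\<close> and input \<open>xs\<close>, program \<open>P\<close> halts after time \<open>t\<close> with
  output \<open>ys\<close>, leaving memory \<open>M'\<close>.\<close>

definition runs ::
  "nat \<Rightarrow> com \<Rightarrow> store \<Rightarrow> nat list \<Rightarrow> nat \<Rightarrow> nat list \<Rightarrow> store \<Rightarrow> bool" where
  "runs W P M xs t ys M' \<longleftrightarrow>
     (\<exists>s. exec W P P (start M xs) t s \<and> out s = ys \<and> store s = M')"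

text \<open>A polynomial bound on the words, i.e. words of logarithmically many bits.\<close>

definition word_bound :: "nat \<Rightarrow> nat \<Rightarrow> nat list \<Rightarrow> nat" where
  "word_bound c k xs = c * (1 + length xs + sum_list xs) ^ k"


section \<open>Encodings and the matrix multiplication exponent\<close>

definition word_of_bit :: "bit \<Rightarrow> nat" where
  "word_of_bit b = (if b = 1 then 1 else 0)"

text \<open>The entries, in row-major order.\<close>

definition enc_mat :: "bit mat \<Rightarrow> nat list" where
  "enc_mat A = map word_of_bit (concat (mat_to_list A))"

definition matmul_in_time :: "real \<Rightarrow> bool" where
  "matmul_in_time \<omega> \<longleftrightarrow>
     (\<exists>P C c k. \<forall>n\<ge>1. \<forall>A\<in>carrier_mat n n. \<forall>B\<in>carrier_mat n n.
        let xs = n # enc_mat A @ enc_mat B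
        in \<exists>t M. runs (word_bound c k xs) P zero_store xs t (enc_mat (A * B)) M \<and>
             real t \<le> C * real n powr \<omega>)"

text \<open>A complex is presented by a list, in any order, of its simplices, each of them a list of
  vertices without repetition; a simplex is then referred to by its position.\<close>

definition lists_complex :: "nat list list \<Rightarrow> nat set set \<Rightarrow> bool" where
  "lists_complex Ks K \<longleftrightarrow>
     set (map set Ks) = K \<and> distinct (map set Ks) \<and> (\<forall>vs\<in>set Ks. distinct vs)"

definition enc_complex :: "nat list list \<Rightarrow> nat list" where
  "enc_complex Ks = length Ks # concat (map (\<lambda>vs. length vs # vs) Ks)"

definition lists_chain :: "nat list list \<Rightarrow> nat list \<Rightarrow> nat set set \<Rightarrow> bool" where
  "lists_chain Ks is z \<longleftrightarrow>
     distinct is \<and> set is \<subseteq> {..<length Ks} \<and> (\<lambda>i. set (Ks ! i)) ` set is = z"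

definition enc_chain :: "nat list \<Rightarrow> nat list" where
  "enc_chain is = length is # is"

text \<open>The vectors assigned to the \<open>p\<close>-simplices, in the order in which these are listed.\<close>

definition enc_annotation ::
  "nat list list \<Rightarrow> nat \<Rightarrow> (nat set \<Rightarrow> bit vec) \<Rightarrow> nat list" where
  "enc_annotation Ks p a =
     concat (map (\<lambda>\<sigma>. map word_of_bit (list_of_vec (a \<sigma>)))
       (filter (\<lambda>\<sigma>. card \<sigma> = p + 1) (map set Ks)))"

end

theory Submission
  imports Defs
begin

text \<open>Write \<open>D\<^sub>p\<close> for the matrix of the boundary map on \<open>p\<close>-chains. For a generalized inverse \<open>G\<close> of
  \<open>D\<^sub>p\<close>, that is, \<open>D\<^sub>p G D\<^sub>p = D\<^sub>p\<close>, the matrix \<open>I - G D\<^sub>p\<close> is a projection onto the \<open>p\<close>-cycles. Let \<open>A\<close> be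
  \<open>D\<^bsub>p+1\<^esub>\<close> followed by the columns of this projection, and \<open>G'\<close> a generalized inverse of \<open>A\<close> that is
  supported on the rows belonging to the lexicographically first column basis of \<open>A\<close>. Then
  \<open>A G' z = z\<close> for every cycle \<open>z\<close>, so the coordinates of \<open>G' z\<close> at the basis columns in the second half of
  \<open>A\<close> vanish exactly if \<open>z\<close> is a boundary. There are \<open>g\<close> of them, and they annotate the \<open>p\<close>-simplices.

  Such a generalized inverse is obtained by splitting a matrix into left and right half:
  if \<open>G\<^sub>1\<close> belongs to \<open>A\<^sub>1\<close>, and \<open>H\<close> to \<open>M = A\<^sub>2 - A\<^sub>1 G\<^sub>1 A\<^sub>2\<close>, then stacking
  \<open>G\<^sub>1 - G\<^sub>1 A\<^sub>2 H'\<close> on \<open>H' = H - H A\<^sub>1 G\<^sub>1\<close> gives one for \<open>(A\<^sub>1 A\<^sub>2)\<close>. With \<open>N\<close> rows and halves of width \<open>s\<close> this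
  takes a bounded number of products of \<open>N/s\<close> pairs of square blocks of size \<open>s\<close>; as \<open>\<omega> > 2\<close>, the resulting costs
  \<open>N s\<^bsup>\<omega>-1\<^esup>\<close> sum up geometrically to \<open>O(N w\<^bsup>\<omega>-1\<^esup>)\<close> for \<open>w\<close> columns.\<close>

section \<open>A program logic with time bounds\<close>

text \<open>The boundary matrices are rank deficient, so inverses do not exist, and elimination
  would have to search for pivots and permute rows, which fits badly with multiplication as a black
  box. A generalized inverse always exists, is built by cutting columns only, and its support
  records the pivots. Two further properties carry the annotation: a column uses no basis column to
  its right, so boundaries get the value 0, and a basis column is sent to its own unit vector, so
  every value occurs and the number of coordinates is the Betti number. Besides the geometric sum,
  \<omega> > 2 pays for the table of facets: a simplex has at most logarithmically many vertices, so
  testing all pairs takes O(n^2 log n) time. The multiplication program brings a polynomial word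
  bound of its own, which the final bound has to dominate on all matrices that occur. A query may
  take O(1 + t g) time; if t = 0 or g = 0 this is constant, so both cases are answered
  apart.\<close>

lemma exec_mono: "exec W P c s t s' \<Longrightarrow> W \<le> W' \<Longrightarrow> exec W' P c s t s'"
proof -
  have fm: "fits W e s \<Longrightarrow> W \<le> W' \<Longrightarrow> fits W' e s" for e s
    by (induction e) (auto dest: order_trans)
  show "exec W P c s t s' \<Longrightarrow> W \<le> W' \<Longrightarrow> exec W' P c s t s'"
  proof (induction rule: exec.induct)
    case Read
    then show ?case by (intro exec.Read fm) (auto intro: order_trans)
  next
    case Fetch
    then show ?case by (intro exec.Fetch fm) (auto intro: order_trans)
  qed (blast intro: exec.intros fm)+
qed

abbreviation reg :: "nat \<Rightarrow> exp" where "reg k \<equiv> Cell k (Num 0)"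

fun ev :: "exp \<Rightarrow> store \<Rightarrow> nat" where
  "ev (Num c) \<sigma> = c"
| "ev (Cell k e) \<sigma> = \<sigma> k (ev e \<sigma>)"
| "ev (Bin f e1 e2) \<sigma> = apply_arith f (ev e1 \<sigma>) (ev e2 \<sigma>)"

lemma val_ev: "val e s = ev e (store s)"
  by (induction e) auto

text \<open>If all cells are at most \<open>B \<ge> 2\<close>, then \<open>e\<close> evaluates to at most \<open>B ^ esize e\<close>. Every expression
  used below has size at most 40, so that bounding the cells suffices to exclude overflows.\<close>

fun esize :: "exp \<Rightarrow> nat" where
  "esize (Num c) = Suc c"
| "esize (Cell k e) = Suc (esize e)"
| "esize (Bin f e1 e2) = esize e1 + esize e2"

abbreviation State :: "store \<Rightarrow> nat list \<Rightarrow> nat list \<Rightarrow> nat list \<Rightarrow> nat list \<Rightarrow> state" where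
  "State \<sigma> xs ys us vs \<equiv> \<lparr>store = \<sigma>, inp = xs, out = ys, arg = us, res = vs\<rparr>"

fun block :: "com list \<Rightarrow> com" where
  "block [] = Skip"
| "block (c # cs) = Seq c (block cs)"

definition for_loop :: "nat \<Rightarrow> nat \<Rightarrow> com \<Rightarrow> com" where
  "for_loop i m c = Seq (Assign i (Num 0) (Num 0))
     (While (Bin OLess (reg i) (reg m)) (Seq c (Assign i (Num 0) (Bin OAdd (reg i) (Num 1)))))"

definition set_reg :: "nat \<Rightarrow> nat \<Rightarrow> store \<Rightarrow> store" where
  "set_reg k x \<sigma> = \<sigma>(k := (\<sigma> k)(0 := x))"

lemma set_reg_apply [simp]:
  "set_reg k x \<sigma> k 0 = x"
  "k' \<noteq> k \<Longrightarrow> set_reg k x \<sigma> k' = \<sigma> k'"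
  "i \<noteq> 0 \<Longrightarrow> set_reg k x \<sigma> k' i = \<sigma> k' i"
  by (auto simp: set_reg_def)

type_synonym invariant = "nat \<Rightarrow> store \<Rightarrow> nat list \<Rightarrow> nat list \<Rightarrow> nat list \<Rightarrow> nat list \<Rightarrow> bool"

text \<open>\<open>for_loop\<close> advances the counter itself after the body. So the body has to
  leave it at \<open>j\<close>, and the invariant is demanded of the store in which the counter
  already reads \<open>Suc j\<close>.\<close>

abbreviation loop_post :: "nat \<Rightarrow> nat \<Rightarrow> invariant \<Rightarrow> state \<Rightarrow> bool" where
  "loop_post i j I \<equiv> (\<lambda>s. store s i 0 = j \<and>
     I (Suc j) (set_reg i (Suc j) (store s)) (inp s) (out s) (arg s) (res s))"

section \<open>Timed weakest preconditions under a word bound\<close>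

locale machine =
  fixes W B :: nat
  assumes two_le_B: "2 \<le> B" and B_pow_le: "B ^ 40 \<le> W"
begin

definition bnd :: "store \<Rightarrow> bool" where
  "bnd \<sigma> \<longleftrightarrow> (\<forall>k i. \<sigma> k i \<le> B)"

lemma bnd_le: "bnd \<sigma> \<Longrightarrow> \<sigma> k i \<le> B"
  by (simp add: bnd_def)

lemma bnd_zero: "bnd zero_store"
  by (simp add: bnd_def zero_store_def)

lemma bnd_set_reg: "bnd \<sigma> \<Longrightarrow> x \<le> B \<Longrightarrow> bnd (set_reg k x \<sigma>)"
  by (simp add: bnd_def set_reg_def)

lemma B_le_W: "B \<le> W"
  using B_pow_le two_le_B by (metis le_trans self_le_power zero_less_numeral less_le_trans one_le_numeral)

lemma fits_aux:
  assumes "bnd (store s)"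
  shows "1 \<le> esize e \<and> val e s \<le> B ^ esize e \<and> (B ^ esize e \<le> V \<longrightarrow> fits V e s)"
proof (induction e)
  case (Num c)
  have "c \<le> 2 ^ c" by (simp add: less_imp_le)
  also have "\<dots> \<le> B ^ c" using two_le_B by (simp add: power_mono)
  also have "\<dots> \<le> B ^ Suc c" using two_le_B by simp
  finally show ?case by auto
next
  case (Cell k e)
  have b: "1 \<le> B" using two_le_B by simp
  have "val (Cell k e) s \<le> B" using assms by (simp add: bnd_def)
  moreover have "B \<le> B ^ Suc (esize e)" using b by simp
  moreover have "B ^ esize e \<le> B ^ Suc (esize e)" using b by simp
  ultimately have "val (Cell k e) s \<le> B ^ Suc (esize e) \<and> (B ^ Suc (esize e) \<le> V \<longrightarrow> fits V e s \<and> val (Cell k e) s \<le> V)"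
    using Cell by (meson order_trans)
  then show ?case by simp
next
  case (Bin f e1 e2)
  define X Y where "X = B ^ esize e1" and "Y = B ^ esize e2"
  have "B \<le> X" "B \<le> Y" using Bin two_le_B unfolding X_def Y_def
    by (auto intro!: self_le_power)
  then have XY: "2 \<le> X" "2 \<le> Y" using two_le_B by auto
  have v: "val e1 s \<le> X" "val e2 s \<le> Y" using Bin by (auto simp: X_def Y_def)
  have prod: "X \<le> X * Y" "Y \<le> X * Y" "1 \<le> X * Y" using XY by auto
  have "X + Y \<le> X * Y"
  proof -
    have "X + Y \<le> X * Y \<longleftrightarrow> int X + int Y \<le> int X * int Y" by (metis of_nat_add of_nat_le_iff of_nat_mult)
    \<comment> \<open>Expanding the product gives X Y \<ge> 2 (X + Y) - 4, and X + Y \<ge> 4;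
      integers avoid truncated subtraction.\<close>
    moreover have "0 \<le> (int X - 2) * (int Y - 2)" using XY by simp
    moreover have "int X \<ge> 2" "int Y \<ge> 2" using XY by auto
    ultimately show ?thesis by (simp add: algebra_simps)
  qed
  then have "apply_arith f (val e1 s) (val e2 s) \<le> X * Y"
  proof (cases f)
    case OMul then show ?thesis using v by (simp add: mult_mono)
  next
    case ODiv then show ?thesis by (simp only: apply_arith.simps) (meson v(1) prod(1) div_le_dividend order_trans)
  next
    case OMod then show ?thesis by (simp only: apply_arith.simps) (meson v(1) prod(1) mod_less_eq_dividend order_trans)
  qed (use v prod \<open>X + Y \<le> X * Y\<close> in \<open>auto simp: of_bool_def split: if_splits\<close>)
  moreover have "B ^ esize (Bin f e1 e2) = X * Y" by (simp add: X_def Y_def power_add)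
  moreover have "fits V e1 s" "fits V e2 s" if "X * Y \<le> V"
    using Bin prod(1,2) that unfolding X_def Y_def by (meson order_trans)+
  ultimately show ?case using Bin by auto
qed

lemma fits_small:
  assumes "bnd (store s)" "esize e \<le> 40"
  shows "fits W e s"
proof -
  have "B ^ esize e \<le> W"
    using power_increasing[OF assms(2), of B] two_le_B B_pow_le by linarith
  then show ?thesis using fits_aux[OF assms(1)] by blast
qed

text \<open>Procedures get a private memory, so only \<open>Recur\<close> depends on the enclosing procedure \<open>P\<close>.\<close>

definition wpb :: "com \<Rightarrow> com \<Rightarrow> real \<Rightarrow> (state \<Rightarrow> bool) \<Rightarrow> state \<Rightarrow> bool" where
  "wpb P c T Q s \<longleftrightarrow> (\<exists>t s'. exec W P c s t s' \<and> real t \<le> T \<and> bnd (store s') \<and> Q s')"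

text \<open>Only the output is constrained: a callee works on a private memory that is discarded,
  and the given multiplication program respects \<open>W\<close> but perhaps not the cell bound
  \<open>B\<close>.\<close>

definition proc :: "com \<Rightarrow> nat list \<Rightarrow> real \<Rightarrow> nat list \<Rightarrow> bool" where
  "proc Q xs T ys \<longleftrightarrow>
     (\<exists>t s'. exec W Q Q (start zero_store xs) t s' \<and> real t \<le> T \<and> out s' = ys)"

lemma procI: "wpb Q Q T (\<lambda>s. out s = ys) (State zero_store xs [] [] []) \<Longrightarrow> proc Q xs T ys"
  unfolding proc_def wpb_def start_def by blast

lemma proc_mono: "proc Q xs T ys \<Longrightarrow> T \<le> T' \<Longrightarrow> proc Q xs T' ys"
  unfolding proc_def by (blast intro: order_trans)

lemma wpb_mono: "wpb P c T Q s \<Longrightarrow> T \<le> T' \<Longrightarrow> (\<And>s'. Q s' \<Longrightarrow> Q' s') \<Longrightarrow> wpb P c T' Q' s"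
  unfolding wpb_def by (meson order_trans)

lemma wpb_Nil: "bnd (store s) \<Longrightarrow> 1 \<le> T \<Longrightarrow> Q s \<Longrightarrow> wpb P (block []) T Q s"
  unfolding wpb_def by (auto intro!: exI[of _ 1] exec.Skip)

lemma wpb_Seq:
  assumes "wpb P c T1 (\<lambda>s'. wpb P c2 (T - T1) Q s') s"
  shows "wpb P (Seq c c2) T Q s"
proof -
  obtain t s' t2 s'' where "exec W P c s t s'" "real t \<le> T1" "exec W P c2 s' t2 s''"
    "real t2 \<le> T - T1" "bnd (store s'')" "Q s''"
    using assms unfolding wpb_def by blast
  then show ?thesis unfolding wpb_def
    by (intro exI[of _ "t + t2"] exI[of _ s'']) (auto intro: exec.Seq)
qed

text \<open>The unspent budget travels along the program as \<open>T - T1\<close>. It need not be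
  shown nonnegative at each command: all costs accumulate in it and are checked once, at
  \<open>wpb_Nil\<close>.\<close>

lemma wpb_Cons:
  assumes "wpb P c T1 (\<lambda>s'. wpb P (block cs) (T - T1) Q s') s"
  shows "wpb P (block (c # cs)) T Q s"
  using wpb_Seq[OF assms] by simp

lemma wpb_Assign1:
  assumes "bnd \<sigma>" "esize i \<le> 40" "esize e \<le> 40" "ev i \<sigma> = j" "ev e \<sigma> = x" "x \<le> B"
    and "real (1 + cost i + cost e) \<le> T"
    and "Q (State (\<sigma>(k := (\<sigma> k)(j := x))) xs ys us vs)"
  shows "wpb P (Assign k i e) T Q (State \<sigma> xs ys us vs)"
  unfolding wpb_def
proof (intro exI conjI)
  show "exec W P (Assign k i e) (State \<sigma> xs ys us vs) (1 + cost i + cost e)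
    (set_cell k (val i (State \<sigma> xs ys us vs)) (val e (State \<sigma> xs ys us vs)) (State \<sigma> xs ys us vs))"
    by (rule exec.Assign) (use assms in \<open>auto intro: fits_small\<close>)
qed (use assms in \<open>auto simp: set_cell_def val_ev bnd_def\<close>)

lemma wpb_Read1:
  assumes "bnd \<sigma>" "esize i \<le> 40" "ev i \<sigma> = j" "x \<le> B"
    and "real (1 + cost i) \<le> T"
    and "Q (State (\<sigma>(k := (\<sigma> k)(j := x))) xs ys us vs)"
  shows "wpb P (Read k i) T Q (State \<sigma> (x # xs) ys us vs)"
  unfolding wpb_def
proof (intro exI conjI)
  show "exec W P (Read k i) (State \<sigma> (x # xs) ys us vs) (1 + cost i)
    ((set_cell k (val i (State \<sigma> (x # xs) ys us vs)) x (State \<sigma> (x # xs) ys us vs))\<lparr>inp := xs\<rparr>)"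
    by (rule exec.Read) (use assms B_le_W in \<open>auto intro: fits_small\<close>)
qed (use assms in \<open>auto simp: set_cell_def val_ev bnd_def\<close>)

lemma wpb_Fetch1:
  assumes "bnd \<sigma>" "esize i \<le> 40" "ev i \<sigma> = j" "x \<le> B"
    and "real (1 + cost i) \<le> T"
    and "Q (State (\<sigma>(k := (\<sigma> k)(j := x))) xs ys us vs)"
  shows "wpb P (Fetch k i) T Q (State \<sigma> xs ys us (x # vs))"
  unfolding wpb_def
proof (intro exI conjI)
  show "exec W P (Fetch k i) (State \<sigma> xs ys us (x # vs)) (1 + cost i)
    ((set_cell k (val i (State \<sigma> xs ys us (x # vs))) x (State \<sigma> xs ys us (x # vs)))\<lparr>res := vs\<rparr>)"
    by (rule exec.Fetch) (use assms B_le_W in \<open>auto intro: fits_small\<close>)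
qed (use assms in \<open>auto simp: set_cell_def val_ev bnd_def\<close>)

lemma wpb_Write1:
  assumes "bnd \<sigma>" "esize e \<le> 40" "ev e \<sigma> = x" "real (1 + cost e) \<le> T"
    and "Q (State \<sigma> xs (ys @ [x]) us vs)"
  shows "wpb P (Write e) T Q (State \<sigma> xs ys us vs)"
  unfolding wpb_def
proof (intro exI conjI)
  show "exec W P (Write e) (State \<sigma> xs ys us vs) (1 + cost e)
    ((State \<sigma> xs ys us vs)\<lparr>out := out (State \<sigma> xs ys us vs) @ [val e (State \<sigma> xs ys us vs)]\<rparr>)"
    by (rule exec.Write) (use assms in \<open>auto intro: fits_small\<close>)
qed (use assms in \<open>auto simp: val_ev\<close>)

lemma wpb_Pass1:
  assumes "bnd \<sigma>" "esize e \<le> 40" "ev e \<sigma> = x" "real (1 + cost e) \<le> T"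
    and "Q (State \<sigma> xs ys (us @ [x]) vs)"
  shows "wpb P (Pass e) T Q (State \<sigma> xs ys us vs)"
  unfolding wpb_def
proof (intro exI conjI)
  show "exec W P (Pass e) (State \<sigma> xs ys us vs) (1 + cost e)
    ((State \<sigma> xs ys us vs)\<lparr>arg := arg (State \<sigma> xs ys us vs) @ [val e (State \<sigma> xs ys us vs)]\<rparr>)"
    by (rule exec.Pass) (use assms in \<open>auto intro: fits_small\<close>)
qed (use assms in \<open>auto simp: val_ev\<close>)

lemma wpb_Assign:
  assumes "bnd \<sigma>" "esize i \<le> 40" "esize e \<le> 40" "ev i \<sigma> = j" "ev e \<sigma> = x" "x \<le> B"
    and "bnd (\<sigma>(k := (\<sigma> k)(j := x))) \<Longrightarrow>
      wpb P (block cs) (T - real (1 + cost i + cost e)) Q (State (\<sigma>(k := (\<sigma> k)(j := x))) xs ys us vs)"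
  shows "wpb P (block (Assign k i e # cs)) T Q (State \<sigma> xs ys us vs)"
  by (rule wpb_Cons, rule wpb_Assign1[OF assms(1-6) order_refl], rule assms(7))
    (use assms in \<open>auto simp: bnd_def\<close>)

lemma wpb_assign_reg:
  assumes "bnd \<sigma>" "esize e \<le> 40" "ev e \<sigma> = x" "x \<le> B"
    and "bnd (set_reg k x \<sigma>) \<Longrightarrow>
      wpb P (block cs) (T - real (2 + cost e)) Q (State (set_reg k x \<sigma>) xs ys us vs)"
  shows "wpb P (block (Assign k (Num 0) e # cs)) T Q (State \<sigma> xs ys us vs)"
  by (rule wpb_Assign[where j = 0 and x = x]) (use assms in \<open>auto simp: set_reg_def\<close>)

lemma wpb_read_reg:
  assumes "bnd \<sigma>" "x \<le> B"
    and "bnd (set_reg k x \<sigma>) \<Longrightarrow>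
      wpb P (block cs) (T - 2) Q (State (set_reg k x \<sigma>) xs ys us vs)"
  shows "wpb P (block (Read k (Num 0) # cs)) T Q (State \<sigma> (x # xs) ys us vs)"
proof (rule wpb_Cons, rule wpb_Read1[OF assms(1)])
  show "wpb P (block cs) (T - 2) Q (State (\<sigma>(k := (\<sigma> k)(0 := x))) xs ys us vs)"
    using assms by (auto simp: set_reg_def bnd_def)
qed (use assms in auto)

lemma wpb_Pass:
  assumes "bnd \<sigma>" "esize e \<le> 40" "ev e \<sigma> = x"
    and "wpb P (block cs) (T - real (1 + cost e)) Q (State \<sigma> xs ys (us @ [x]) vs)"
  shows "wpb P (block (Pass e # cs)) T Q (State \<sigma> xs ys us vs)"
  by (rule wpb_Cons, rule wpb_Pass1[OF assms(1-3) order_refl]) (rule assms(4))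

lemma wpb_Write:
  assumes "bnd \<sigma>" "esize e \<le> 40" "ev e \<sigma> = x"
    and "wpb P (block cs) (T - real (1 + cost e)) Q (State \<sigma> xs (ys @ [x]) us vs)"
  shows "wpb P (block (Write e # cs)) T Q (State \<sigma> xs ys us vs)"
  by (rule wpb_Cons, rule wpb_Write1[OF assms(1-3) order_refl]) (rule assms(4))

lemma wpb_Call:
  assumes "proc R us TR zs" "bnd \<sigma>"
    and "wpb P (block cs) (T - 1 - TR) Q (State \<sigma> xs ys [] zs)"
  shows "wpb P (block (Call R # cs)) T Q (State \<sigma> xs ys us vs)"
proof (rule wpb_Cons[where ?T1.0 = "1 + TR"])
  obtain t s' where "exec W R R (start zero_store us) t s'" "real t \<le> TR" "out s' = zs"
    using assms(1) unfolding proc_def by blast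
  moreover from this have "exec W P (Call R) (State \<sigma> xs ys us vs) (1 + t)
      ((State \<sigma> xs ys us vs)\<lparr>arg := [], res := out s'\<rparr>)"
    by (intro exec.Call) simp
  ultimately show "wpb P (Call R) (1 + TR) (wpb P (block cs) (T - (1 + TR)) Q) (State \<sigma> xs ys us vs)"
    using assms(2,3) unfolding wpb_def[of P "Call R"]
    by (intro exI[of _ "1 + t"] exI[of _ "State \<sigma> xs ys [] zs"]) (auto simp: algebra_simps)
qed

lemma wpb_Recur:
  assumes "proc P us TR zs" "bnd \<sigma>"
    and "wpb P (block cs) (T - 1 - TR) Q (State \<sigma> xs ys [] zs)"
  shows "wpb P (block (Recur # cs)) T Q (State \<sigma> xs ys us vs)"
proof (rule wpb_Cons[where ?T1.0 = "1 + TR"])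
  obtain t s' where "exec W P P (start zero_store us) t s'" "real t \<le> TR" "out s' = zs"
    using assms(1) unfolding proc_def by blast
  moreover from this have "exec W P Recur (State \<sigma> xs ys us vs) (1 + t)
      ((State \<sigma> xs ys us vs)\<lparr>arg := [], res := out s'\<rparr>)"
    by (intro exec.Recur) simp
  ultimately show "wpb P Recur (1 + TR) (wpb P (block cs) (T - (1 + TR)) Q) (State \<sigma> xs ys us vs)"
    using assms(2,3) unfolding wpb_def[of P Recur]
    by (intro exI[of _ "1 + t"] exI[of _ "State \<sigma> xs ys [] zs"]) (auto simp: algebra_simps)
qed

text \<open>A block ends in a \<open>Skip\<close> of cost 1, so cutting it in two adds one such
  step.\<close>

lemma exec_append:
  "exec W P (block (l1 @ l2)) s t s'' \<Longrightarrow>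
   \<exists>t1 t2 s'. exec W P (block l1) s t1 s' \<and> exec W P (block l2) s' t2 s'' \<and> t1 + t2 = t + 1"
proof (induction l1 arbitrary: s t)
  case Nil
  then show ?case by (intro exI[of _ 1] exI[of _ t] exI[of _ s]) (auto intro: exec.Skip[unfolded One_nat_def])
next
  case (Cons c l1)
  from Cons.prems obtain ta tb sm where 1: "exec W P c s ta sm" "exec W P (block (l1 @ l2)) sm tb s''"
    "t = ta + tb"
    by (auto elim: exec.cases)
  from Cons.IH[OF 1(2)] obtain t1 t2 s' where "exec W P (block l1) sm t1 s'"
    "exec W P (block l2) s' t2 s''" "t1 + t2 = tb + 1" by blast
  with 1 show ?case
    by (intro exI[of _ "ta + t1"] exI[of _ t2] exI[of _ s']) (auto intro: exec.Seq)
qed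

text \<open>The continuation \<open>cs\<close> is moved into both branches, so that no common
  postcondition has to be invented for them. The 2 pays for the conditional itself and for the
  \<open>Skip\<close> that ends the chosen branch.\<close>

lemma wpb_Cond:
  assumes "bnd \<sigma>" "esize e \<le> 40"
    and "ev e \<sigma> \<noteq> 0 \<Longrightarrow> wpb P (block (l1 @ cs)) (T - real (2 + cost e)) Q (State \<sigma> xs ys us vs)"
    and "ev e \<sigma> = 0 \<Longrightarrow> wpb P (block (l2 @ cs)) (T - real (2 + cost e)) Q (State \<sigma> xs ys us vs)"
  shows "wpb P (block (Cond e (block l1) (block l2) # cs)) T Q (State \<sigma> xs ys us vs)"
proof -
  let ?s = "State \<sigma> xs ys us vs"
  have f: "fits W e ?s" using assms by (auto intro: fits_small)
  obtain l where l: "wpb P (block (l @ cs)) (T - real (2 + cost e)) Q ?s"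
    and ex: "\<And>t s'. exec W P (block l) ?s t s' \<Longrightarrow> exec W P (Cond e (block l1) (block l2)) ?s (1 + cost e + t) s'"
  proof (cases "ev e \<sigma> = 0")
    case True
    then show ?thesis using that[of l2] assms(4) exec.CondF[OF f] by (simp add: val_ev)
  next
    case False
    then show ?thesis using that[of l1] assms(3) exec.CondT[OF f] by (simp add: val_ev)
  qed
  from l obtain t s'' where t: "exec W P (block (l @ cs)) ?s t s''" "real t \<le> T - real (2 + cost e)"
    "bnd (store s'')" "Q s''" unfolding wpb_def by blast
  from exec_append[OF t(1)] obtain t1 t2 s' where "exec W P (block l) ?s t1 s'"
    "exec W P (block cs) s' t2 s''" "t1 + t2 = t + 1" by blast
  then have "exec W P (block (Cond e (block l1) (block l2) # cs)) ?s (1 + cost e + t1 + t2) s''"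
    by (simp only: block.simps) (rule exec.Seq[OF ex])
  then show ?thesis unfolding wpb_def using t \<open>t1 + t2 = t + 1\<close>
    by (intro exI[of _ "1 + cost e + t1 + t2"] exI[of _ s'']) auto
qed

lemma wpb_while_aux:
  assumes step: "\<And>j \<tau> xs ys us vs. j < n \<Longrightarrow> bnd \<tau> \<Longrightarrow> I j \<tau> xs ys us vs \<Longrightarrow>
        wpb P c Tb (loop_post i j I)
         (State \<tau> xs ys us vs)"
    and regs: "\<And>j \<tau> xs ys us vs. I j \<tau> xs ys us vs \<Longrightarrow> \<tau> i 0 = j \<and> \<tau> m 0 = n"
  shows "j \<le> n \<Longrightarrow> bnd (store s) \<Longrightarrow> I j (store s) (inp s) (out s) (arg s) (res s) \<Longrightarrow>
    \<exists>t s'. exec W P (While (Bin OLess (reg i) (reg m)) (Seq c (Assign i (Num 0) (Bin OAdd (reg i) (Num 1))))) s t s' \<and>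
      real t \<le> real (n - j) * (Tb + 12) + 6 \<and> bnd (store s') \<and> I n (store s') (inp s') (out s') (arg s') (res s')"
proof (induction "n - j" arbitrary: j s)
  case 0
  then have "val (Bin OLess (reg i) (reg m)) s = 0" using regs[OF 0(4)] by simp
  then have "exec W P (While (Bin OLess (reg i) (reg m)) (Seq c (Assign i (Num 0) (Bin OAdd (reg i) (Num 1))))) s 6 s"
    using exec.WhileF[OF fits_small[OF 0(3)], of "Bin OLess (reg i) (reg m)" P] by (simp add: eval_nat_numeral)
  then show ?case using 0 by (intro exI[of _ 6] exI[of _ s]) auto
next
  case (Suc d)
  let ?e = "Bin OLess (reg i) (reg m)" and ?inc = "Assign i (Num 0) (Bin OAdd (reg i) (Num 1))"
  have j: "j < n" using Suc(2) by simp
  have v: "val ?e s \<noteq> 0" using regs[OF Suc(5)] j by simp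
  have ss: "s = State (store s) (inp s) (out s) (arg s) (res s)" by simp
  obtain t1 s1 where 1: "exec W P c s t1 s1" "real t1 \<le> Tb" "bnd (store s1)" "store s1 i 0 = j"
    "I (Suc j) (set_reg i (Suc j) (store s1)) (inp s1) (out s1) (arg s1) (res s1)"
    using step[OF j Suc(4,5)] unfolding wpb_def ss[symmetric] by blast
  define s2 where "s2 = set_cell i 0 (Suc j) s1"
  have s2: "store s2 = set_reg i (Suc j) (store s1)" "inp s2 = inp s1" "out s2 = out s1" "arg s2 = arg s1" "res s2 = res s1"
    by (auto simp: s2_def set_cell_def set_reg_def)
  have 2: "exec W P ?inc s1 6 s2"
    using exec.Assign[OF fits_small[OF 1(3)] fits_small[OF 1(3)], of "Num 0" "Bin OAdd (reg i) (Num 1)" P i] 1(4)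
    by (simp add: s2_def eval_nat_numeral)
  \<comment> \<open>The limit is itself the content of a cell, so no round pushes the counter past
    \<open>B\<close>.\<close>
  have "n \<le> B" using regs[OF Suc(5)] bnd_le[OF Suc(4), of m 0] by simp
  then have b2: "bnd (store s2)" using 1(3) j by (simp add: s2 bnd_set_reg)
  have "d = n - Suc j" using Suc(2) by simp
  from Suc(1)[OF this _ b2] obtain t3 s3 where
    3: "exec W P (While ?e (Seq c ?inc)) s2 t3 s3" "real t3 \<le> real (n - Suc j) * (Tb + 12) + 6"
    "bnd (store s3)" "I n (store s3) (inp s3) (out s3) (arg s3) (res s3)"
    using 1(5) j unfolding s2 by auto
  have f: "fits W ?e s" by (rule fits_small[OF Suc(4)]) simp
  have e: "exec W P (While ?e (Seq c ?inc)) s (1 + cost ?e + (t1 + 6) + t3) s3"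
    by (rule exec.WhileT[OF f v _ 3(1)], rule exec.Seq[OF 1(1) 2])
  have "real (n - j) = real (n - Suc j) + 1" using j by simp
  then have "real (1 + cost ?e + (t1 + 6) + t3) \<le> real (n - j) * (Tb + 12) + 6"
    using 1(2) 3(2) by (simp add: algebra_simps)
  then show ?case using e 3 by blast
qed

text \<open>In each round 6 steps go to the guard and 6 to the increment; setting the counter to 0
  takes 3 and the failing guard 6, together 9. The limit is reread from register \<open>m\<close> in
  every round, hence the invariant has to fix it.\<close>

lemma wpb_for:
  assumes "bnd \<sigma>" and init: "I 0 (set_reg i 0 \<sigma>) xs ys us vs"
    and step: "\<And>j \<tau> xs ys us vs. j < n \<Longrightarrow> bnd \<tau> \<Longrightarrow> I j \<tau> xs ys us vs \<Longrightarrow>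
        wpb P c Tb (loop_post i j I)
         (State \<tau> xs ys us vs)"
    and regs: "\<And>j \<tau> xs ys us vs. I j \<tau> xs ys us vs \<Longrightarrow> \<tau> i 0 = j \<and> \<tau> m 0 = n"
    and cont: "\<And>\<tau> xs ys us vs. bnd \<tau> \<Longrightarrow> I n \<tau> xs ys us vs \<Longrightarrow>
        wpb P (block cs) (T - (real n * (Tb + 12) + 9)) Q (State \<tau> xs ys us vs)"
  shows "wpb P (block (for_loop i m c # cs)) T Q (State \<sigma> xs ys us vs)"
proof (rule wpb_Cons[where ?T1.0 = "real n * (Tb + 12) + 9"])
  let ?s = "State \<sigma> xs ys us vs"
  let ?s1 = "State (set_reg i 0 \<sigma>) xs ys us vs"
  let ?w = "While (Bin OLess (reg i) (reg m)) (Seq c (Assign i (Num 0) (Bin OAdd (reg i) (Num 1))))"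
  have 1: "exec W P (Assign i (Num 0) (Num 0)) ?s 3 ?s1"
    using exec.Assign[of W "Num 0" ?s "Num 0" P i]
    by (simp add: set_cell_def set_reg_def eval_nat_numeral)
  have b1: "bnd (store ?s1)" using assms(1) by (simp add: bnd_set_reg)
  have "\<exists>t s'. exec W P ?w ?s1 t s' \<and> real t \<le> real (n - 0) * (Tb + 12) + 6 \<and>
    bnd (store s') \<and> I n (store s') (inp s') (out s') (arg s') (res s')"
  proof (rule wpb_while_aux[where I = I])
    show "bnd (store ?s1)" by (rule b1)
    show "I 0 (store ?s1) (inp ?s1) (out ?s1) (arg ?s1) (res ?s1)" using init by simp
  qed (fact step regs le0)+
  then obtain t s' where 2: "exec W P ?w ?s1 t s'" "real t \<le> real (n - 0) * (Tb + 12) + 6"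
    "bnd (store s')" "I n (store s') (inp s') (out s') (arg s') (res s')" by blast
  have "exec W P (for_loop i m c) ?s (3 + t) s'"
    unfolding for_loop_def by (rule exec.Seq[OF 1 2(1)])
  moreover have "wpb P (block cs) (T - (real n * (Tb + 12) + 9)) Q s'"
    using cont[OF 2(3,4)] by (cases s') simp
  ultimately show "wpb P (for_loop i m c) (real n * (Tb + 12) + 9)
      (wpb P (block cs) (T - (real n * (Tb + 12) + 9)) Q) ?s"
    unfolding wpb_def[of P "for_loop i m c"] using 2(2,3) by (intro exI[of _ "3 + t"] exI[of _ s']) auto
qed

lemma wpb_read_array:
  assumes "bnd \<sigma>" "\<sigma> m 0 = n" "n \<le> length xs" "\<And>k. k < n \<Longrightarrow> xs ! k \<le> B" "distinct [i, m, a]"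
    and "bnd (set_reg i n (\<sigma>(a := (\<lambda>k. if k < n then xs ! k else \<sigma> a k)))) \<Longrightarrow>
      wpb P (block cs) (T - (real n * 15 + 9)) Q
        (State (set_reg i n (\<sigma>(a := (\<lambda>k. if k < n then xs ! k else \<sigma> a k)))) (drop n xs) ys us vs)"
  shows "wpb P (block (for_loop i m (Read a (reg i)) # cs)) T Q (State \<sigma> xs ys us vs)"
proof (rule wpb_for[where I = "\<lambda>j \<tau> xs' ys' us' vs'.
     \<tau> = set_reg i j (\<sigma>(a := (\<lambda>k. if k < j then xs ! k else \<sigma> a k))) \<and> xs' = drop j xs \<and>
     ys' = ys \<and> us' = us \<and> vs' = vs" and Tb = 3 and n = n], goal_cases)
  case (3 j \<tau> xs' ys' us' vs')
  then have eq: "xs' = xs ! j # drop (Suc j) xs" using assms by (simp add: Cons_nth_drop_Suc)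
  show ?case unfolding eq
    by (rule wpb_Read1[OF 3(2)], simp, rule refl, use 3 assms in
      \<open>auto simp: fun_eq_iff set_reg_def less_Suc_eq\<close>)
qed (use assms in auto)

lemma wpb_fetch_array:
  assumes "bnd \<sigma>" "\<sigma> m 0 = n" "n \<le> length vs" "\<And>k. k < n \<Longrightarrow> vs ! k \<le> B" "distinct [i, m, a]"
    and "bnd (set_reg i n (\<sigma>(a := (\<lambda>k. if k < n then vs ! k else \<sigma> a k)))) \<Longrightarrow>
      wpb P (block cs) (T - (real n * 15 + 9)) Q
        (State (set_reg i n (\<sigma>(a := (\<lambda>k. if k < n then vs ! k else \<sigma> a k)))) xs ys us (drop n vs))"
  shows "wpb P (block (for_loop i m (Fetch a (reg i)) # cs)) T Q (State \<sigma> xs ys us vs)"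
proof (rule wpb_for[where I = "\<lambda>j \<tau> xs' ys' us' vs'.
     \<tau> = set_reg i j (\<sigma>(a := (\<lambda>k. if k < j then vs ! k else \<sigma> a k))) \<and> vs' = drop j vs \<and>
     ys' = ys \<and> us' = us \<and> xs' = xs" and Tb = 3 and n = n], goal_cases)
  case (3 j \<tau> xs' ys' us' vs')
  then have eq: "vs' = vs ! j # drop (Suc j) vs" using assms by (simp add: Cons_nth_drop_Suc)
  show ?case unfolding eq
    by (rule wpb_Fetch1[OF 3(2)], simp, rule refl, use 3 assms in
      \<open>auto simp: fun_eq_iff set_reg_def less_Suc_eq\<close>)
qed (use assms in auto)

lemma wpb_pass_loop:
  assumes "bnd \<sigma>" "\<sigma> m 0 = n" "esize e \<le> 40" "i \<noteq> m"
    and "\<And>k. k < n \<Longrightarrow> ev e (set_reg i k \<sigma>) = f k"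
    and "bnd (set_reg i n \<sigma>) \<Longrightarrow>
      wpb P (block cs) (T - (real n * (real (cost e) + 13) + 9)) Q
        (State (set_reg i n \<sigma>) xs ys (us @ map f [0..<n]) vs)"
  shows "wpb P (block (for_loop i m (Pass e) # cs)) T Q (State \<sigma> xs ys us vs)"
proof (rule wpb_for[where I = "\<lambda>j \<tau> xs' ys' us' vs'.
     \<tau> = set_reg i j \<sigma> \<and> xs' = xs \<and> ys' = ys \<and> us' = us @ map f [0..<j] \<and> vs' = vs"
     and Tb = "real (1 + cost e)" and n = n], goal_cases)
  case (3 j \<tau> xs' ys' us' vs')
  show ?case
    by (rule wpb_Pass1[OF 3(2) assms(3) refl], use 3 assms in \<open>auto simp: set_reg_def\<close>)
qed (use assms in \<open>auto simp: algebra_simps\<close>)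

lemma wpb_write_loop:
  assumes "bnd \<sigma>" "\<sigma> m 0 = n" "esize e \<le> 40" "i \<noteq> m"
    and "\<And>k. k < n \<Longrightarrow> ev e (set_reg i k \<sigma>) = f k"
    and "bnd (set_reg i n \<sigma>) \<Longrightarrow>
      wpb P (block cs) (T - (real n * (real (cost e) + 13) + 9)) Q
        (State (set_reg i n \<sigma>) xs (ys @ map f [0..<n]) us vs)"
  shows "wpb P (block (for_loop i m (Write e) # cs)) T Q (State \<sigma> xs ys us vs)"
proof (rule wpb_for[where I = "\<lambda>j \<tau> xs' ys' us' vs'.
     \<tau> = set_reg i j \<sigma> \<and> xs' = xs \<and> us' = us \<and> ys' = ys @ map f [0..<j] \<and> vs' = vs"
     and Tb = "real (1 + cost e)" and n = n], goal_cases)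
  case (3 j \<tau> xs' ys' us' vs')
  show ?case
    by (rule wpb_Write1[OF 3(2) assms(3) refl], use 3 assms in \<open>auto simp: set_reg_def\<close>)
qed (use assms in \<open>auto simp: algebra_simps\<close>)

text \<open>The expression may refer to the array being overwritten, but only at the current index:
  it is evaluated for every \<open>h\<close> that agrees with the old array there. This admits sums
  accumulated in place.\<close>

lemma wpb_map_loop:
  assumes "bnd \<sigma>" "\<sigma> m 0 = n" "esize e \<le> 40" "distinct [i, m, a]"
    and ev: "\<And>k h. k < n \<Longrightarrow> h k = \<sigma> a k \<Longrightarrow> ev e (set_reg i k (\<sigma>(a := h))) = f k"
    and "\<And>k. k < n \<Longrightarrow> f k \<le> B"
    and "bnd (set_reg i n (\<sigma>(a := (\<lambda>k. if k < n then f k else \<sigma> a k)))) \<Longrightarrow>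
      wpb P (block cs) (T - (real n * (real (cost e) + 15) + 9)) Q
        (State (set_reg i n (\<sigma>(a := (\<lambda>k. if k < n then f k else \<sigma> a k)))) xs ys us vs)"
  shows "wpb P (block (for_loop i m (Assign a (reg i) e) # cs)) T Q (State \<sigma> xs ys us vs)"
proof (rule wpb_for[where I = "\<lambda>j \<tau> xs' ys' us' vs'.
     \<tau> = set_reg i j (\<sigma>(a := (\<lambda>k. if k < j then f k else \<sigma> a k))) \<and> xs' = xs \<and>
     ys' = ys \<and> us' = us \<and> vs' = vs" and Tb = "real (3 + cost e)" and n = n], goal_cases)
  case (3 j \<tau> xs' ys' us' vs')
  have e: "ev e \<tau> = f j" using 3 by (simp add: ev)
  show ?case
    by (rule wpb_Assign1[OF 3(2) _ assms(3) refl e], use 3 assms in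
      \<open>auto simp: fun_eq_iff set_reg_def less_Suc_eq\<close>)
qed (use assms in \<open>auto simp: algebra_simps\<close>)

end

section \<open>Block matrix products\<close>

type_synonym bmat = "nat \<Rightarrow> nat \<Rightarrow> bit"

definition enc :: "nat \<Rightarrow> nat \<Rightarrow> bmat \<Rightarrow> nat list" where
  "enc r c M = map (\<lambda>k. word_of_bit (M (k div c) (k mod c))) [0..<r * c]"

lemma length_enc [simp]: "length (enc r c M) = r * c"
  by (simp add: enc_def)

lemma enc_nth [simp]: "k < r * c \<Longrightarrow> enc r c M ! k = word_of_bit (M (k div c) (k mod c))"
  by (simp add: enc_def)

lemma word_of_bit_le: "word_of_bit b \<le> 1"
  by (simp add: word_of_bit_def)

lemma word_of_bit_add: "a + b = c \<Longrightarrow> (word_of_bit a + word_of_bit b) mod 2 = word_of_bit c"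
  by (cases a; cases b) (auto simp: word_of_bit_def)

lemma word_of_bit_eq_0 [simp]: "word_of_bit b = 0 \<longleftrightarrow> b = 0"
  by (cases b) (simp_all add: word_of_bit_def)

lemma word_of_bit_0 [simp]: "word_of_bit 0 = 0"
  by (simp add: word_of_bit_def)

lemma sum_lessThan_add:
  fixes f :: "nat \<Rightarrow> 'a::comm_monoid_add"
  shows "(\<Sum>x<a + b. f x) = (\<Sum>x<a. f x) + (\<Sum>x<b. f (a + x))"
  by (induction b) (simp_all add: add.assoc)

lemma map_upt_add: "map g [0..<a + b] = map g [0..<a] @ map (\<lambda>k. g (a + k)) [0..<b]"
  by (induction b) simp_all

lemma index_div_mod:
  assumes "b < (s::nat)"
  shows "(a * s + b) div s = a" "(a * s + b) mod s = b"
  using assms by auto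

lemma index_less:
  assumes "a < r" "b < (s::nat)"
  shows "a * s + b < r * s"
proof -
  have "a * s + b < Suc a * s" using assms by simp
  also have "\<dots> \<le> r * s" using assms by (intro mult_le_mono1) simp
  finally show ?thesis .
qed

lemma enc_mat_eq:
  assumes "A \<in> carrier_mat n n"
  shows "enc_mat A = enc n n (\<lambda>i j. A $$ (i, j))"
proof (cases "n = 0")
  case True
  then show ?thesis using assms by (simp add: enc_mat_def enc_def mat_to_list_def)
next
  case False
  have *: "concat (map (\<lambda>i. map (\<lambda>j. f i j) [0..<n]) [0..<r]) = map (\<lambda>k. f (k div n) (k mod n)) [0..<r * n]"
    for f :: "nat \<Rightarrow> nat \<Rightarrow> bit" and r
  proof (induction r)
    case (Suc r)
    then show ?case using map_upt_add[of "\<lambda>k. f (k div n) (k mod n)" "r * n" n] False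
      by (simp add: add.commute)
  qed simp
  have "concat (mat_to_list A) = map (\<lambda>k. A $$ (k div n, k mod n)) [0..<n * n]"
    unfolding mat_to_list_def using assms *[of "\<lambda>i j. A $$ (i, j)" n] by auto
  then show ?thesis by (simp add: enc_mat_def enc_def)
qed

definition mmul ::
  "nat \<Rightarrow> (nat \<Rightarrow> nat \<Rightarrow> 'a::comm_ring_1) \<Rightarrow> (nat \<Rightarrow> nat \<Rightarrow> 'a) \<Rightarrow> nat \<Rightarrow> nat \<Rightarrow> 'a" where
  "mmul n A M = (\<lambda>i j. \<Sum>k<n. A i k * M k j)"

text \<open>Transposing the left factor lets two matrices of the same tall shape be multiplied; the
  blocks are transposed while they are passed to the multiplication program.\<close>

definition tmul ::
  "nat \<Rightarrow> (nat \<Rightarrow> nat \<Rightarrow> 'a::comm_ring_1) \<Rightarrow> (nat \<Rightarrow> nat \<Rightarrow> 'a) \<Rightarrow> nat \<Rightarrow> nat \<Rightarrow> 'a" where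
  "tmul n A M = (\<lambda>i j. \<Sum>k<n. A k i * M k j)"

lemma enc_mat_times:
  assumes "A \<in> carrier_mat n n" "M \<in> carrier_mat n n"
  shows "enc_mat (A * M) = enc n n (mmul n (\<lambda>i j. A $$ (i, j)) (\<lambda>i j. M $$ (i, j)))"
proof -
  have "enc_mat (A * M) = enc n n (\<lambda>i j. (A * M) $$ (i, j))"
    using assms by (intro enc_mat_eq) auto
  also have "\<dots> = enc n n (mmul n (\<lambda>i j. A $$ (i, j)) (\<lambda>i j. M $$ (i, j)))"
    unfolding enc_def
  proof (rule map_cong[OF refl])
    fix k assume "k \<in> set [0..<n * n]"
    then have "k div n < n" "k mod n < n" by (auto simp: less_mult_imp_div_less) (metis mod_less_divisor mult_is_0 neq0_conv not_less0)
    then show "word_of_bit ((A * M) $$ (k div n, k mod n)) =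
        word_of_bit (mmul n (\<lambda>i j. A $$ (i, j)) (\<lambda>i j. M $$ (i, j)) (k div n) (k mod n))"
      using assms by (auto simp: mmul_def scalar_prod_def atLeast0LessThan intro!: arg_cong[of _ _ word_of_bit] sum.cong)
  qed
  finally show ?thesis .
qed

abbreviation add_mod2 :: "exp \<Rightarrow> exp \<Rightarrow> exp" where
  "add_mod2 e1 e2 \<equiv> Bin OMod (Bin OAdd e1 e2) (Num 2)"

text \<open>The two shapes of products needed: \<open>tn_prog\<close> computes the \<open>s \<times> s\<close> matrix \<open>M\<^sup>T M'\<close> and \<open>nn_prog\<close>
  the product \<open>M M'\<close> with an \<open>s \<times> s\<close> matrix \<open>M'\<close>, where \<open>M\<close> consists of \<open>q\<close> square blocks on top of each other.\<close>

abbreviation tn_body :: "com \<Rightarrow> com" where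
  "tn_body P \<equiv> block [Pass (reg 1),
       for_loop 4 3 (Pass (Cell 10 (Bin OAdd (Bin OMul (Bin OAdd (Bin OMul (reg 5) (reg 1)) (Bin OMod (reg 4) (reg 1))) (reg 1)) (Bin ODiv (reg 4) (reg 1))))),
       for_loop 4 3 (Pass (Cell 11 (Bin OAdd (Bin OMul (reg 5) (reg 3)) (reg 4)))),
       Call P,
       for_loop 4 3 (Fetch 13 (reg 4)),
       for_loop 4 3 (Assign 12 (reg 4) (add_mod2 (Cell 12 (reg 4)) (Cell 13 (reg 4))))]"

definition tn_prog :: "com \<Rightarrow> com" where
  "tn_prog P = block [Read 0 (Num 0), Read 1 (Num 0),
     Assign 3 (Num 0) (Bin OMul (reg 1) (reg 1)), Assign 2 (Num 0) (Bin OMul (reg 0) (reg 3)),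
     for_loop 4 2 (Read 10 (reg 4)), for_loop 4 2 (Read 11 (reg 4)),
     for_loop 5 0 (tn_body P),
     for_loop 4 3 (Write (Cell 12 (reg 4)))]"

abbreviation nn_body :: "com \<Rightarrow> com" where
  "nn_body P \<equiv> block [Pass (reg 1),
       for_loop 4 3 (Pass (Cell 10 (Bin OAdd (Bin OMul (reg 5) (reg 3)) (reg 4)))),
       for_loop 4 3 (Pass (Cell 11 (reg 4))),
       Call P,
       for_loop 4 3 (Fetch 13 (reg 4)),
       for_loop 4 3 (Write (Cell 13 (reg 4)))]"

definition nn_prog :: "com \<Rightarrow> com" where
  "nn_prog P = block [Read 0 (Num 0), Read 1 (Num 0),
     Assign 3 (Num 0) (Bin OMul (reg 1) (reg 1)), Assign 2 (Num 0) (Bin OMul (reg 0) (reg 3)),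
     for_loop 4 2 (Read 10 (reg 4)), for_loop 4 3 (Read 11 (reg 4)),
     for_loop 5 0 (nn_body P)]"

text \<open>\<open>Nmax\<close> limits the dimensions at which the multiplication program is called.
  Its square against \<open>B\<close> leaves room for the entry counts and indices of matrices with
  \<open>Nmax\<close> rows and up to twice as many columns.\<close>

locale mul_machine = machine +
  fixes P :: com and C \<omega> :: real and Nmax :: nat
  assumes omega: "2 < \<omega>" and C: "0 \<le> C" and Nmax: "8 * (Nmax + 1)\<^sup>2 \<le> B"
    and mul: "\<And>s A M. 1 \<le> s \<Longrightarrow> s \<le> Nmax \<Longrightarrow>
      proc P (s # enc s s A @ enc s s M) (C * real s powr \<omega>) (enc s s (mmul s A M))"
begin

lemma sq_le_powr:
  assumes "1 \<le> s"
  shows "real (s * s) \<le> real s powr \<omega>"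
proof -
  have "real (s * s) = real s powr 2" using assms by (simp add: power2_eq_square)
  also have "\<dots> \<le> real s powr \<omega>" using assms omega by (intro powr_mono) auto
  finally show ?thesis .
qed

lemma word_le_B: "word_of_bit b \<le> B"
  using two_le_B word_of_bit_le[of b] by linarith

lemma small_le_B:
  assumes "x \<le> Nmax" "y \<le> Nmax"
  shows "x * y \<le> B" "x \<le> B"
proof -
  have "x * y \<le> Nmax * Nmax" using assms by (rule mult_le_mono)
  also have "\<dots> \<le> B" using Nmax by (simp add: power2_eq_square)
  finally show "x * y \<le> B" .
  show "x \<le> B" using assms Nmax by (simp add: power2_eq_square)
qed

text \<open>The result is the sum of the products of corresponding blocks, so \<open>q\<close>
  multiplications of size \<open>s\<close> and \<open>q\<close> additions suffice. Copying a block
  takes O(s^2) time, which \<open>sq_le_powr\<close> absorbs; the 400 covers all of it.\<close>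

lemma tn_proc:
  assumes s: "1 \<le> s" and q: "1 \<le> q" and qs: "q * s \<le> Nmax"
  shows "proc (tn_prog P) (q # s # enc (q * s) s M @ enc (q * s) s M')
    ((C + 400) * real q * real s powr \<omega>) (enc s s (tmul (q * s) M M'))"
proof (rule procI)
  define m where "m = q * s * s"
  define f where "f = real s powr \<omega>"
  have sN: "s \<le> Nmax" "q \<le> Nmax" using s q qs by (auto intro: order_trans[rotated])
  have mB: "q * (s * s) \<le> B" "s * s \<le> B" "q \<le> B" "s \<le> B" using small_le_B[OF qs sN(1)] small_le_B[OF sN(1) sN(1)] small_le_B(2)[OF sN(2) sN(2)]
    by (auto simp: mult.assoc)
  have s0: "0 < s" using s by simp
  have kdiv: "k div s < s" "k mod s < s" if "k < s * s" for k
    using that s0 by (auto simp: less_mult_imp_div_less)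
  have idx: "l * (s * s) + k < q * (s * s)" "(l * (s * s) + k) div s = l * s + k div s" "(l * (s * s) + k) mod s = k mod s"
    "(l * s + k mod s) * s + k div s < q * (s * s)" 
    if "l < q" "k < s * s" for k l
  proof -
    show "l * (s * s) + k < q * (s * s)" using that by (rule index_less)
    have "l * s + k mod s < q * s" using that kdiv by (intro index_less) auto
    from index_less[OF this kdiv(1)[OF that(2)]]
    show "(l * s + k mod s) * s + k div s < q * (s * s)" by (simp add: mult.assoc)
    have e: "l * (s * s) + k = k + s * (l * s)" by (simp add: algebra_simps)
    show "(l * (s * s) + k) div s = l * s + k div s" unfolding e using s0 by simp
    show "(l * (s * s) + k) mod s = k mod s" unfolding e by simp
  qed
  define I :: invariant where "I = (\<lambda>l \<tau> xs ys us vs.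
    \<tau> 0 0 = q \<and> \<tau> 1 0 = s \<and> \<tau> 3 0 = s * s \<and> \<tau> 5 0 = l \<and>
    (\<forall>k<q * (s * s). \<tau> 10 k = word_of_bit (M (k div s) (k mod s))) \<and>
    (\<forall>k<q * (s * s). \<tau> 11 k = word_of_bit (M' (k div s) (k mod s))) \<and>
    (\<forall>k<s * s. \<tau> 12 k = word_of_bit (tmul (l * s) M M' (k div s) (k mod s))) \<and> ys = [] \<and> us = [])"
  have fq: "real (s * s) \<le> f" "1 \<le> real (s * s)" "1 \<le> real q"
    using sq_le_powr[OF s] s q unfolding f_def by auto (metis One_nat_def mult_le_mono nat_mult_1 of_nat_1 of_nat_le_iff of_nat_mult s)
  have fq3: "real q * (real s * real s) \<le> f * real q" "real s * real s \<le> real q * (real s * real s)"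
    "real q \<le> real q * (real s * real s)" "1 \<le> real q"
    using fq mult_left_mono[of "real (s * s)" f "real q"] mult_right_mono[of 1 "real q" "real (s * s)"]
      mult_left_mono[of 1 "real (s * s)" "real q"] by (auto simp: mult.commute)
  have step: "wpb R (tn_body P)
     (C * f + real (s * s) * 140 + 60)
     (loop_post 5 l I)
     (State \<tau> xs ys us vs)" if l: "l < q" and b: "bnd \<tau>" and inv: "I l \<tau> xs ys us vs" for R l \<tau> xs ys us vs
  proof -
    have r: "\<tau> 0 0 = q" "\<tau> 1 0 = s" "\<tau> (Suc 0) 0 = s" "\<tau> 3 0 = s * s" "\<tau> 5 0 = l" "ys = []" "us = []"
      and a: "\<And>k. k<q * (s * s) \<Longrightarrow> \<tau> 10 k = word_of_bit (M (k div s) (k mod s))"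
      "\<And>k. k<q * (s * s) \<Longrightarrow> \<tau> 11 k = word_of_bit (M' (k div s) (k mod s))"
      "\<And>k. k<s * s \<Longrightarrow> \<tau> 12 k = word_of_bit (tmul (l * s) M M' (k div s) (k mod s))"
      using inv by (simp_all add: I_def)
    \<comment> \<open>What block \<open>l\<close> contributes to the sum over all rows.\<close>
    define D where "D = (\<lambda>a b. \<Sum>x<s. M (l * s + x) a * M' (l * s + x) b)"
    have D: "tmul (l * s) M M' a b + D a b = tmul (Suc l * s) M M' a b" for a b
    proof -
      have "tmul (Suc l * s) M M' a b = (\<Sum>x<l * s + s. M x a * M' x b)" by (simp add: tmul_def add.commute)
      also have "\<dots> = tmul (l * s) M M' a b + D a b"
        by (simp add: sum_lessThan_add tmul_def D_def)
      finally show ?thesis by simp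
    qed
    show ?thesis
      apply (rule wpb_Pass[OF b], simp, simp)
      apply (rule wpb_pass_loop[where n = "s * s" and f = "\<lambda>k. word_of_bit (M (l * s + k mod s) (k div s))"], rule b, simp add: r, simp, simp)
       apply (simp add: r a idx l index_div_mod kdiv)
      apply (rule wpb_pass_loop[where n = "s * s" and f = "\<lambda>k. word_of_bit (M' (l * s + k div s) (k mod s))"], assumption, simp add: r, simp, simp)
       apply (simp add: r a idx l index_div_mod kdiv)
      apply (rule wpb_Call[where TR = "C * f" and zs = "enc s s D"])
        apply (use mul[OF s sN(1), of "\<lambda>a b. M (l * s + b) a" "\<lambda>a b. M' (l * s + a) b"] in \<open>simp add: enc_def mmul_def f_def r D_def\<close>)
       apply assumption
      apply (rule wpb_fetch_array[where n = "s * s"], assumption, simp add: r, simp, simp add: word_le_B, simp)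
      apply (rule wpb_map_loop[where n = "s * s" and f = "\<lambda>k. word_of_bit (tmul (Suc l * s) M M' (k div s) (k mod s))"], assumption, simp add: r, simp, simp)
        apply (simp add: a del: mult_Suc, rule word_of_bit_add, rule D)
       apply (simp add: word_le_B)
      apply (rule wpb_Nil, simp, simp add: algebra_simps)
      apply (simp add: I_def r a)
      done
  qed
  show "wpb (tn_prog P) (tn_prog P) ((C + 400) * real q * real s powr \<omega>)
     (\<lambda>st. out st = enc s s (tmul (q * s) M M'))
     (State zero_store (q # s # enc (q * s) s M @ enc (q * s) s M') [] [] [])"
    apply (subst (2) tn_prog_def)
    apply (rule wpb_read_reg, rule bnd_zero, simp add: mB)
    apply (rule wpb_read_reg, assumption, simp add: mB)
    apply (rule wpb_assign_reg, assumption, simp, simp, simp add: mB)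
    apply (rule wpb_assign_reg, assumption, simp, simp, simp add: mB)
    apply (rule wpb_read_array[where n = "q * (s * s)"], assumption, simp, simp, simp add: nth_append mult.assoc word_le_B, simp)
    apply (rule wpb_read_array[where n = "q * (s * s)"], assumption, simp, simp, simp add: nth_append mult.assoc word_le_B, simp)
    apply (rule wpb_for[where I = I and n = q and Tb = "C * f + real (s * s) * 140 + 60"], assumption)
       \<comment> \<open>Array 12 is zero in a fresh memory, which is the empty sum that the
         accumulation starts from.\<close>
       apply (simp add: I_def nth_append mult.assoc tmul_def zero_store_def)
      apply (rule step; assumption)
     apply (simp add: I_def)
    apply (rule wpb_write_loop[where n = "s * s" and f = "\<lambda>k. word_of_bit (tmul (q * s) M M' (k div s) (k mod s))"], assumption, simp add: I_def, simp, simp)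
     apply (simp add: I_def)
    apply (rule wpb_Nil, simp)
     apply (simp add: algebra_simps flip: f_def, use fq3 in linarith)
    apply (simp add: I_def enc_def)
    done
qed

text \<open>Every block of \<open>M\<close> meets the same right factor, so each product is a
  finished, contiguous piece of the row-major result and is written at once.\<close>

lemma nn_proc:
  assumes s: "1 \<le> s" and q: "1 \<le> q" and qs: "q * s \<le> Nmax"
  shows "proc (nn_prog P) (q # s # enc (q * s) s M @ enc s s M')
    ((C + 400) * real q * real s powr \<omega>) (enc (q * s) s (mmul s M M'))"
proof (rule procI)
  define f where "f = real s powr \<omega>"
  have sN: "s \<le> Nmax" "q \<le> Nmax" using s q qs by (auto intro: order_trans[rotated])
  have mB: "q * (s * s) \<le> B" "s * s \<le> B" "q \<le> B" "s \<le> B" using small_le_B[OF qs sN(1)] small_le_B[OF sN(1) sN(1)] small_le_B(2)[OF sN(2) sN(2)]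
    by (auto simp: mult.assoc)
  have s0: "0 < s" using s by simp
  have idx: "l * (s * s) + k < q * (s * s)" "(l * (s * s) + k) div s = l * s + k div s" "(l * (s * s) + k) mod s = k mod s"
    if "l < q" "k < s * s" for k l
  proof -
    show "l * (s * s) + k < q * (s * s)" using that by (rule index_less)
    have e: "l * (s * s) + k = k + s * (l * s)" by (simp add: algebra_simps)
    show "(l * (s * s) + k) div s = l * s + k div s" unfolding e using s0 by simp
    show "(l * (s * s) + k) mod s = k mod s" unfolding e by simp
  qed
  define g where "g = (\<lambda>k. word_of_bit (mmul s M M' (k div s) (k mod s)))"
  define I :: invariant where "I = (\<lambda>l \<tau> xs ys us vs.
    \<tau> 0 0 = q \<and> \<tau> 1 0 = s \<and> \<tau> 3 0 = s * s \<and> \<tau> 5 0 = l \<and>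
    (\<forall>k<q * (s * s). \<tau> 10 k = word_of_bit (M (k div s) (k mod s))) \<and>
    (\<forall>k<s * s. \<tau> 11 k = word_of_bit (M' (k div s) (k mod s))) \<and>
    ys = map g [0..<l * (s * s)] \<and> us = [])"
  have fq: "real (s * s) \<le> f" "1 \<le> real (s * s)" "1 \<le> real q"
    using sq_le_powr[OF s] s q unfolding f_def by auto (metis One_nat_def mult_le_mono nat_mult_1 of_nat_1 of_nat_le_iff of_nat_mult s)
  have fq3: "real q * (real s * real s) \<le> f * real q" "real s * real s \<le> real q * (real s * real s)"
    "real q \<le> real q * (real s * real s)" "1 \<le> real q"
    using fq mult_left_mono[of "real (s * s)" f "real q"] mult_right_mono[of 1 "real q" "real (s * s)"]
      mult_left_mono[of 1 "real (s * s)" "real q"] by (auto simp: mult.commute)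
  have step: "wpb R (nn_body P)
     (C * f + real (s * s) * 140 + 60)
     (loop_post 5 l I)
     (State \<tau> xs ys us vs)" if l: "l < q" and b: "bnd \<tau>" and inv: "I l \<tau> xs ys us vs" for R l \<tau> xs ys us vs
  proof -
    have r: "\<tau> 0 0 = q" "\<tau> 1 0 = s" "\<tau> (Suc 0) 0 = s" "\<tau> 3 0 = s * s" "\<tau> 5 0 = l" "us = []"
      "ys = map g [0..<l * (s * s)]"
      and a: "\<And>k. k<q * (s * s) \<Longrightarrow> \<tau> 10 k = word_of_bit (M (k div s) (k mod s))"
      "\<And>k. k<s * s \<Longrightarrow> \<tau> 11 k = word_of_bit (M' (k div s) (k mod s))"
      using inv by (simp_all add: I_def)
    have app: "map g [0..<l * (s * s)] @ map (\<lambda>k. g (l * (s * s) + k)) [0..<s * s] = map g [0..<Suc l * (s * s)]"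
      using map_upt_add[of g "l * (s * s)" "s * s"] by (simp add: add.commute)
    show ?thesis
      apply (rule wpb_Pass[OF b], simp, simp)
      apply (rule wpb_pass_loop[where n = "s * s" and f = "\<lambda>k. word_of_bit (M (l * s + k div s) (k mod s))"], rule b, simp add: r, simp, simp)
       apply (simp add: r a idx l)
      apply (rule wpb_pass_loop[where n = "s * s" and f = "\<lambda>k. word_of_bit (M' (k div s) (k mod s))"], assumption, simp add: r, simp, simp)
       apply (simp add: r a)
      apply (rule wpb_Call[where TR = "C * f" and zs = "enc s s (mmul s (\<lambda>a b. M (l * s + a) b) M')"])
        apply (use mul[OF s sN(1), of "\<lambda>a b. M (l * s + a) b" M'] in \<open>simp add: enc_def f_def r\<close>)
       apply assumption
      apply (rule wpb_fetch_array[where n = "s * s"], assumption, simp add: r, simp, simp add: word_le_B, simp)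
      apply (rule wpb_write_loop[where n = "s * s" and f = "\<lambda>k. g (l * (s * s) + k)"], assumption, simp add: r, simp, simp)
       apply (simp add: g_def idx l mmul_def)
      apply (rule wpb_Nil, simp, simp add: algebra_simps)
      apply (simp add: I_def r a app del: mult_Suc upt_Suc)
      done
  qed
  show "wpb (nn_prog P) (nn_prog P) ((C + 400) * real q * real s powr \<omega>)
     (\<lambda>st. out st = enc (q * s) s (mmul s M M'))
     (State zero_store (q # s # enc (q * s) s M @ enc s s M') [] [] [])"
    apply (subst (2) nn_prog_def)
    apply (rule wpb_read_reg, rule bnd_zero, simp add: mB)
    apply (rule wpb_read_reg, assumption, simp add: mB)
    apply (rule wpb_assign_reg, assumption, simp, simp, simp add: mB)
    apply (rule wpb_assign_reg, assumption, simp, simp, simp add: mB)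
    apply (rule wpb_read_array[where n = "q * (s * s)"], assumption, simp, simp, simp add: nth_append mult.assoc word_le_B, simp)
    apply (rule wpb_read_array[where n = "s * s"], assumption, simp, simp, simp add: nth_append mult.assoc word_le_B, simp)
    apply (rule wpb_for[where I = I and n = q and Tb = "C * f + real (s * s) * 140 + 60"], assumption)
       apply (simp add: I_def nth_append mult.assoc)
      apply (rule step; assumption)
     apply (simp add: I_def)
    apply (rule wpb_Nil, simp)
     apply (simp add: algebra_simps flip: f_def, use fq3 in linarith)
    apply (simp add: I_def enc_def g_def mult.assoc)
    done
qed

end

section \<open>Generalized inverses\<close>

text \<open>The generalized inverse is the transpose of \<open>G\<close>, so that \<open>G\<close> has the same shape as \<open>A\<close> and
  \<open>tmul N G A\<close> is the product of the generalized inverse with \<open>A\<close>. The nonzero columns of \<open>G\<close> mark a basis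
  among the columns of \<open>A\<close>; by the last condition a column is expressed by basis columns not to its right.\<close>

definition ginverse :: "nat \<Rightarrow> nat \<Rightarrow> (nat \<Rightarrow> nat \<Rightarrow> 'a::comm_ring_1) \<Rightarrow> (nat \<Rightarrow> nat \<Rightarrow> 'a) \<Rightarrow> bool" where
  "ginverse N w A G \<longleftrightarrow>
     (\<forall>i<N. \<forall>j<w. mmul w A (tmul N G A) i j = A i j) \<and>
     (\<forall>j<w. (\<forall>i<N. G i j = 0) \<or> (\<forall>a<w. tmul N G A a j = of_bool (a = j))) \<and>
     (\<forall>a<w. \<forall>j<a. tmul N G A a j = 0)"

definition glue :: "nat \<Rightarrow> (nat \<Rightarrow> nat \<Rightarrow> 'a::comm_ring_1) \<Rightarrow> (nat \<Rightarrow> nat \<Rightarrow> 'a) \<Rightarrow> nat \<Rightarrow> nat \<Rightarrow> 'a" where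
  "glue s U V = (\<lambda>i j. if j < s then U i j else V i (j - s))"

text \<open>In matrix form (G Y)^T A = Y^T (G^T A), by exchanging two finite sums. It moves a right
  factor of a transposed generalized inverse out of the product with \<open>A\<close>.\<close>

lemma tmul_swap_mmul:
  "(\<Sum>i<N. mmul s G Y i b * A i j) = (\<Sum>c<s. tmul N G A c j * Y c b)"
proof -
  have "(\<Sum>i<N. mmul s G Y i b * A i j) = (\<Sum>i<N. \<Sum>c<s. G i c * A i j * Y c b)"
    by (simp add: mmul_def sum_distrib_right sum_distrib_left mult_ac)
  also have "\<dots> = (\<Sum>c<s. \<Sum>i<N. G i c * A i j * Y c b)" by (rule sum.swap)
  also have "\<dots> = (\<Sum>c<s. tmul N G A c j * Y c b)"
    by (simp add: tmul_def sum_distrib_right)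
  finally show ?thesis .
qed

lemma sum_mmul_assoc:
  "(\<Sum>a<s. A i a * (\<Sum>b<s. X a b * Z b j)) = (\<Sum>b<s. mmul s A X i b * (Z b j :: 'a::comm_ring_1))"
proof -
  have "(\<Sum>a<s. A i a * (\<Sum>b<s. X a b * Z b j)) = (\<Sum>a<s. \<Sum>b<s. A i a * X a b * Z b j)"
    by (simp add: sum_distrib_left mult_ac)
  also have "\<dots> = (\<Sum>b<s. \<Sum>a<s. A i a * X a b * Z b j)" by (rule sum.swap)
  also have "\<dots> = (\<Sum>b<s. mmul s A X i b * Z b j)"
    by (simp add: mmul_def sum_distrib_right)
  finally show ?thesis .
qed

text \<open>In characteristic 2 every minus becomes a plus. Let A1 be the left half of
  \<open>A\<close>. The product of the new generalized inverse with \<open>A\<close> is block upper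
  triangular, with rows (G1^T A1, X + X H^T M) and (0, H^T M), and all three clauses of
  \<open>ginverse\<close> are read off from this form.\<close>

lemma ginverse_step:
  fixes A :: "nat \<Rightarrow> nat \<Rightarrow> 'a::comm_ring_1" and N s :: nat
  assumes char2: "\<And>x::'a. x + x = 0"
  defines "A2 \<equiv> (\<lambda>i j. A i (s + j))"
  assumes G1: "ginverse N s A G1"
  defines "X \<equiv> tmul N G1 A2"
  defines "M \<equiv> (\<lambda>i j. A2 i j + mmul s A X i j)"
  assumes H: "ginverse N s M H"
  defines "Y \<equiv> tmul N A H"
  defines "H' \<equiv> (\<lambda>i j. H i j + mmul s G1 Y i j)"
  defines "G \<equiv> glue s (\<lambda>i j. G1 i j + mmul s H' (\<lambda>a b. X b a) i j) H'"
  shows "ginverse N (s + s) A G"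
proof -
  have cancel: "x + (x + y) = y" "x + y = z \<longleftrightarrow> y = x + z" for x y z :: 'a
  proof -
    show c: "x + (x + y) = y" for x y :: 'a using char2[of x] by (simp flip: add.assoc)
    show "x + y = z \<longleftrightarrow> y = x + z" using c by metis
  qed
  have low: "tmul N H' A b j = (\<Sum>i<N. H i b * (A i j + mmul s A (tmul N G1 A) i j))" for b j
  proof -
    have "tmul N H' A b j = tmul N H A b j + (\<Sum>i<N. mmul s G1 Y i b * A i j)"
      by (simp add: tmul_def H'_def distrib_right sum.distrib)
    also have "(\<Sum>i<N. mmul s G1 Y i b * A i j) = (\<Sum>c<s. tmul N G1 A c j * Y c b)"
      by (rule tmul_swap_mmul)
    also have "\<dots> = (\<Sum>c<s. \<Sum>i<N. H i b * (A i c * tmul N G1 A c j))"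
      by (simp add: Y_def tmul_def[of N A H] sum_distrib_left mult_ac)
    also have "\<dots> = (\<Sum>i<N. \<Sum>c<s. H i b * (A i c * tmul N G1 A c j))" by (rule sum.swap)
    also have "\<dots> = (\<Sum>i<N. H i b * mmul s A (tmul N G1 A) i j)"
      by (simp add: mmul_def sum_distrib_left)
    finally show ?thesis by (simp add: tmul_def[of N H A] distrib_left sum.distrib)
  qed
  \<comment> \<open>The factor I + A1 G1^T inside \<open>H'\<close> kills the left half, as A1 + A1
    G1^T A1 = 0; below, the same factor turns A2 into \<open>M\<close>.\<close>
  have low1: "tmul N H' A b j = 0" if "j < s" for b j
    unfolding low using G1 that char2 by (intro sum.neutral) (simp add: ginverse_def)
  have X: "tmul N G1 A c (s + j) = X c j" for c j by (simp add: X_def tmul_def A2_def)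
  have low2: "tmul N H' A b (s + j) = tmul N H M b j" for b j
    unfolding low by (simp add: mmul_def X) (simp add: tmul_def M_def mmul_def A2_def)
  have top: "tmul N G A a j = tmul N G1 A a j + (\<Sum>b<s. X a b * tmul N H' A b j)" if "a < s" for a j
  proof -
    have "tmul N G A a j = tmul N G1 A a j + (\<Sum>i<N. mmul s H' (\<lambda>a b. X b a) i a * A i j)"
      using that by (simp add: tmul_def G_def glue_def distrib_right sum.distrib)
    then show ?thesis unfolding tmul_swap_mmul by (simp add: mult.commute)
  qed
  have GA1: "tmul N G A a j = tmul N G1 A a j" if "a < s" "j < s" for a j
    using top[OF that(1), of j] low1[OF that(2)] by simp
  have GA2: "tmul N G A a (s + j) = X a j + (\<Sum>b<s. X a b * tmul N H M b j)" if "a < s" for a j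
    using top[OF that, of "s + j"] by (simp add: X low2)
  have GA3: "tmul N G A (s + b) j = tmul N H' A b j" for b j
    by (simp add: tmul_def G_def glue_def)
  have cases: "(\<forall>j<s + s. Q j) \<longleftrightarrow> (\<forall>j<s. Q j \<and> Q (s + j))" for Q
  proof (intro iffI allI impI)
    fix j assume Q: "\<forall>j<s. Q j \<and> Q (s + j)" and j: "j < s + s"
    show "Q j"
    proof (cases "j < s")
      case False
      then show ?thesis using Q[rule_format, of "j - s"] j by simp
    qed (use Q in blast)
  qed auto
  have split: "mmul (s + s) A R i j = mmul s A R i j + (\<Sum>b<s. A2 i b * R (s + b) j)" for R i j
    by (simp add: mmul_def sum_lessThan_add A2_def)
  show ?thesis unfolding ginverse_def cases
  proof (intro conjI allI impI)
    fix i j assume ij: "i < N" "j < s"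
    have "mmul s A (tmul N G A) i j = mmul s A (tmul N G1 A) i j"
      using ij by (simp add: mmul_def GA1)
    then show "mmul (s + s) A (tmul N G A) i j = A i j"
      unfolding split using G1 ij by (simp add: GA3 low1 ginverse_def)
    \<comment> \<open>Right half: A1 X + A1 X H^T M + A2 H^T M = A1 X + M H^T M = A1 X + M, which is
      A2.\<close>
    have "mmul (s + s) A (tmul N G A) i (s + j) =
       mmul s A X i j + (\<Sum>a<s. A i a * (\<Sum>b<s. X a b * tmul N H M b j)) + (\<Sum>b<s. A2 i b * tmul N H M b j)"
      unfolding split GA3 low2 by (simp add: mmul_def GA2 distrib_left sum.distrib)
    also have "\<dots> = mmul s A X i j + mmul s M (tmul N H M) i j"
    proof -
      have "mmul s M Z i j = (\<Sum>b<s. A2 i b * Z b j) + (\<Sum>b<s. mmul s A X i b * Z b j)" for Z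
        unfolding mmul_def[of s M] by (simp add: M_def distrib_right sum.distrib)
      then show ?thesis unfolding sum_mmul_assoc by (simp only: add_ac)
    qed
    also have "mmul s M (tmul N H M) i j = M i j" using H ij by (simp add: ginverse_def)
    finally show "mmul (s + s) A (tmul N G A) i (s + j) = A i (s + j)"
      by (simp only: M_def A2_def cancel add.commute[of "A i (s + j)"])
  next
    fix j assume j: "j < s"
    show "(\<forall>i<N. G i j = 0) \<or> (\<forall>a<s. tmul N G A a j = of_bool (a = j) \<and> tmul N G A (s + a) j = of_bool (s + a = j))"
    \<comment> \<open>A zero column of \<open>G1\<close> gives a zero row of \<open>X\<close>, so
      the correction term cannot revive it.\<close>
    proof (cases "\<forall>i<N. G1 i j = 0")
      case True
      then have "X j b = 0" for b by (simp add: X_def tmul_def)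
      then show ?thesis using True j by (simp add: G_def glue_def mmul_def)
    next
      case False
      then show ?thesis using G1 j by (auto simp: ginverse_def GA1 GA3 low1)
    qed
    show "(\<forall>i<N. G i (s + j) = 0) \<or> (\<forall>a<s. tmul N G A a (s + j) = of_bool (a = s + j) \<and> tmul N G A (s + a) (s + j) = of_bool (s + a = s + j))"
    proof (cases "\<forall>i<N. H i j = 0")
      case True
      then have "Y c j = 0" for c by (simp add: Y_def tmul_def)
      then show ?thesis using True by (simp add: G_def glue_def H'_def mmul_def)
    next
      case False
      then have d: "\<And>a. a < s \<Longrightarrow> tmul N H M a j = of_bool (a = j)"
        using H j unfolding ginverse_def by blast
      have "(\<Sum>b<s. X a b * tmul N H M b j) = X a j" for a
      proof -
        have "(\<Sum>b<s. X a b * tmul N H M b j) = (\<Sum>b<s. if b = j then X a b else 0)"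
          by (rule sum.cong) (auto simp: d)
        then show ?thesis using j by (simp add: sum.delta)
      qed
      \<comment> \<open>At a basis column of \<open>M\<close> the term X H^T M equals X, and the two
        copies of X cancel, which leaves a unit vector.\<close>
      then show ?thesis using char2 by (auto simp: GA2 GA3 low2 d)
    qed
  next
    fix a j assume a: "a < s"
    { assume "j < a"
      then show "tmul N G A a j = 0" using a G1 by (simp add: GA1 ginverse_def) }
    { assume j: "j < s + a"
      show "tmul N G A (s + a) j = 0"
      proof (cases "j < s")
        case False
        then obtain j' where "j = s + j'" by (metis le_add_diff_inverse not_less)
        then show ?thesis using a j H by (simp add: GA3 low2 ginverse_def)
      qed (simp add: GA3 low1) }
  qed
qed

text \<open>The programs are specified as computing this particular generalized inverse. For a
  single column a unit vector at any nonzero entry works; the last such entry is taken because one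
  scan with one register finds it. In the recursive case \<open>A\<close> also stands for its left
  half, of which only columns below \<open>s\<close> matter.\<close>

primrec gamma :: "nat \<Rightarrow> nat \<Rightarrow> bmat \<Rightarrow> bmat" where
  "gamma N 0 A = (\<lambda>i j. of_bool (i < N \<and> A i 0 \<noteq> 0 \<and> (\<forall>i'<N. i < i' \<longrightarrow> A i' 0 = 0)))"
| "gamma N (Suc k) A =
    (let s = 2 ^ k; A2 = (\<lambda>i j. A i (s + j));
         G1 = gamma N k A; X = tmul N G1 A2;
         H = gamma N k (\<lambda>i j. A2 i j + mmul s A X i j);
         H' = (\<lambda>i j. H i j + mmul s G1 (tmul N A H) i j)
     in glue s (\<lambda>i j. G1 i j + mmul s H' (\<lambda>a b. X b a) i j) H')"

lemma ginverse_gamma: "ginverse N (2 ^ k) A (gamma N k A)"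
proof (induction k arbitrary: A)
  case 0
  show ?case
  proof (cases "\<exists>i<N. A i 0 \<noteq> 0")
    case False
    then show ?thesis by (auto simp: ginverse_def mmul_def tmul_def)
  next
    case True
    define r where "r = Max {i. i < N \<and> A i 0 \<noteq> 0}"
    have fin: "finite {i. i < N \<and> A i 0 \<noteq> 0}" by simp
    have r: "r < N" "A r 0 \<noteq> 0" using Max_in[OF fin] True unfolding r_def by auto
    have mx: "i \<le> r" if "i < N" "A i 0 \<noteq> 0" for i
      unfolding r_def using that fin by (intro Max_ge) auto
    have g: "gamma N 0 A i j = of_bool (i = r)" for i j
    proof -
      have "(i < N \<and> A i 0 \<noteq> 0 \<and> (\<forall>i'<N. i < i' \<longrightarrow> A i' 0 = 0)) \<longleftrightarrow> i = r"
        using r mx by (metis leD le_neq_implies_less)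
      then show ?thesis by simp
    qed
    have "tmul N (gamma N 0 A) A a 0 = A r 0" for a
    proof -
      have "tmul N (gamma N 0 A) A a 0 = (\<Sum>i<N. if i = r then A i 0 else 0)"
        unfolding tmul_def g by (rule sum.cong) auto
      then show ?thesis using r by (simp add: sum.delta)
    qed
    \<comment> \<open>A nonzero bit is 1, so the pivot needs no division.\<close>
    moreover have "A r 0 = 1" using r(2) by simp
    ultimately show ?thesis by (simp add: ginverse_def mmul_def)
  qed
next
  case (Suc k)
  have "2 ^ Suc k = 2 ^ k + (2 ^ k :: nat)" by simp
  then show ?case
    unfolding gamma.simps Let_def by (simp only:) (rule ginverse_step, simp, rule Suc, rule Suc)
qed

definition stored :: "(nat \<Rightarrow> nat) \<Rightarrow> nat \<Rightarrow> nat \<Rightarrow> bmat \<Rightarrow> bool" where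
  "stored h r c M \<longleftrightarrow> (\<forall>k<r * c. h k = word_of_bit (M (k div c) (k mod c)))"

lemma map_stored: "stored h r c M \<Longrightarrow> map h [0..<r * c] = enc r c M"
  by (simp add: stored_def enc_def)

section \<open>The recursion for generalized inverses as a program\<close>

definition add_loop :: "nat \<Rightarrow> nat \<Rightarrow> com" where
  "add_loop a b = for_loop 4 6 (Assign a (reg 4) (add_mod2 (Cell a (reg 4)) (Cell b (reg 4))))"

text \<open>Registers of \<open>ginv_prog\<close>: 0 and 1 hold the numbers N and w of rows and
  columns, 2 the half width s, 3 the number N/s of blocks, and 5, 6, 7 the sizes N w, N s and s^2.
  The parameters \<open>m\<close> and \<open>m'\<close> name the registers for the sizes of the
  right factor and of the result, which differ between the two kinds of product.\<close>

definition mul_call :: "com \<Rightarrow> nat \<Rightarrow> nat \<Rightarrow> nat \<Rightarrow> nat \<Rightarrow> nat \<Rightarrow> com list" where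
  "mul_call R a m b m' c = [Pass (reg 3), Pass (reg 2), for_loop 4 6 (Pass (Cell a (reg 4))),
     for_loop 4 m (Pass (Cell b (reg 4))), Call R, for_loop 4 m' (Fetch c (reg 4))]"

definition rec_call :: "nat \<Rightarrow> nat \<Rightarrow> com list" where
  "rec_call a c = [Pass (reg 0), Pass (reg 2), for_loop 4 6 (Pass (Cell a (reg 4))), Recur,
     for_loop 4 6 (Fetch c (reg 4))]"

text \<open>Arrays: 10 the input, 11 and 12 its halves, 13 the inverse of the left half, 14 and 20 the
  matrix \<open>X\<close> of \<open>gamma\<close> and its transpose, 15 the Schur complement, 16 its inverse, 17 the matrix \<open>tmul N A H\<close>,
  18 and 19 the right and left half of the result.\<close>

definition ginv_step :: "com \<Rightarrow> com list" where
  "ginv_step P =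
    [Assign 2 (Num 0) (Bin ODiv (reg 1) (Num 2)), Assign 3 (Num 0) (Bin ODiv (reg 0) (reg 2)),
     Assign 6 (Num 0) (Bin OMul (reg 0) (reg 2)), Assign 7 (Num 0) (Bin OMul (reg 2) (reg 2)),
     for_loop 4 6 (Assign 11 (reg 4) (Cell 10 (Bin OAdd (Bin OMul (Bin ODiv (reg 4) (reg 2)) (reg 1)) (Bin OMod (reg 4) (reg 2))))),
     for_loop 4 6 (Assign 12 (reg 4) (Cell 10 (Bin OAdd (Bin OMul (Bin ODiv (reg 4) (reg 2)) (reg 1)) (Bin OAdd (reg 2) (Bin OMod (reg 4) (reg 2))))))]
   @ rec_call 11 13
   @ mul_call (tn_prog P) 13 6 12 7 14
   @ mul_call (nn_prog P) 11 7 14 6 15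
   @ add_loop 15 12 # rec_call 15 16
   @ mul_call (tn_prog P) 11 6 16 7 17
   @ mul_call (nn_prog P) 13 7 17 6 18
   @ [add_loop 18 16,
      for_loop 4 7 (Assign 20 (reg 4) (Cell 14 (Bin OAdd (Bin OMul (Bin OMod (reg 4) (reg 2)) (reg 2)) (Bin ODiv (reg 4) (reg 2)))))]
   @ mul_call (nn_prog P) 18 7 20 6 19
   @ [add_loop 19 13,
      for_loop 4 5 (Write (Bin OAdd
        (Bin OMul (Bin OLess (Bin OMod (reg 4) (reg 1)) (reg 2))
          (Cell 19 (Bin OAdd (Bin OMul (Bin ODiv (reg 4) (reg 1)) (reg 2)) (Bin OMod (reg 4) (reg 1)))))
        (Bin OMul (Bin OSub (Num 1) (Bin OLess (Bin OMod (reg 4) (reg 1)) (reg 2)))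
          (Cell 18 (Bin OAdd (Bin OMul (Bin ODiv (reg 4) (reg 1)) (reg 2)) (Bin OSub (Bin OMod (reg 4) (reg 1)) (reg 2)))))))]"

text \<open>Register 9 starts at \<open>N\<close>, which is no row index: a zero column leaves it
  there, and the final comparison then writes zeros only.\<close>

definition ginv_base :: "com list" where
  "ginv_base = [Assign 9 (Num 0) (reg 0),
     for_loop 4 5 (block [Cond (Cell 10 (reg 4)) (block [Assign 9 (Num 0) (reg 4)]) (block [])]),
     for_loop 4 5 (Write (Bin OEq (reg 4) (reg 9)))]"

definition ginv_prog :: "com \<Rightarrow> com" where
  "ginv_prog P = block [Read 0 (Num 0), Read 1 (Num 0), Assign 5 (Num 0) (Bin OMul (reg 0) (reg 1)),
     for_loop 4 5 (Read 10 (reg 4)),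
     Cond (Bin OLess (Num 1) (reg 1)) (block (ginv_step P)) (block ginv_base)]"

context mul_machine begin

lemma wpb_map_stored:
  assumes "bnd \<sigma>" "\<sigma> m 0 = r * c" "esize e \<le> 40" "distinct [i, m, a]"
    and ev: "\<And>k h. k < r * c \<Longrightarrow> h k = \<sigma> a k \<Longrightarrow>
      ev e (set_reg i k (\<sigma>(a := h))) = word_of_bit (M (k div c) (k mod c))"
    and "\<And>\<tau>. bnd \<tau> \<Longrightarrow> stored (\<tau> a) r c M \<Longrightarrow> (\<And>k. k \<noteq> i \<Longrightarrow> k \<noteq> a \<Longrightarrow> \<tau> k = \<sigma> k) \<Longrightarrow>
      wpb R (block cs) (T - (real (r * c) * (real (cost e) + 15) + 9)) Q (State \<tau> xs ys us vs)"
  shows "wpb R (block (for_loop i m (Assign a (reg i) e) # cs)) T Q (State \<sigma> xs ys us vs)"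
  by (rule wpb_map_loop[OF assms(1-4) ev], assumption, assumption, rule word_le_B, rule assms(6))
    (use assms(4) in \<open>auto simp: stored_def\<close>)

lemma wpb_read_stored:
  assumes "bnd \<sigma>" "\<sigma> m 0 = r * c" "distinct [i, m, a]"
    and "\<And>\<tau>. bnd \<tau> \<Longrightarrow> stored (\<tau> a) r c M \<Longrightarrow> (\<And>k. k \<noteq> i \<Longrightarrow> k \<noteq> a \<Longrightarrow> \<tau> k = \<sigma> k) \<Longrightarrow>
      wpb R (block cs) (T - (real (r * c) * 15 + 9)) Q (State \<tau> [] ys us vs)"
  shows "wpb R (block (for_loop i m (Read a (reg i)) # cs)) T Q (State \<sigma> (enc r c M) ys us vs)"
proof (rule wpb_read_array[OF assms(1,2)])
  let ?\<tau> = "set_reg i (r * c) (\<sigma>(a := (\<lambda>k. if k < r * c then enc r c M ! k else \<sigma> a k)))"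
  assume "bnd ?\<tau>"
  then have "wpb R (block cs) (T - (real (r * c) * 15 + 9)) Q (State ?\<tau> [] ys us vs)"
    by (rule assms(4)) (use assms(3) in \<open>auto simp: stored_def\<close>)
  then show "wpb R (block cs) (T - (real (r * c) * 15 + 9)) Q (State ?\<tau> (drop (r * c) (enc r c M)) ys us vs)"
    by simp
qed (use assms(3) in \<open>auto simp: word_le_B\<close>)

lemma wpb_fetch_stored:
  assumes "bnd \<sigma>" "\<sigma> m 0 = r * c" "distinct [i, m, a]"
    and "\<And>\<tau> vs. bnd \<tau> \<Longrightarrow> stored (\<tau> a) r c M \<Longrightarrow> (\<And>k. k \<noteq> i \<Longrightarrow> k \<noteq> a \<Longrightarrow> \<tau> k = \<sigma> k) \<Longrightarrow>
      wpb R (block cs) (T - (real (r * c) * 15 + 9)) Q (State \<tau> xs ys us vs)"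
  shows "wpb R (block (for_loop i m (Fetch a (reg i)) # cs)) T Q (State \<sigma> xs ys us (enc r c M))"
  by (rule wpb_fetch_array[OF assms(1,2)], simp, simp add: word_le_B, rule assms(3), rule assms(4))
    (use assms(3) in \<open>auto simp: stored_def\<close>)

lemma wpb_pass_stored:
  assumes "bnd \<sigma>" "\<sigma> m 0 = r * c" "distinct [i, m, a]" "stored (\<sigma> a) r c M"
    and "\<And>\<tau>. bnd \<tau> \<Longrightarrow> (\<And>k. k \<noteq> i \<Longrightarrow> \<tau> k = \<sigma> k) \<Longrightarrow>
      wpb R (block cs) (T - (real (r * c) * 17 + 9)) Q (State \<tau> xs ys (us @ enc r c M) vs)"
  shows "wpb R (block (for_loop i m (Pass (Cell a (reg i))) # cs)) T Q (State \<sigma> xs ys us vs)"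
proof (rule wpb_pass_loop[OF assms(1,2), where f = "\<sigma> a"])
  assume b: "bnd (set_reg i (r * c) \<sigma>)"
  have "wpb R (block cs) (T - (real (r * c) * 17 + 9)) Q (State (set_reg i (r * c) \<sigma>) xs ys (us @ enc r c M) vs)"
    by (rule assms(5)[OF b]) simp
  then show "wpb R (block cs) (T - (real (r * c) * (real (cost (Cell a (reg i))) + 13) + 9)) Q
      (State (set_reg i (r * c) \<sigma>) xs ys (us @ map (\<sigma> a) [0..<r * c]) vs)"
    unfolding map_stored[OF assms(4)] by (rule wpb_mono) simp_all
qed (use assms in auto)

lemma wpb_add_loop:
  assumes "bnd \<sigma>" "\<sigma> 6 0 = r * c" "stored (\<sigma> a) r c M" "stored (\<sigma> b) r c M'" "distinct [4, 6, a, b]"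
    and "\<And>\<tau>. bnd \<tau> \<Longrightarrow> stored (\<tau> a) r c (\<lambda>i j. M' i j + M i j) \<Longrightarrow> (\<And>k. k \<noteq> 4 \<Longrightarrow> k \<noteq> a \<Longrightarrow> \<tau> k = \<sigma> k) \<Longrightarrow>
      wpb R (block cs) (T - (real (r * c) * 30 + 9)) Q (State \<tau> xs ys us vs)"
  shows "wpb R (block (add_loop a b # cs)) T Q (State \<sigma> xs ys us vs)"
  unfolding add_loop_def
proof (rule wpb_map_stored[OF assms(1,2), where M = "\<lambda>i j. M' i j + M i j"])
  fix k h assume "k < r * c" "h k = \<sigma> a k"
  then show "ev (add_mod2 (Cell a (reg 4)) (Cell b (reg 4))) (set_reg 4 k (\<sigma>(a := h))) =
      word_of_bit (M' (k div c) (k mod c) + M (k div c) (k mod c))"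
    using assms(3-5) word_of_bit_add[OF add.commute] by (simp add: stored_def)
next
  fix \<tau> assume "bnd \<tau>" "stored (\<tau> a) r c (\<lambda>i j. M' i j + M i j)" "\<And>k. k \<noteq> 4 \<Longrightarrow> k \<noteq> a \<Longrightarrow> \<tau> k = \<sigma> k"
  from assms(6)[OF this]
  show "wpb R (block cs) (T - (real (r * c) * (real (cost (add_mod2 (Cell a (reg 4)) (Cell b (reg 4)))) + 15) + 9)) Q (State \<tau> xs ys us vs)"
    by (rule wpb_mono) simp_all
qed (use assms in auto)

lemma wpb_mul_call:
  assumes "bnd \<sigma>" "proc F (\<sigma> 3 0 # \<sigma> 2 0 # enc r1 c1 M1 @ enc r2 c2 M2) TF (enc r3 c3 M3)"
    and "\<sigma> 6 0 = r1 * c1" "\<sigma> m 0 = r2 * c2" "\<sigma> m' 0 = r3 * c3"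
    and "distinct [4, 6, a]" "distinct [4, m, b]" "distinct [4, m', c]"
    and "stored (\<sigma> a) r1 c1 M1" "stored (\<sigma> b) r2 c2 M2"
    and "\<And>\<tau> vs. bnd \<tau> \<Longrightarrow> stored (\<tau> c) r3 c3 M3 \<Longrightarrow> (\<And>k. k \<noteq> 4 \<Longrightarrow> k \<noteq> c \<Longrightarrow> \<tau> k = \<sigma> k) \<Longrightarrow>
      wpb R (block cs) (T - TF - (real (r1 * c1) * 17 + real (r2 * c2) * 17 + real (r3 * c3) * 15 + 40)) Q
        (State \<tau> xs ys [] vs)"
  shows "wpb R (block (mul_call F a m b m' c @ cs)) T Q (State \<sigma> xs ys [] vs)"
  unfolding mul_call_def append_Cons append_Nil
  apply (rule wpb_Pass[OF assms(1)], simp, simp)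
  apply (rule wpb_Pass[OF assms(1)], simp, simp)
  apply (rule wpb_pass_stored[OF assms(1,3,6,9)])
  subgoal for \<tau>
    apply (rule wpb_pass_stored[of \<tau> m r2 c2 4 b M2], assumption, use assms in simp, use assms in simp, use assms in simp)
    subgoal for \<tau>'
      apply (rule wpb_Call[where TR = TF and zs = "enc r3 c3 M3"], use assms in simp, assumption)
      apply (rule wpb_fetch_stored, assumption, use assms in simp, use assms in simp)
      apply (rule wpb_mono, rule assms(11), assumption, assumption)
      using assms by auto
    done
  done

lemma wpb_rec_call:
  assumes "bnd \<sigma>" "proc R (\<sigma> 0 0 # \<sigma> 2 0 # enc r1 c1 M1) TF (enc r1 c1 M3)"
    and "\<sigma> 6 0 = r1 * c1"
    and "distinct [4, 6, a]" "distinct [4, 6, c]"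
    and "stored (\<sigma> a) r1 c1 M1"
    and "\<And>\<tau> vs. bnd \<tau> \<Longrightarrow> stored (\<tau> c) r1 c1 M3 \<Longrightarrow> (\<And>k. k \<noteq> 4 \<Longrightarrow> k \<noteq> c \<Longrightarrow> \<tau> k = \<sigma> k) \<Longrightarrow>
      wpb R (block cs) (T - TF - (real (r1 * c1) * 32 + 40)) Q
        (State \<tau> xs ys [] vs)"
  shows "wpb R (block (rec_call a c @ cs)) T Q (State \<sigma> xs ys [] vs)"
  unfolding rec_call_def append_Cons append_Nil
  apply (rule wpb_Pass[OF assms(1)], simp, simp)
  apply (rule wpb_Pass[OF assms(1)], simp, simp)
  apply (rule wpb_pass_stored[OF assms(1,3,4,6)])
  subgoal for \<tau>
    apply (rule wpb_Recur[where TR = TF and zs = "enc r1 c1 M3"], use assms in simp, assumption)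
    apply (rule wpb_fetch_stored, assumption, use assms in simp, use assms in simp)
    apply (rule wpb_mono, rule assms(7), assumption, assumption)
    using assms by auto
  done

lemma ginv_base_proc:
  assumes N: "1 \<le> N" "N \<le> Nmax"
  shows "proc (ginv_prog P) (N # 1 # enc N 1 A) (150 * real N) (enc N 1 (gamma N 0 A))"
proof (rule procI)
  have mB: "Suc 0 \<le> B" "N \<le> B" using small_le_B(2)[OF N(2)] two_le_B by auto
  define I :: invariant where "I = (\<lambda>l \<tau> xs ys us vs.
    \<tau> 4 0 = l \<and> \<tau> 5 0 = N \<and> stored (\<tau> 10) N 1 A \<and> ys = [] \<and> (\<tau> 9 0 < l \<or> \<tau> 9 0 = N) \<and>
    (\<forall>k<l. k = \<tau> 9 0 \<longleftrightarrow> A k 0 \<noteq> 0 \<and> (\<forall>i'<l. k < i' \<longrightarrow> A i' 0 = 0)))"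
  have step: "wpb R (block [Cond (Cell 10 (reg 4)) (block [Assign 9 (Num 0) (reg 4)]) (block [])]) 20
     (loop_post 4 l I)
     (State \<tau> xs ys us vs)" if l: "l < N" and b: "bnd \<tau>" and inv: "I l \<tau> xs ys us vs" for R l \<tau> xs ys us vs
  proof -
    have t: "\<tau> 10 l = word_of_bit (A l 0)" "\<tau> 4 0 = l" "\<tau> 5 0 = N" "stored (\<tau> 10) N 1 A" "ys = []"
      "\<tau> 9 0 < l \<or> \<tau> 9 0 = N"
      "\<And>k. k < l \<Longrightarrow> k = \<tau> 9 0 \<longleftrightarrow> A k 0 \<noteq> 0 \<and> (\<forall>i'<l. k < i' \<longrightarrow> A i' 0 = 0)"
      using inv l by (auto simp: I_def stored_def)
    have lB: "l \<le> B" using l mB by simp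
    have 1: "I (Suc l) (set_reg 4 (Suc l) (set_reg 9 l \<tau>)) xs ys us vs" if "A l 0 \<noteq> 0"
      unfolding I_def using t(2-5) that by (auto simp: less_Suc_eq)
    have 2: "I (Suc l) (set_reg 4 (Suc l) \<tau>) xs ys us vs" if "A l 0 = 0"
      unfolding I_def using t(2-6) that l by (auto simp: less_Suc_eq t(7))
    show ?thesis
      apply (rule wpb_Cond[OF b], simp)
       apply (simp only: append_Cons append_Nil)
       apply (rule wpb_assign_reg[OF b], simp, simp, simp add: t lB)
       apply (rule wpb_Nil, simp, simp, use 1 t in simp)
      apply (simp only: append_Nil)
      apply (rule wpb_Nil, simp add: b, simp, use 2 t in simp)
      done
  qed
  have g: "N * 1 = N" by simp
  show "wpb (ginv_prog P) (ginv_prog P) (150 * real N)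
     (\<lambda>st. out st = enc N 1 (gamma N 0 A))
     (State zero_store (N # 1 # enc N 1 A) [] [] [])"
    apply (subst (2) ginv_prog_def)
    apply (rule wpb_read_reg, rule bnd_zero, simp add: mB)
    apply (rule wpb_read_reg, assumption, simp add: mB)
    apply (rule wpb_assign_reg, assumption, simp, simp, simp add: mB)
    apply (rule wpb_read_array[where n = N], assumption, simp, simp, simp add: word_le_B, simp)
    apply (rule wpb_Cond, assumption, simp, simp)
    apply (simp only: append_Nil2 ginv_base_def)
    apply (rule wpb_assign_reg, assumption, simp, simp, simp add: mB)
    apply (rule wpb_for[where I = I and n = N and Tb = 20], assumption)
       apply (simp add: I_def stored_def)
      apply (rule step; assumption)
     apply (simp add: I_def)
    apply (rule wpb_write_loop[where n = N and f = "\<lambda>k. word_of_bit (gamma N 0 A k 0)"], assumption, simp add: I_def, simp, simp)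
     apply (simp add: I_def word_of_bit_def)
    apply (rule wpb_Nil, simp)
     apply (use N in \<open>simp add: algebra_simps\<close>)
    apply (simp add: I_def enc_def)
    done
qed

text \<open>With F = N s^(\<omega>-1), two recursive calls and five block products give T(2s) \<le>
  2 T(s) + 5 (C + 400) F + 3000 N s. Doubling the width multiplies the claimed D F by
  2^(\<omega>-1), so the second condition on \<open>D\<close> is what pays for the products and the
  copying. The width may exceed \<open>N\<close> once, because the annotation needs a matrix with 2
  N columns.\<close>

lemma ginv_proc:
  assumes N: "N = 2 ^ K" "N \<le> Nmax" and D: "150 \<le> D" "5 * (C + 400) + 3000 \<le> D * (2 powr (\<omega> - 1) - 2)"
  shows "k \<le> Suc K \<Longrightarrow> proc (ginv_prog P) (N # 2 ^ k # enc N (2 ^ k) A)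
    (D * real N * real (2 ^ k) powr (\<omega> - 1)) (enc N (2 ^ k) (gamma N k A))"
proof (induction k arbitrary: A)
  case 0
  have "1 \<le> N" using N by simp
  from ginv_base_proc[OF this N(2), of A] show ?case
    using D(1) by (simp only: power_0 of_nat_1 powr_one_eq_one mult_1_right) (erule proc_mono, simp add: mult_right_mono)
next
  case (Suc k)
  define s q w where "s = (2::nat) ^ k" and "q = (2::nat) ^ (K - k)" and "w = (2::nat) ^ Suc k"
  have k: "k \<le> K" using Suc.prems by simp
  have s1: "1 \<le> s" "1 \<le> q" "0 < s" by (simp_all add: s_def q_def)
  have Nqs: "N = q * s" using k by (simp add: N s_def q_def flip: power_add)
  have ws: "w = s + s" "w div 2 = s" "N div s = q" using s1 by (simp_all add: w_def s_def Nqs)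
  have lt_w: "x < w" "s + x < w" if "x < s" for x using that by (simp_all add: ws(1))
  have sN: "s \<le> N" using s1 by (simp add: Nqs)
  have NN: "N * N \<le> Nmax * Nmax" using N(2) by (intro mult_le_mono)
  have "N * s \<le> N * N" "s * s \<le> N * N" using sN by (auto intro: mult_le_mono)
  then have mB: "N * w \<le> B" "N * s \<le> B" "s * s \<le> B" "N \<le> B" "s \<le> B" "w \<le> B" "q \<le> B"
  proof -
    assume a: "N * s \<le> N * N" "s * s \<le> N * N"
    have "8 * (N * N) \<le> B" using Nmax NN by (simp add: power2_eq_square)
    moreover have "N \<le> N * N" "q \<le> N" using s1 by (auto simp: Nqs)
    ultimately show "N * w \<le> B" "N * s \<le> B" "s * s \<le> B" "N \<le> B" "s \<le> B" "w \<le> B" "q \<le> B"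
      using a sN unfolding ws(1) distrib_left by linarith+
  qed
  define T1 where "T1 = D * real N * real s powr (\<omega> - 1)"
  define T2 where "T2 = D * real N * real w powr (\<omega> - 1)"
  define TF where "TF = (C + 400) * real q * real s powr \<omega>"
  have Tge: "2 * T1 + 5 * TF + 3000 * (real N * real s) \<le> T2" "real s * real s \<le> real N * real s" "1 \<le> real N * real s"
  proof -
    define F where "F = real N * real s powr (\<omega> - 1)"
    have p: "real s powr \<omega> = real s * real s powr (\<omega> - 1)"
      using s1 powr_add[of "real s" 1 "\<omega> - 1"] by simp
    have TF: "TF = (C + 400) * F" by (simp add: TF_def F_def p Nqs)
    have "real w powr (\<omega> - 1) = 2 powr (\<omega> - 1) * real s powr (\<omega> - 1)"
      using powr_mult[of 2 "real s" "\<omega> - 1"] by (simp add: ws)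
    then have T2: "T2 = 2 * T1 + D * (2 powr (\<omega> - 1) - 2) * F" by (simp add: T2_def T1_def F_def algebra_simps)
    \<comment> \<open>Here \<omega> \<ge> 2 bounds the copying cost N s by F.\<close>
    have "real s powr 1 \<le> real s powr (\<omega> - 1)" using s1 omega by (intro powr_mono) auto
    then have NsF: "real N * real s \<le> F" using s1 by (simp add: F_def mult_left_mono)
    then have F0: "0 \<le> F" by (simp add: F_def)
    have "(5 * (C + 400) + 3000) * F \<le> D * (2 powr (\<omega> - 1) - 2) * F" using D(2) F0 by (rule mult_right_mono)
    moreover have "(5 * (C + 400) + 3000) * F = 5 * ((C + 400) * F) + 3000 * F" by (simp add: algebra_simps)
    ultimately show "2 * T1 + 5 * TF + 3000 * (real N * real s) \<le> T2" unfolding T2 TF using NsF by linarith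
    show "real s * real s \<le> real N * real s" using sN by (simp add: mult_right_mono)
    have "1 * 1 \<le> real N * real s" using s1 sN by (intro mult_mono) auto
    then show "1 \<le> real N * real s" by simp
  qed
  have IH: "proc (ginv_prog P) (N # s # enc N s A) T1 (enc N s (gamma N k A))" for A
    using Suc.IH[of A] k by (simp add: T1_def s_def)
  have qsN: "q * s \<le> Nmax" using N(2) Nqs by simp
  have tn: "proc (tn_prog P) (q # s # enc N s M @ enc N s M') TF (enc s s (tmul N M M'))" for M M'
    using tn_proc[OF s1(1,2) qsN, of M M'] by (simp add: TF_def Nqs)
  have nn: "proc (nn_prog P) (q # s # enc N s M @ enc s s M') TF (enc N s (mmul s M M'))" for M M'
    using nn_proc[OF s1(1,2) qsN, of M M'] by (simp add: TF_def Nqs)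
  have kdiv: "i div s < N" "i mod s < s" if "i < N * s" for i
    using that s1 by (auto simp: less_mult_imp_div_less)
  have kdiv': "i div s < s" "i mod s < s" if "i < s * s" for i
    using that s1 by (auto simp: less_mult_imp_div_less)
  have kdivw: "i div w < N" "i mod w < w" if "i < N * w" for i
    using that s1 ws by (auto simp: less_mult_imp_div_less)
  have st: "h (i * c + j) = word_of_bit (M i j)" if "stored h r c M" "i < r" "j < c" for h r c M i j
    using that index_less[OF that(2,3)] by (simp add: stored_def index_div_mod)
  have st': "h (i * s + x - s) = word_of_bit (V i (x - s))" if "stored h N s V" "i < N" "s \<le> x" "x < w" for h V i x
    using st[OF that(1,2), of "x - s"] that ws(1) by simp
  define A2 where "A2 = (\<lambda>i j. A i (s + j))"
  define G1 where "G1 = gamma N k A"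
  define X where "X = tmul N G1 A2"
  define M where "M = (\<lambda>i j. A2 i j + mmul s A X i j)"
  define H where "H = gamma N k M"
  define Y where "Y = tmul N A H"
  define H' where "H' = (\<lambda>i j. H i j + mmul s G1 Y i j)"
  define U where "U = (\<lambda>i j. G1 i j + mmul s H' (\<lambda>a b. X b a) i j)"
  have gam: "gamma N (Suc k) A = glue s U H'"
    by (simp add: Let_def A2_def G1_def X_def M_def H_def Y_def H'_def U_def flip: s_def)
  have "wpb (ginv_prog P) (ginv_prog P) T2 (\<lambda>st. out st = enc N w (glue s U H'))
     (State zero_store (N # w # enc N w A) [] [] [])"
    apply (subst (2) ginv_prog_def)
    apply (rule wpb_read_reg, rule bnd_zero, simp add: mB)
    apply (rule wpb_read_reg, assumption, simp add: mB)
    apply (rule wpb_assign_reg, assumption, simp, simp, simp add: mB)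
    apply (rule wpb_read_stored, assumption, simp, simp)
    subgoal premises p for \<tau>
      apply (rule wpb_Cond, rule p(4), simp)
       prefer 2 subgoal using s1 by (simp add: p ws)
      apply (simp only: ginv_step_def append_Nil2 append_Cons append_Nil append_assoc)
      apply (rule wpb_assign_reg[where x = s], rule p(4), simp, simp add: p ws, simp add: mB)
      apply (rule wpb_assign_reg[where x = q], assumption, simp, simp add: p ws, simp add: mB)
      apply (rule wpb_assign_reg[where x = "N * s"], assumption, simp, simp add: p, simp add: mB)
      apply (rule wpb_assign_reg[where x = "s * s"], assumption, simp, simp add: p, simp add: mB)
      apply (rule wpb_map_stored[where r = N and c = s and M = A], assumption, simp, simp, simp)
       apply (use p(5) in \<open>simp add: p st[OF p(5)] kdiv lt_w\<close>)
      apply (rule wpb_map_stored[where r = N and c = s and M = A2], assumption, simp, simp, simp)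
       apply (use p(5) in \<open>simp add: p A2_def st[OF p(5)] kdiv lt_w\<close>)
      apply (rule wpb_rec_call[where ?r1.0 = N and ?c1.0 = s and ?M1.0 = A and ?M3.0 = G1 and TF = T1], assumption,
          use IH in \<open>simp add: p G1_def\<close>, simp, simp, simp, simp)
      apply (rule wpb_mul_call[where ?r1.0 = N and ?c1.0 = s and ?M1.0 = G1 and ?r2.0 = N and ?c2.0 = s and ?M2.0 = A2
            and ?r3.0 = s and ?c3.0 = s and ?M3.0 = X and TF = TF], assumption,
          use tn in \<open>simp add: X_def\<close>, simp, simp, simp, simp, simp, simp, simp, simp)
      apply (rule wpb_mul_call[where ?r1.0 = N and ?c1.0 = s and ?M1.0 = A and ?r2.0 = s and ?c2.0 = s and ?M2.0 = X
            and ?r3.0 = N and ?c3.0 = s and ?M3.0 = "mmul s A X" and TF = TF], assumption,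
          use nn in simp, simp, simp, simp, simp, simp, simp, simp, simp)
      apply (rule wpb_add_loop[where r = N and c = s and M = "mmul s A X" and M' = A2], assumption, simp, simp, simp, simp,
          fold M_def)
      apply (rule wpb_rec_call[where ?r1.0 = N and ?c1.0 = s and ?M1.0 = M and ?M3.0 = H and TF = T1], assumption,
          use IH in \<open>simp add: p H_def\<close>, simp, simp, simp, simp)
      apply (rule wpb_mul_call[where ?r1.0 = N and ?c1.0 = s and ?M1.0 = A and ?r2.0 = N and ?c2.0 = s and ?M2.0 = H
            and ?r3.0 = s and ?c3.0 = s and ?M3.0 = Y and TF = TF], assumption,
          use tn in \<open>simp add: Y_def\<close>, simp, simp, simp, simp, simp, simp, simp, simp)
      apply (rule wpb_mul_call[where ?r1.0 = N and ?c1.0 = s and ?M1.0 = G1 and ?r2.0 = s and ?c2.0 = s and ?M2.0 = Y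
            and ?r3.0 = N and ?c3.0 = s and ?M3.0 = "mmul s G1 Y" and TF = TF], assumption,
          use nn in simp, simp, simp, simp, simp, simp, simp, simp, simp)
      apply (rule wpb_add_loop[where r = N and c = s and M = "mmul s G1 Y" and M' = H], assumption, simp, simp, simp, simp,
          fold H'_def)
      apply (rule wpb_map_stored[where r = s and c = s and M = "\<lambda>a b. X b a"], assumption, simp, simp, simp)
       apply (simp add: st[where c = s and r = s and M = X] kdiv')
      apply (rule wpb_mul_call[where ?r1.0 = N and ?c1.0 = s and ?M1.0 = H' and ?r2.0 = s and ?c2.0 = s and ?M2.0 = "\<lambda>a b. X b a"
            and ?r3.0 = N and ?c3.0 = s and ?M3.0 = "mmul s H' (\<lambda>a b. X b a)" and TF = TF], assumption,
          use nn in simp, simp, simp, simp, simp, simp, simp, simp, simp)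
      apply (rule wpb_add_loop[where r = N and c = s and M = "mmul s H' (\<lambda>a b. X b a)" and M' = G1], assumption, simp, simp, simp, simp,
          fold U_def)
      \<comment> \<open>The written expression selects a half by multiplying with 0 or 1. The factor
        0 discards the cell read from the wrong half, whose index may come from a truncated
        subtraction.\<close>
      apply (rule wpb_write_loop[where n = "N * w" and f = "\<lambda>k. word_of_bit (glue s U H' (k div w) (k mod w))"], assumption,
          simp add: p, simp, simp)
       apply (simp add: p glue_def kdivw st[where c = s and r = N and M = U] st'[where V = H'])
      apply (rule wpb_Nil, simp)
       apply (use Tge in \<open>simp add: algebra_simps ws\<close>)
      apply (simp add: enc_def)
      done
    done
  then show ?case unfolding T2_def gam[symmetric] w_def by (rule procI)
qed

end

section \<open>The preprocessing program\<close>

text \<open>The vertices of the second list are marked in an array addressed by vertex. A fresh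
  memory is zero, so no clearing is paid for, and the time is linear in the lengths whatever the
  vertex numbers are.\<close>

definition facet_prog :: com where
  "facet_prog = block [Read 0 (Num 0), for_loop 4 0 (Read 10 (reg 4)), Read 1 (Num 0),
     for_loop 4 1 (block [Read 2 (Num 0), Assign 11 (reg 2) (Num 1)]),
     Assign 3 (Num 0) (Num 0),
     for_loop 4 0 (Assign 3 (Num 0) (Bin OAdd (reg 3) (Cell 11 (Cell 10 (reg 4))))),
     Write (Bin OMul (Bin OLess (Num 0) (reg 0)) (Bin OMul (Bin OEq (reg 0) (reg 3)) (Bin OEq (Bin OAdd (reg 0) (Num 1)) (reg 1))))]"

text \<open>The empty list is excluded since the empty set is not a simplex: vertices get zero
  boundary, and padding rows stay zero.\<close>

definition is_facet :: "nat list \<Rightarrow> nat list \<Rightarrow> bool" where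
  "is_facet us vs \<longleftrightarrow> us \<noteq> [] \<and> length vs = length us + 1 \<and> set us \<subseteq> set vs"

abbreviation parse_body :: "com" where
  "parse_body \<equiv> block [Read 10 (reg 5), Assign 6 (Num 0) (Cell 10 (reg 5)),
     for_loop 4 6 (Read 11 (Bin OAdd (Bin OMul (reg 5) (reg 1)) (reg 4)))]"

text \<open>Simplex k starts at cell k n of array 11, a stride that suffices because a simplex has
  at most n vertices. Array 10 keeps the numbers of vertices.\<close>

definition parse_prog :: "com list" where
  "parse_prog = [for_loop 5 1 parse_body]"

text \<open>After \<open>n\<close> rounds the register holds a power of two between \<open>n\<close> and \<open>2 n\<close>, since \<open>n \<le> 2 ^ n\<close>.\<close>

abbreviation double_body :: "com" where
  "double_body \<equiv> block [Cond (Bin OLess (reg 2) (reg 1)) (block [Assign 2 (Num 0) (Bin OMul (Num 2) (reg 2))]) (block [])]"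

definition double_prog :: "com list" where
  "double_prog = [Assign 2 (Num 0) (Num 1),
     for_loop 4 1 double_body]"

abbreviation incidence_body :: "com" where
  "incidence_body \<equiv> block [Assign 23 (Num 0) (Bin ODiv (reg 5) (reg 2)), Assign 24 (Num 0) (Bin OMod (reg 5) (reg 2)),
       Assign 25 (Num 0) (Cell 10 (reg 23)), Assign 26 (Num 0) (Cell 10 (reg 24)),
       Pass (reg 25), for_loop 4 25 (Pass (Cell 11 (Bin OAdd (Bin OMul (reg 23) (reg 1)) (reg 4)))),
       Pass (reg 26), for_loop 4 26 (Pass (Cell 11 (Bin OAdd (Bin OMul (reg 24) (reg 1)) (reg 4)))),
       Call facet_prog, Fetch 12 (reg 5)]"

text \<open>The facet relation is tabulated between all simplices at once; restricting the columns
  by dimension later yields both boundary matrices from this one table.\<close>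

definition incidence_prog :: "com list" where
  "incidence_prog = [Assign 3 (Num 0) (Bin OMul (reg 2) (reg 2)),
     for_loop 5 3 incidence_body]"

context machine begin

lemma wpb_Fetch:
  assumes "bnd \<sigma>" "esize i \<le> 40" "ev i \<sigma> = j" "x \<le> B"
    and "bnd (\<sigma>(k := (\<sigma> k)(j := x))) \<Longrightarrow>
      wpb P (block cs) (T - real (1 + cost i)) Q (State (\<sigma>(k := (\<sigma> k)(j := x))) xs ys us vs)"
  shows "wpb P (block (Fetch k i # cs)) T Q (State \<sigma> xs ys us (x # vs))"
  by (rule wpb_Cons, rule wpb_Fetch1[OF assms(1-4) order_refl], rule assms(5))
    (use assms in \<open>auto simp: bnd_def\<close>)

lemma wpb_Read:
  assumes "bnd \<sigma>" "esize i \<le> 40" "ev i \<sigma> = j" "x \<le> B"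
    and "bnd (\<sigma>(k := (\<sigma> k)(j := x))) \<Longrightarrow>
      wpb P (block cs) (T - real (1 + cost i)) Q (State (\<sigma>(k := (\<sigma> k)(j := x))) xs ys us vs)"
  shows "wpb P (block (Read k i # cs)) T Q (State \<sigma> (x # xs) ys us vs)"
  by (rule wpb_Cons, rule wpb_Read1[OF assms(1-4) order_refl], rule assms(5))
    (use assms in \<open>auto simp: bnd_def\<close>)

lemma facet_proc:
  assumes us: "length us \<le> L" "\<And>x. x \<in> set us \<Longrightarrow> x \<le> B"
    and vs: "length vs \<le> L" "\<And>x. x \<in> set vs \<Longrightarrow> x \<le> B" and L: "L \<le> B"
  shows "proc facet_prog (length us # us @ length vs # vs) (real L * 100 + 100) [of_bool (is_facet us vs)]"
proof (rule procI)
  define I :: invariant where "I = (\<lambda>l \<tau> xs ys us' vs'.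
    \<tau> 4 0 = l \<and> \<tau> 0 0 = length us \<and> \<tau> 1 0 = length vs \<and> (\<forall>k<length us. \<tau> 10 k = us ! k) \<and>
    (\<forall>x. \<tau> 11 x = of_bool (x \<in> set (take l vs))) \<and> xs = drop l vs \<and> ys = [])"
  have step1: "wpb R (block [Read 2 (Num 0), Assign 11 (reg 2) (Num 1)]) 10
     (loop_post 4 l I)
     (State \<tau> xs ys us' vs')" if l: "l < length vs" and b: "bnd \<tau>" and inv: "I l \<tau> xs ys us' vs'" for R l \<tau> xs ys us' vs'
  proof -
    have xs: "xs = vs ! l # drop (Suc l) vs" using inv l by (simp add: I_def Cons_nth_drop_Suc)
    show ?thesis unfolding xs
      apply (rule wpb_read_reg[OF b], use vs(2) l in simp)
      apply (rule wpb_Assign, assumption, simp, simp, simp, simp, use two_le_B in simp)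
      apply (rule wpb_Nil, simp, simp)
      using inv by (auto simp: I_def take_Suc_conv_app_nth l)
  qed
  define cnt :: "nat \<Rightarrow> nat" where "cnt l = (\<Sum>k<l. of_bool (us ! k \<in> set vs))" for l
  have cnt: "cnt 0 = 0" "cnt (Suc l) = cnt l + of_bool (us ! l \<in> set vs)" for l
    unfolding cnt_def sum.lessThan_Suc by (rule sum.neutral) auto
  define J :: invariant where "J = (\<lambda>l \<tau> xs ys us' vs'.
    \<tau> 4 0 = l \<and> \<tau> 0 0 = length us \<and> \<tau> 1 0 = length vs \<and> (\<forall>k<length us. \<tau> 10 k = us ! k) \<and>
    (\<forall>x. \<tau> 11 x = of_bool (x \<in> set vs)) \<and> \<tau> 3 0 = cnt l \<and> ys = [])"
  have step2: "wpb R (Assign 3 (Num 0) (Bin OAdd (reg 3) (Cell 11 (Cell 10 (reg 4))))) 20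
     (loop_post 4 l J)
     (State \<tau> xs ys us' vs')" if l: "l < length us" and b: "bnd \<tau>" and inv: "J l \<tau> xs ys us' vs'" for R l \<tau> xs ys us' vs'
  proof -
    have "cnt l' \<le> l'" for l' by (induction l') (simp_all add: cnt)
    from this[of "Suc l"] have le: "cnt l + of_bool (us ! l \<in> set vs) \<le> B" using l us L by (simp add: cnt)
    show ?thesis
      by (rule wpb_Assign1[OF b _ _ refl refl]) (use inv l le in \<open>auto simp: J_def cnt\<close>)
  qed
  have nB: "length us \<le> B" "length vs \<le> B" using us vs L by auto
  have cnt_le: "cnt l \<le> l" for l by (induction l) (simp_all add: cnt)
  \<comment> \<open>The count reaches its maximum exactly if every vertex is found marked.\<close>
  have "cnt l = l \<longleftrightarrow> (\<forall>k<l. us ! k \<in> set vs)" for l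
  proof (induction l)
    case (Suc l)
    then show ?case using cnt_le[of l] by (cases "us ! l \<in> set vs") (simp_all add: cnt All_less_Suc)
  qed (simp add: cnt)
  then have eq: "cnt (length us) = length us \<longleftrightarrow> set us \<subseteq> set vs"
    by (simp only: subset_eq all_set_conv_all_nth)
  then have eq': "length us = cnt (length us) \<longleftrightarrow> set us \<subseteq> set vs" by metis
  show "wpb facet_prog facet_prog (real L * 100 + 100) (\<lambda>st. out st = [of_bool (is_facet us vs)])
     (State zero_store (length us # us @ length vs # vs) [] [] [])"
    apply (subst (2) facet_prog_def)
    apply (rule wpb_read_reg, rule bnd_zero, simp add: nB)
    apply (rule wpb_read_array[where n = "length us"], assumption, simp, simp, use us in \<open>simp add: nth_append\<close>, simp)
    apply (simp only: drop_append drop_all le_refl diff_self_eq_0 drop_0 append_Nil)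
    apply (rule wpb_read_reg, assumption, simp add: nB)
    apply (rule wpb_for[where I = I and n = "length vs" and Tb = 10], assumption)
       apply (simp add: I_def nth_append zero_store_def)
      apply (rule step1; assumption)
     apply (simp add: I_def)
    apply (rule wpb_assign_reg, assumption, simp, simp, simp)
    apply (rule wpb_for[where I = J and n = "length us" and Tb = 20], assumption)
       apply (simp add: I_def J_def cnt)
      apply (rule step2; assumption)
     apply (simp add: J_def)
    apply (rule wpb_Write[where x = "of_bool (is_facet us vs)"], assumption, simp)
     apply (auto simp: J_def is_facet_def eq eq')[1]
    apply (rule wpb_Nil, simp)
     apply (use us(1) vs(1) in simp)
    apply (simp add: J_def)
    done
qed

text \<open>Array 10 has to be zero at the start: its cells from n on are never written, so padding
  indices read as simplices without vertices, as in \<open>simplex_list\<close>.\<close>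

lemma wpb_parse:
  assumes b: "bnd \<sigma>" and s: "\<sigma> 1 0 = length Ks" "\<And>k. \<sigma> 10 k = 0"
    and L: "\<And>vs. vs \<in> set Ks \<Longrightarrow> length vs \<le> L" and Ln: "L \<le> length Ks" "L \<le> B"
    and V: "\<And>vs x. vs \<in> set Ks \<Longrightarrow> x \<in> set vs \<Longrightarrow> x \<le> B"
    and cont: "\<And>\<tau>. bnd \<tau> \<Longrightarrow> (\<And>k. \<tau> 10 k = (if k < length Ks then length (Ks ! k) else 0)) \<Longrightarrow>
      (\<And>k x. k < length Ks \<Longrightarrow> x < length (Ks ! k) \<Longrightarrow> \<tau> 11 (k * length Ks + x) = Ks ! k ! x) \<Longrightarrow>
      (\<And>k. k \<notin> {4, 5, 6, 10, 11} \<Longrightarrow> \<tau> k = \<sigma> k) \<Longrightarrow>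
      wpb R (block cs) (T - (real (length Ks) * (real L * 30 + 50) + 9)) Q (State \<tau> [] ys us vs)"
  shows "wpb R (block (parse_prog @ cs)) T Q (State \<sigma> (concat (map (\<lambda>vs. length vs # vs) Ks)) ys us vs)"
proof -
  define n where "n = length Ks"
  have sn: "\<sigma> (Suc 0) 0 = n" using s(1) by (simp add: n_def)
  define I :: invariant where "I = (\<lambda>l \<tau> xs ys' us' vs'.
    \<tau> 5 0 = l \<and> \<tau> 1 0 = n \<and> (\<forall>k. \<tau> 10 k = (if k < l then length (Ks ! k) else 0)) \<and>
    (\<forall>k x. k < l \<longrightarrow> x < length (Ks ! k) \<longrightarrow> \<tau> 11 (k * n + x) = Ks ! k ! x) \<and>
    (\<forall>k. k \<notin> {4, 5, 6, 10, 11} \<longrightarrow> \<tau> k = \<sigma> k) \<and>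
    xs = concat (map (\<lambda>vs. length vs # vs) (drop l Ks)) \<and> ys' = ys \<and> us' = us \<and> vs' = vs)"
  have step: "wpb R parse_body (real L * 30 + 38)
     (loop_post 5 l I)
     (State \<tau> xs ys' us' vs')" if l: "l < n" and b: "bnd \<tau>" and inv: "I l \<tau> xs ys' us' vs'" for l \<tau> xs ys' us' vs'
  proof -
    define rest where "rest = concat (map (\<lambda>vs. length vs # vs) (drop (Suc l) Ks))"
    have xs: "xs = length (Ks ! l) # Ks ! l @ rest"
      using inv l by (simp add: I_def rest_def n_def flip: Cons_nth_drop_Suc)
    have m: "Ks ! l \<in> set Ks" using l by (simp add: n_def)
    have lB: "length (Ks ! l) \<le> B" "length (Ks ! l) \<le> L" using L[OF m] Ln by auto
    have t: "\<tau> 5 0 = l" "\<tau> 1 0 = n" "\<tau> (Suc 0) 0 = n" "\<And>k. \<tau> 10 k = (if k < l then length (Ks ! k) else 0)"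
      "\<And>k x. k < l \<Longrightarrow> x < length (Ks ! k) \<Longrightarrow> \<tau> 11 (k * n + x) = Ks ! k ! x"
      "\<And>k. k \<notin> {4, 5, 6, 10, 11} \<Longrightarrow> \<tau> k = \<sigma> k"
      "ys' = ys" "us' = us" "vs' = vs" using inv by (simp_all add: I_def sn)
    note t = t sn
    define \<sigma>' where "\<sigma>' = set_reg 6 (length (Ks ! l)) (\<tau>(10 := (\<tau> 10)(l := length (Ks ! l))))"
    define J :: invariant where "J = (\<lambda>j \<tau>' xs' ys'' us'' vs''.
      \<tau>' 4 0 = j \<and> (\<forall>y<j. \<tau>' 11 (l * n + y) = Ks ! l ! y) \<and> (\<forall>a<l * n. \<tau>' 11 a = \<tau> 11 a) \<and>
      (\<forall>k. k \<noteq> 4 \<longrightarrow> k \<noteq> 11 \<longrightarrow> \<tau>' k = \<sigma>' k) \<and> xs' = drop j (Ks ! l) @ rest \<and> ys'' = ys \<and> us'' = us \<and> vs'' = vs)"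
    have s': "\<sigma>' 5 0 = l" "\<sigma>' 1 0 = n" "\<sigma>' (Suc 0) 0 = n" "\<sigma>' 6 0 = length (Ks ! l)" by (simp_all add: \<sigma>'_def t)
    have step': "wpb R (Read 11 (Bin OAdd (Bin OMul (reg 5) (reg 1)) (reg 4))) 10
        (loop_post 4 j J)
        (State \<tau>' xs' ys'' us'' vs'')" if j: "j < length (Ks ! l)" and b: "bnd \<tau>'" and inv: "J j \<tau>' xs' ys'' us'' vs''" for j \<tau>' xs' ys'' us'' vs''
    proof -
      have xs': "xs' = Ks ! l ! j # drop (Suc j) (Ks ! l) @ rest"
        using inv j by (simp add: J_def flip: Cons_nth_drop_Suc)
      show ?thesis unfolding xs'
        by (rule wpb_Read1[OF b _ refl]) (use inv j V[OF m] s' in \<open>auto simp: J_def less_Suc_eq\<close>)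
    qed
    have fin: "I (Suc l) (set_reg 5 (Suc l) \<tau>') rest ys us vs" if "J (length (Ks ! l)) \<tau>' xs' ys'' us'' vs''" for \<tau>' xs' ys'' us'' vs''
    proof -
      have f: "\<And>k. k \<noteq> 4 \<Longrightarrow> k \<noteq> 11 \<Longrightarrow> \<tau>' k = \<sigma>' k" and g: "\<And>a. a < l * n \<Longrightarrow> \<tau>' 11 a = \<tau> 11 a"
        and h: "\<And>y. y < length (Ks ! l) \<Longrightarrow> \<tau>' 11 (l * n + y) = Ks ! l ! y"
        using that by (auto simp: J_def)
      have "\<tau>' 11 (k * n + x) = Ks ! k ! x" if "k < Suc l" "x < length (Ks ! k)" for k x
      \<comment> \<open>An earlier row lies below cell l n, where this round writes nothing.\<close>
      proof (cases "k = l")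
        case True then show ?thesis using h that by simp
      next
        case False
        then have k: "k < l" using that by simp
        have "x < n" using that(2) L[of "Ks ! k"] Ln k l by (auto simp: n_def intro: less_le_trans)
        then show ?thesis using index_less[OF k, of x n] g t(5)[OF k that(2)] by simp
      qed
      then show ?thesis unfolding I_def by (auto simp: f s' \<sigma>'_def t less_Suc_eq rest_def)
    qed
    show ?thesis unfolding xs \<open>ys' = ys\<close> \<open>us' = us\<close> \<open>vs' = vs\<close>
      apply (rule wpb_Read[OF b], simp, simp add: t, simp add: lB)
      apply (rule wpb_assign_reg, assumption, simp, simp add: t, simp add: lB)
      apply (fold \<sigma>'_def)
      apply (rule wpb_for[where I = J and n = "length (Ks ! l)" and Tb = 10], assumption)
         apply (simp add: J_def, simp add: \<sigma>'_def)
        apply (rule step'; assumption)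
       apply (simp add: J_def s')
      apply (rule wpb_Nil, simp, use lB in simp)
      subgoal for \<tau>' xs' ys'' us'' vs''
        using fin[of \<tau>' xs' ys'' us'' vs''] by (auto simp: J_def s')
      done
  qed
  show ?thesis unfolding parse_prog_def append_Cons append_Nil
    apply (rule wpb_for[where I = I and n = n and Tb = "real L * 30 + 38"], rule b)
       apply (simp add: I_def s sn[unfolded n_def] n_def)
      apply (rule step; assumption)
     apply (simp add: I_def sn)
    subgoal premises p for \<tau> xs ys' us' vs'
    proof -
      have e: "xs = []" "ys' = ys" "us' = us" "vs' = vs" using p(2) by (simp_all add: I_def n_def)
      have T: "T - (real n * (real L * 30 + 38 + 12) + 9) = T - (real (length Ks) * (real L * 30 + 50) + 9)"
        by (simp add: n_def)
      have "wpb R (block cs) (T - (real (length Ks) * (real L * 30 + 50) + 9)) Q (State \<tau> [] ys us vs)"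
        using p(2) unfolding I_def n_def by (intro cont[OF p(1)]) blast+
      then show ?thesis unfolding e T .
    qed
    done
qed

end

section \<open>Padding to a power of two, and the table of facets\<close>

context machine begin

lemma wpb_double:
  assumes b: "bnd \<sigma>" and s: "\<sigma> 1 0 = n" and n: "1 \<le> n" "2 * n \<le> B"
    and cont: "\<And>\<tau> K. bnd \<tau> \<Longrightarrow> \<tau> 2 0 = 2 ^ K \<Longrightarrow> n \<le> 2 ^ K \<Longrightarrow> 2 ^ K < 2 * n \<Longrightarrow>
      (\<And>k. k \<notin> {2, 4} \<Longrightarrow> \<tau> k = \<sigma> k) \<Longrightarrow>
      wpb R (block cs) (T - (real n * 40 + 20)) Q (State \<tau> xs ys us vs)"
  shows "wpb R (block (double_prog @ cs)) T Q (State \<sigma> xs ys us vs)"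
proof -
  have s': "\<sigma> (Suc 0) 0 = n" using s by simp
  define I :: invariant where "I = (\<lambda>l \<tau> xs' ys' us' vs'.
    \<tau> 4 0 = l \<and> (\<exists>K. \<tau> 2 0 = 2 ^ K \<and> 2 ^ K < 2 * n \<and> (n \<le> 2 ^ K \<or> l \<le> K)) \<and>
    (\<forall>k. k \<notin> {2, 4} \<longrightarrow> \<tau> k = \<sigma> k) \<and> xs' = xs \<and> ys' = ys \<and> us' = us \<and> vs' = vs)"
  have step: "wpb R double_body 28
     (loop_post 4 l I)
     (State \<tau> xs' ys' us' vs')" if l: "l < n" and b: "bnd \<tau>" and inv: "I l \<tau> xs' ys' us' vs'" for l \<tau> xs' ys' us' vs'
  proof -
    obtain K where K: "\<tau> 2 0 = 2 ^ K" "2 ^ K < 2 * n" "n \<le> 2 ^ K \<or> l \<le> K" and t: "\<tau> 4 0 = l"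
      and fr: "\<And>k. k \<notin> {2, 4} \<Longrightarrow> \<tau> k = \<sigma> k"
      and e: "xs' = xs" "ys' = ys" "us' = us" "vs' = vs" using inv by (auto simp: I_def)
    have t1: "\<tau> 1 0 = n" "\<tau> (Suc 0) 0 = n" using fr s' by simp_all
    have 1: "I (Suc l) (set_reg 4 (Suc l) (set_reg 2 (2 * 2 ^ K) \<tau>)) xs ys us vs" if "2 ^ K < n"
      unfolding I_def using that K fr by (auto intro!: exI[of _ "Suc K"])
    have 2: "I (Suc l) (set_reg 4 (Suc l) \<tau>) xs ys us vs" if "\<not> 2 ^ K < n"
      unfolding I_def using that K fr by (auto intro!: exI[of _ K])
    show ?thesis unfolding e
      apply (rule wpb_Cond[OF b], simp)
       apply (simp only: append_Cons append_Nil)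
       apply (rule wpb_assign_reg[where x = "2 * 2 ^ K", OF b], simp, simp add: K, use K t1 n in simp)
       apply (rule wpb_Nil, simp, simp, use 1 K t1 t in simp)
      apply (simp only: append_Nil)
      apply (rule wpb_Nil, simp add: b, simp, use 2 K t1 t in simp)
      done
  qed
  show ?thesis unfolding double_prog_def append_Cons append_Nil
    apply (rule wpb_assign_reg[OF b], simp, simp, use two_le_B in simp)
    apply (rule wpb_for[where I = I and n = n and Tb = 28], assumption)
       apply (use n in \<open>simp add: I_def exI[of _ 0]\<close>)
      apply (rule step; assumption)
     apply (simp add: I_def s')
    subgoal premises p for \<tau> xs' ys' us' vs'
    proof -
      obtain K where K: "\<tau> 2 0 = 2 ^ K" "2 ^ K < 2 * n" "n \<le> 2 ^ K \<or> n \<le> K"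
        and fr: "\<And>k. k \<notin> {2, 4} \<Longrightarrow> \<tau> k = \<sigma> k"
        and e: "xs' = xs" "ys' = ys" "us' = us" "vs' = vs" using p(3) by (auto simp: I_def)
      have "n \<le> 2 ^ K" using K(3) less_exp[of K] by linarith
      from cont[OF p(2) K(1) this K(2) fr] show ?thesis unfolding e by (rule wpb_mono) simp_all
    qed
    done
qed

text \<open>\<open>S\<close> is total on indices, so pairs that involve padding need no separate
  treatment.\<close>

lemma wpb_incidence:
  assumes b: "bnd \<sigma>" and s: "\<sigma> 1 0 = n" "\<sigma> 2 0 = N" and N: "1 \<le> N" "N * N \<le> B"
    and len: "\<And>i. \<sigma> 10 i = length (S i)" and vert: "\<And>i x. x < length (S i) \<Longrightarrow> \<sigma> 11 (i * n + x) = S i ! x"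
    and L: "\<And>i. length (S i) \<le> L" and LB: "L \<le> B"
    and V: "\<And>i x. x \<in> set (S i) \<Longrightarrow> x \<le> B"
    and cont: "\<And>\<tau> vs. bnd \<tau> \<Longrightarrow> \<tau> 3 0 = N * N \<Longrightarrow> stored (\<tau> 12) N N (\<lambda>i j. of_bool (is_facet (S i) (S j))) \<Longrightarrow>
      (\<And>k. k \<notin> {3, 4, 5, 12, 23, 24, 25, 26} \<Longrightarrow> \<tau> k = \<sigma> k) \<Longrightarrow>
      wpb R (block cs) (T - (real (N * N) * (real L * 160 + 300) + 20)) Q (State \<tau> xs ys [] vs)"
  shows "wpb R (block (incidence_prog @ cs)) T Q (State \<sigma> xs ys [] vs)"
proof -
  have s': "\<sigma> (Suc 0) 0 = n" using s by simp
  define g where "g k = word_of_bit (of_bool (is_facet (S (k div N)) (S (k mod N))))" for k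
  have g: "of_bool (is_facet (S (k div N)) (S (k mod N))) = g k" for k by (simp add: g_def word_of_bit_def)
  define I :: invariant where "I = (\<lambda>l \<tau> xs' ys' us' vs'.
    \<tau> 5 0 = l \<and> \<tau> 3 0 = N * N \<and> (\<forall>k<l. \<tau> 12 k = g k) \<and>
    (\<forall>k. k \<notin> {3, 4, 5, 12, 23, 24, 25, 26} \<longrightarrow> \<tau> k = \<sigma> k) \<and> xs' = xs \<and> ys' = ys \<and> us' = [])"
  have step: "wpb R incidence_body (real L * 160 + 240)
     (loop_post 5 l I)
     (State \<tau> xs' ys' us' vs')" if l: "l < N * N" and b: "bnd \<tau>" and inv: "I l \<tau> xs' ys' us' vs'" for l \<tau> xs' ys' us' vs'
  proof -
    have t: "\<tau> 5 0 = l" "\<tau> 3 0 = N * N" "\<And>k. k < l \<Longrightarrow> \<tau> 12 k = g k"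
      "\<And>k. k \<notin> {3, 4, 5, 12, 23, 24, 25, 26} \<Longrightarrow> \<tau> k = \<sigma> k"
      and e: "xs' = xs" "ys' = ys" "us' = []" using inv by (simp_all add: I_def)
    define i j where "i = l div N" and "j = l mod N"
    have ij: "i \<le> B" "j \<le> B" using l N by (auto simp: i_def j_def intro: order_trans[OF div_le_dividend] order_trans[OF mod_less_eq_dividend])
    have LL: "real (length (S i)) \<le> real L" "real (length (S j)) \<le> real L" using L by simp_all
    have lB: "length (S i) \<le> B" "length (S j) \<le> B" using L LB by (auto intro: order_trans)
    have gB: "g l \<le> B" "of_bool (is_facet (S i) (S j)) = g l" using two_le_B by (auto simp: g_def i_def j_def word_of_bit_def)
    show ?thesis unfolding e
      apply (rule wpb_assign_reg[where x = i, OF b], simp, simp add: t s i_def, rule ij)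
      apply (rule wpb_assign_reg[where x = j], assumption, simp, simp add: t s j_def, rule ij)
      apply (rule wpb_assign_reg[where x = "length (S i)"], assumption, simp, simp add: t len, rule lB)
      apply (rule wpb_assign_reg[where x = "length (S j)"], assumption, simp, simp add: t len, rule lB)
      apply (rule wpb_Pass, assumption, simp, simp)
      apply (rule wpb_pass_loop[where n = "length (S i)" and f = "(!) (S i)"], assumption, simp, simp, simp)
       apply (simp add: t s' vert)
      apply (rule wpb_Pass, assumption, simp, simp)
      apply (rule wpb_pass_loop[where n = "length (S j)" and f = "(!) (S j)"], assumption, simp, simp, simp)
       apply (simp add: t s' vert)
      apply (rule wpb_Call[where TR = "real L * 100 + 100" and zs = "[g l]"])
        apply (use facet_proc[of "S i" L "S j"] L V LB gB in \<open>simp add: map_nth\<close>)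
       apply assumption
      apply (rule wpb_Fetch[where j = l], assumption, simp, simp add: t, simp add: gB)
      apply (rule wpb_Nil, simp)
       apply (use LL in simp)
      apply (use t in \<open>auto simp: I_def less_Suc_eq\<close>)
      done
  qed
  show ?thesis unfolding incidence_prog_def append_Cons append_Nil
    apply (rule wpb_assign_reg[OF b], simp, simp, use N s in simp)
    apply (rule wpb_for[where I = I and n = "N * N" and Tb = "real L * 160 + 240"], assumption)
       apply (simp add: I_def s)
      apply (rule step; assumption)
     apply (simp add: I_def)
    subgoal premises p for \<tau> xs' ys' us' vs'
    proof -
      have I: "I (N * N) \<tau> xs' ys' us' vs'" by (rule p(3))
      have e: "xs' = xs" "ys' = ys" "us' = []" using I by (simp_all add: I_def)
      have "wpb R (block cs) (T - (real (N * N) * (real L * 160 + 300) + 20)) Q (State \<tau> xs ys [] vs')"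
      proof (rule cont[OF p(2)])
        show "\<tau> 3 0 = N * N" using I by (simp add: I_def)
        show "stored (\<tau> 12) N N (\<lambda>i j. of_bool (is_facet (S i) (S j)))"
          using I by (auto simp: I_def stored_def g_def)
        show "\<tau> k = \<sigma> k" if "k \<notin> {3, 4, 5, 12, 23, 24, 25, 26}" for k using I that by (simp add: I_def)
      qed
      then show ?thesis unfolding e by (rule wpb_mono) (simp_all add: algebra_simps)
    qed
    done
qed

end

text \<open>Every position indexes a row and a column, whatever its dimension, and unwanted columns
  are masked to zero; so both boundary matrices are square with a power of two as size. Arrays: 12
  the facet table, 13 first D_p and then D_(p+1), 14 the generalized inverse of D_p, 15 the
  projection onto cycles, 17 the final generalized inverse.\<close>

definition mats_prog :: "com \<Rightarrow> com list" where
  "mats_prog P = [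
     for_loop 4 3 (Assign 13 (reg 4) (Bin OMul (Cell 12 (reg 4)) (Bin OEq (Cell 10 (Bin OMod (reg 4) (reg 2))) (Bin OAdd (reg 0) (Num 1))))),
     Pass (reg 2), Pass (reg 2), for_loop 4 3 (Pass (Cell 13 (reg 4))), Call (ginv_prog P), for_loop 4 3 (Fetch 14 (reg 4)),
     Pass (Num 1), Pass (reg 2), for_loop 4 3 (Pass (Cell 14 (reg 4))), for_loop 4 3 (Pass (Cell 13 (reg 4))),
     Call (tn_prog P), for_loop 4 3 (Fetch 15 (reg 4)),
     for_loop 4 3 (Assign 15 (reg 4) (Bin OMul
       (add_mod2 (Cell 15 (reg 4)) (Bin OEq (Bin ODiv (reg 4) (reg 2)) (Bin OMod (reg 4) (reg 2))))
       (Bin OEq (Cell 10 (Bin OMod (reg 4) (reg 2))) (Bin OAdd (reg 0) (Num 1))))),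
     for_loop 4 3 (Assign 13 (reg 4) (Bin OMul (Cell 12 (reg 4)) (Bin OEq (Cell 10 (Bin OMod (reg 4) (reg 2))) (Bin OAdd (reg 0) (Num 2))))),
     Assign 7 (Num 0) (Bin OMul (Num 2) (reg 2)), Assign 8 (Num 0) (Bin OMul (reg 2) (reg 7)),
     Pass (reg 2), Pass (reg 7),
     for_loop 4 8 (Pass (Bin OAdd
        (Bin OMul (Bin OLess (Bin OMod (reg 4) (reg 7)) (reg 2))
          (Cell 13 (Bin OAdd (Bin OMul (Bin ODiv (reg 4) (reg 7)) (reg 2)) (Bin OMod (reg 4) (reg 7)))))
        (Bin OMul (Bin OSub (Num 1) (Bin OLess (Bin OMod (reg 4) (reg 7)) (reg 2)))
          (Cell 15 (Bin OAdd (Bin OMul (Bin ODiv (reg 4) (reg 7)) (reg 2)) (Bin OSub (Bin OMod (reg 4) (reg 7)) (reg 2))))))),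
     Call (ginv_prog P), for_loop 4 8 (Fetch 17 (reg 4))]"

text \<open>A column is tested by the ordinary sum of its 0/1 words, which, unlike the sum modulo 2,
  vanishes only for a zero column.\<close>

abbreviation select_body :: "com" where
  "select_body \<equiv> block [Assign 6 (Num 0) (Num 0),
       for_loop 4 2 (Assign 6 (Num 0) (Bin OAdd (reg 6) (Cell 17 (Bin OAdd (Bin OMul (reg 4) (reg 7)) (Bin OAdd (reg 2) (reg 5)))))),
       Cond (reg 6) (block [Assign 18 (reg 9) (reg 5), Assign 9 (Num 0) (Bin OAdd (reg 9) (Num 1))]) (block [])]"

definition select_prog :: "com list" where
  "select_prog = [Assign 9 (Num 0) (Num 0),
     for_loop 5 2 select_body]"

abbreviation output_body :: "com" where
  "output_body \<equiv> block [Cond (Bin OEq (Cell 10 (reg 5)) (Bin OAdd (reg 0) (Num 1)))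
       (block [for_loop 4 9 (Write (Cell 19 (Bin OAdd (Bin OMul (reg 5) (reg 9)) (reg 4))))]) (block [])]"

definition output_prog :: "com list" where
  "output_prog = [Assign 22 (Num 0) (Bin OMul (reg 1) (reg 9)),
     for_loop 4 22 (Assign 19 (reg 4) (Cell 17 (Bin OAdd (Bin OMul (Bin ODiv (reg 4) (reg 9)) (reg 7)) (Bin OAdd (reg 2) (Cell 18 (Bin OMod (reg 4) (reg 9))))))),
     Write (reg 9),
     for_loop 5 1 output_body]"

text \<open>For a generalized inverse these are the basis columns in the right half, counted from
  its left end.\<close>

definition nonzero_cols :: "nat \<Rightarrow> bmat \<Rightarrow> nat \<Rightarrow> nat list" where
  "nonzero_cols N G m = filter (\<lambda>c. \<exists>i<N. G i (N + c) \<noteq> 0) [0..<m]"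

definition incidence :: "(nat \<Rightarrow> nat list) \<Rightarrow> nat \<Rightarrow> bmat" where
  "incidence S p = (\<lambda>i j. of_bool (is_facet (S i) (S j)) * of_bool (length (S j) = p + 1))"

text \<open>The columns of \<open>I - G D\<^sub>p\<close> that belong to \<open>p\<close>-simplices.\<close>

definition kernel_projection :: "(nat \<Rightarrow> nat list) \<Rightarrow> nat \<Rightarrow> nat \<Rightarrow> bmat" where
  "kernel_projection S p K = (\<lambda>i j.
     (of_bool (i = j) + tmul (2 ^ K) (gamma (2 ^ K) K (incidence S p)) (incidence S p) i j) * of_bool (length (S j) = p + 1))"

text \<open>The order of the halves matters: with the boundaries on the left, the basis columns
  found on the right extend a basis of the boundaries to one of the cycles, and so represent a basis
  of homology.\<close>

definition annot_mat :: "(nat \<Rightarrow> nat list) \<Rightarrow> nat \<Rightarrow> nat \<Rightarrow> bmat" where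
  "annot_mat S p K = gamma (2 ^ K) (Suc K) (glue (2 ^ K) (incidence S (p + 1)) (kernel_projection S p K))"

lemma word_of_bit_mult_of_bool: "word_of_bit a * of_bool Q = word_of_bit (a * of_bool Q)"
  by (cases Q) simp_all

lemma word_of_bit_of_bool: "word_of_bit (of_bool Q) = of_bool Q"
  by (simp add: word_of_bit_def)

section \<open>From the facet table to the annotation\<close>

context mul_machine begin

text \<open>The dominant costs are two generalized inverses, of widths \<open>N\<close> and 2 N, and
  one product of a single pair of blocks; the rest is linear in the number of entries.\<close>

lemma wpb_mats:
  assumes b: "bnd \<sigma>" and N: "N = 2 ^ K" "N \<le> Nmax"
    and D: "150 \<le> D" "5 * (C + 400) + 3000 \<le> D * (2 powr (\<omega> - 1) - 2)"
    and s: "\<sigma> 0 0 = p" "\<sigma> 2 0 = N" "\<sigma> 3 0 = N * N" "\<And>i. \<sigma> 10 i = length (S i)"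
    and st: "stored (\<sigma> 12) N N (\<lambda>i j. of_bool (is_facet (S i) (S j)))"
    and cont: "\<And>\<tau> vs. bnd \<tau> \<Longrightarrow> stored (\<tau> 17) N (2 * N) (annot_mat S p K) \<Longrightarrow> \<tau> 7 0 = 2 * N \<Longrightarrow>
      (\<And>k. k \<notin> {4, 7, 8, 13, 14, 15, 17} \<Longrightarrow> \<tau> k = \<sigma> k) \<Longrightarrow>
      wpb R (block cs) (T - (D * real N * real N powr (\<omega> - 1) + (C + 400) * real N powr \<omega> +
          D * real N * real (2 * N) powr (\<omega> - 1) + real (N * N) * 600 + 300)) Q (State \<tau> xs ys [] vs)"
  shows "wpb R (block (mats_prog P @ cs)) T Q (State \<sigma> xs ys [] vs)"
proof -
  have N1: "1 \<le> N" by (simp add: N)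
  have "N * N \<le> Nmax * Nmax" using N(2) by (intro mult_le_mono)
  then have "8 * (N * N) \<le> B" using Nmax by (simp add: power2_eq_square)
  moreover have "N \<le> N * N" by simp
  ultimately have mB: "2 * N \<le> B" "N * (2 * N) \<le> B" using N1 by linarith+
  define F where "F = (\<lambda>i j. of_bool (is_facet (S i) (S j)) :: bit)"
  define Dp where "Dp = incidence S p"
  define G where "G = gamma N K Dp"
  define P2 where "P2 = kernel_projection S p K"
  define T1 where "T1 = D * real N * real N powr (\<omega> - 1)"
  define T2 where "T2 = (C + 400) * real N powr \<omega>"
  define T3 where "T3 = D * real N * real (2 * N) powr (\<omega> - 1)"
  have gi: "proc (ginv_prog P) (N # N # enc N N Dp) T1 (enc N N G)"
    using ginv_proc[OF N D, of K Dp] by (simp add: G_def T1_def flip: N(1))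
  have tn: "proc (tn_prog P) (Suc 0 # N # enc N N G @ enc N N Dp) T2 (enc N N (tmul N G Dp))"
    using tn_proc[OF N1, of 1 G Dp] N(2) by (simp add: T2_def)
  have gi2: "proc (ginv_prog P) (N # 2 * N # enc N (2 * N) (glue N (incidence S (p + 1)) P2)) T3 (enc N (2 * N) (annot_mat S p K))"
    using ginv_proc[OF N D, of "Suc K"] by (simp add: annot_mat_def T3_def P2_def flip: N(1))
  have kdiv: "i div N < N" "i mod N < N" if "i < N * N" for i
    using that N1 by (auto simp: less_mult_imp_div_less)
  have kdiv2: "i div (2 * N) < N" "i mod (2 * N) < 2 * N" if "i < N * (2 * N)" for i
    using that N1 by (auto simp: less_mult_imp_div_less)
  have stD: "h k = word_of_bit (M (k div N) (k mod N))" if "stored h N N M" "k < N * N" for h M k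
    using that by (simp add: stored_def)
  have stI: "h (i * N + j) = word_of_bit (M i j)" if "stored h N N M" "i < N" "j < N" for h M i j
    using that index_less[OF that(2,3)] by (simp add: stored_def index_div_mod)
  have stI': "h (i * N + x - N) = word_of_bit (V i (x - N))" if "stored h N N V" "i < N" "N \<le> x" "x < 2 * N" for h V i x
    using stI[OF that(1,2), of "x - N"] that by simp
  have m1: "word_of_bit (F i j) * of_bool (length (S j) = Suc q) = word_of_bit (incidence S q i j)" for i j q
    by (simp add: word_of_bit_mult_of_bool incidence_def F_def)
  have m2: "(word_of_bit (tmul N G Dp i j) + of_bool (i = j)) mod 2 * of_bool (length (S j) = Suc p) = word_of_bit (P2 i j)" for i j
  proof -
    have "(word_of_bit (tmul N G Dp i j) + of_bool (i = j)) mod 2 = word_of_bit (of_bool (i = j) + tmul N G Dp i j)"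
      unfolding word_of_bit_of_bool[symmetric] by (rule word_of_bit_add) (rule add.commute)
    then show ?thesis
      by (simp only: word_of_bit_mult_of_bool P2_def kernel_projection_def N(1)[symmetric] G_def Dp_def Suc_eq_plus1)
  qed
  note s0 = s(1) s(2) s(3) s(4)
  show ?thesis unfolding mats_prog_def append_Cons append_Nil
    apply (rule wpb_map_stored[where r = N and c = N and M = Dp, OF b], simp add: s, simp, simp)
     apply (simp add: s0 stD[OF st[folded F_def]] m1 Dp_def)
    apply (rule wpb_Pass, assumption, simp, simp)
    apply (rule wpb_Pass, assumption, simp, simp)
    apply (rule wpb_pass_stored[where r = N and c = N and M = Dp], assumption, simp add: s0, simp, simp)
    apply (rule wpb_Call[where TR = T1 and zs = "enc N N G"], use gi in \<open>simp add: s0\<close>, assumption)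
    apply (rule wpb_fetch_stored, assumption, simp add: s0, simp)
    apply (rule wpb_Pass, assumption, simp, simp)
    apply (rule wpb_Pass, assumption, simp, simp)
    apply (rule wpb_pass_stored[where r = N and c = N and M = G], assumption, simp add: s0, simp, simp)
    apply (rule wpb_pass_stored[where r = N and c = N and M = Dp], assumption, simp add: s0, simp, simp)
    apply (rule wpb_Call[where TR = T2 and zs = "enc N N (tmul N G Dp)"], use tn in \<open>simp add: s0\<close>, assumption)
    apply (rule wpb_fetch_stored, assumption, simp add: s0, simp)
    apply (rule wpb_map_stored[where r = N and c = N and M = P2], assumption, simp add: s0, simp, simp)
     apply (simp add: s0 stD[where M = "tmul N G Dp"] m2)
    apply (rule wpb_map_stored[where r = N and c = N and M = "incidence S (p + 1)"], assumption, simp add: s0, simp, simp)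
     apply (simp add: s0 stD[OF st[folded F_def]] m1)
    apply (rule wpb_assign_reg[where x = "2 * N"], assumption, simp, simp add: s0, rule mB)
    apply (rule wpb_assign_reg[where x = "N * (2 * N)"], assumption, simp, simp add: s0, rule mB)
    apply (rule wpb_Pass, assumption, simp, simp)
    apply (rule wpb_Pass, assumption, simp, simp)
    apply (rule wpb_pass_loop[where n = "N * (2 * N)" and f = "\<lambda>k. word_of_bit (glue N (incidence S (p + 1)) P2 (k div (2 * N)) (k mod (2 * N)))"],
        assumption, simp, simp, simp)
     apply (simp add: s0 glue_def kdiv2 stI[where M = "incidence S (Suc p)"] stI'[where V = P2])
    apply (rule wpb_Call[where TR = T3 and zs = "enc N (2 * N) (annot_mat S p K)"], use gi2 in \<open>simp add: s0 enc_def\<close>, assumption)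
    apply (rule wpb_fetch_stored, assumption, simp, simp)
    subgoal for \<tau>1 \<tau>2 \<tau>3 vs3 \<tau>4 \<tau>5 \<tau>6 vs6 \<tau>7 \<tau>8 \<tau>9 vs9
      apply (rule wpb_mono)
        apply (rule cont[of \<tau>9, folded T1_def T2_def T3_def], assumption, assumption, simp, simp)
       apply (use N1 in \<open>simp add: algebra_simps\<close>)
      apply assumption
      done
    done
qed

lemma wpb_select:
  assumes b: "bnd \<sigma>" and N: "1 \<le> N" "2 * N \<le> B"
    and s: "\<sigma> 2 0 = N" "\<sigma> 7 0 = 2 * N" and st: "stored (\<sigma> 17) N (2 * N) G"
    and cont: "\<And>\<tau>. bnd \<tau> \<Longrightarrow> \<tau> 9 0 = length (nonzero_cols N G N) \<Longrightarrow>
      (\<And>t. t < length (nonzero_cols N G N) \<Longrightarrow> \<tau> 18 t = nonzero_cols N G N ! t) \<Longrightarrow>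
      (\<And>k. k \<notin> {4, 5, 6, 9, 18} \<Longrightarrow> \<tau> k = \<sigma> k) \<Longrightarrow>
      wpb R (block cs) (T - (real (N * N) * 40 + real N * 60 + 20)) Q (State \<tau> xs ys us vs)"
  shows "wpb R (block (select_prog @ cs)) T Q (State \<sigma> xs ys us vs)"
proof -
  have stI: "\<sigma> 17 (i * (2 * N) + (N + j)) = word_of_bit (G i (N + j))" if "i < N" "j < N" for i j
  proof -
    have "N + j < 2 * N" using that by simp
    then show ?thesis using that st index_less[OF that(1), of "N + j" "2 * N"]
      by (simp add: stored_def index_div_mod)
  qed
  have lenj: "length (nonzero_cols N G m) \<le> m" for m
    unfolding nonzero_cols_def using length_filter_le[of _ "[0..<m]"] by simp
  define I :: invariant where "I = (\<lambda>l \<tau> xs' ys' us' vs'.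
    \<tau> 5 0 = l \<and> \<tau> 9 0 = length (nonzero_cols N G l) \<and>
    (\<forall>t<length (nonzero_cols N G l). \<tau> 18 t = nonzero_cols N G l ! t) \<and>
    (\<forall>k. k \<notin> {4, 5, 6, 9, 18} \<longrightarrow> \<tau> k = \<sigma> k) \<and> xs' = xs \<and> ys' = ys \<and> us' = us \<and> vs' = vs)"
  have step: "wpb R select_body
     (real N * 40 + 48)
     (loop_post 5 l I)
     (State \<tau> xs' ys' us' vs')" if l: "l < N" and b: "bnd \<tau>" and inv: "I l \<tau> xs' ys' us' vs'" for l \<tau> xs' ys' us' vs'
  proof -
    have t: "\<tau> 5 0 = l" "\<tau> 9 0 = length (nonzero_cols N G l)"
      "\<And>t. t<length (nonzero_cols N G l) \<Longrightarrow> \<tau> 18 t = nonzero_cols N G l ! t"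
      "\<And>k. k \<notin> {4, 5, 6, 9, 18} \<Longrightarrow> \<tau> k = \<sigma> k"
      and e: "xs' = xs" "ys' = ys" "us' = us" "vs' = vs" using inv by (simp_all add: I_def)
    define J :: invariant where "J = (\<lambda>i \<tau>' xs' ys' us' vs'.
      \<tau>' 4 0 = i \<and> \<tau>' 6 0 \<le> i \<and> (\<tau>' 6 0 = 0 \<longleftrightarrow> (\<forall>i'<i. G i' (N + l) = 0)) \<and>
      (\<forall>k. k \<notin> {4, 6} \<longrightarrow> \<tau>' k = \<tau> k) \<and> xs' = xs \<and> ys' = ys \<and> us' = us \<and> vs' = vs)"
    have step': "wpb R (Assign 6 (Num 0) (Bin OAdd (reg 6) (Cell 17 (Bin OAdd (Bin OMul (reg 4) (reg 7)) (Bin OAdd (reg 2) (reg 5)))))) 28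
        (loop_post 4 i J)
        (State \<tau>' xs'' ys'' us'' vs'')" if i: "i < N" and b: "bnd \<tau>'" and inv: "J i \<tau>' xs'' ys'' us'' vs''" for i \<tau>' xs'' ys'' us'' vs''
    proof -
      have t': "\<tau>' 4 0 = i" "\<tau>' 6 0 \<le> i" "\<tau>' 6 0 = 0 \<longleftrightarrow> (\<forall>i'<i. G i' (N + l) = 0)"
        "\<And>k. k \<notin> {4, 6} \<Longrightarrow> \<tau>' k = \<tau> k"
        and e: "xs'' = xs" "ys'' = ys" "us'' = us" "vs'' = vs" using inv by (simp_all add: J_def)
      have v: "ev (Bin OAdd (reg 6) (Cell 17 (Bin OAdd (Bin OMul (reg 4) (reg 7)) (Bin OAdd (reg 2) (reg 5))))) \<tau>' =
          \<tau>' 6 0 + word_of_bit (G i (N + l))"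
        using stI[OF i l] by (simp add: t' t s)
      have le: "\<tau>' 6 0 + word_of_bit (G i (N + l)) \<le> Suc i"
        using t'(2) word_of_bit_le[of "G i (N + l)"] by simp
      have J: "J (Suc i) (set_reg 4 (Suc i) (set_reg 6 (\<tau>' 6 0 + word_of_bit (G i (N + l))) \<tau>')) xs ys us vs"
        unfolding J_def using le t'(3) by (auto simp: t'(4) less_Suc_eq)
      show ?thesis unfolding e
      proof (rule wpb_Assign1[OF b _ _ refl v])
        show "\<tau>' 6 0 + word_of_bit (G i (N + l)) \<le> B" using le i N by simp
      qed (use J t' in \<open>simp_all add: set_reg_def\<close>)
    qed
    have nz: "nonzero_cols N G (Suc l) = (if \<forall>i'<N. G i' (N + l) = 0 then nonzero_cols N G l else nonzero_cols N G l @ [l])"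
      by (auto simp: nonzero_cols_def)
    have lB: "l \<le> B" "Suc (length (nonzero_cols N G l)) \<le> B" using l N lenj[of l] by auto
    show ?thesis unfolding e
      apply (rule wpb_assign_reg[OF b], simp, simp, simp)
      apply (rule wpb_for[where I = J and n = N and Tb = 28], assumption)
         apply (simp add: J_def)
        apply (rule step'; assumption)
       apply (simp add: J_def t s)
      subgoal premises p for \<tau>' xs'' ys'' us'' vs''
      proof -
        have t': "\<tau>' 6 0 = 0 \<longleftrightarrow> (\<forall>i'<N. G i' (N + l) = 0)"
          "\<And>k. k \<notin> {4, 6} \<Longrightarrow> \<tau>' k = \<tau> k"
          and e: "xs'' = xs" "ys'' = ys" "us'' = us" "vs'' = vs" using p(3) by (simp_all add: J_def)
        have b': "bnd \<tau>'" by (rule p(2))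
        have 1: "I (Suc l) (set_reg 5 (Suc l) (set_reg 9 (Suc (length (nonzero_cols N G l)))
             (\<tau>'(18 := (\<tau>' 18)(length (nonzero_cols N G l) := l))))) xs ys us vs" if "\<tau>' 6 0 \<noteq> 0"
          using that unfolding I_def t' nz by (auto simp: t' t nth_append)
        have 2: "I (Suc l) (set_reg 5 (Suc l) \<tau>') xs ys us vs" if "\<tau>' 6 0 = 0"
          using that unfolding I_def t' nz by (auto simp: t' t)
        show ?thesis unfolding e
          apply (rule wpb_Cond[OF b'], simp)
           apply (simp only: append_Cons append_Nil)
           apply (rule wpb_Assign[where j = "length (nonzero_cols N G l)" and x = l, OF b'], simp, simp, simp add: t' t, simp add: t' t, rule lB)
           apply (rule wpb_assign_reg[where x = "Suc (length (nonzero_cols N G l))"], assumption, simp, simp add: t' t, rule lB)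
           apply (rule wpb_Nil, simp, simp, use 1 in \<open>simp add: t' t\<close>)
          apply (simp only: append_Nil)
          apply (rule wpb_Nil, simp add: b', simp, use 2 in \<open>simp add: t' t\<close>)
          done
      qed
      done
  qed
  show ?thesis unfolding select_prog_def append_Cons append_Nil
    apply (rule wpb_assign_reg[OF b], simp, simp, simp)
    apply (rule wpb_for[where I = I and n = N and Tb = "real N * 40 + 48"], assumption)
       apply (simp add: I_def nonzero_cols_def)
      apply (rule step; assumption)
     apply (simp add: I_def s)
    subgoal premises p for \<tau> xs' ys' us' vs'
    proof -
      have t: "\<tau> 9 0 = length (nonzero_cols N G N)"
        "\<And>t. t<length (nonzero_cols N G N) \<Longrightarrow> \<tau> 18 t = nonzero_cols N G N ! t"
        "\<And>k. k \<notin> {4, 5, 6, 9, 18} \<Longrightarrow> \<tau> k = \<sigma> k"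
        and e: "xs' = xs" "ys' = ys" "us' = us" "vs' = vs" using p(3) by (simp_all add: I_def)
      from cont[OF p(2) t] show ?thesis unfolding e by (rule wpb_mono) (simp_all add: algebra_simps)
    qed
    done
qed

text \<open>Array 19 receives the rows of all simplices, also of those not written out, so that a
  query addresses it directly by position. Together with register 9 it is the data structure left
  for the queries.\<close>

lemma wpb_output:
  assumes b: "bnd \<sigma>" and N: "1 \<le> N" "2 * (N * N) \<le> B" and n: "n \<le> N"
    and s: "\<sigma> 0 0 = p" "\<sigma> 1 0 = n" "\<sigma> 2 0 = N" "\<sigma> 7 0 = 2 * N" "\<sigma> 9 0 = g" and st: "stored (\<sigma> 17) N (2 * N) G"
    and js: "length js = g" "g \<le> N" "\<And>t. t < g \<Longrightarrow> \<sigma> 18 t = js ! t" "\<And>t. t < g \<Longrightarrow> js ! t < N"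
    and len: "\<And>i. \<sigma> 10 i = length (S i)"
    and cont: "\<And>\<tau>. bnd \<tau> \<Longrightarrow> \<tau> 9 0 = g \<Longrightarrow> stored (\<tau> 19) n g (\<lambda>i t. G i (N + js ! t)) \<Longrightarrow>
      wpb R (block cs) (T - (real (N * N) * 80 + real N * 60 + 40)) Q
        (State \<tau> xs (ys @ g # concat (map (\<lambda>i. if length (S i) = p + 1
           then map (\<lambda>t. word_of_bit (G i (N + js ! t))) [0..<g] else []) [0..<n])) us vs)"
  shows "wpb R (block (output_prog @ cs)) T Q (State \<sigma> xs ys us vs)"
proof -
  have s': "\<sigma> (Suc 0) 0 = n" using s by simp
  have stI: "\<sigma> 17 (i * (2 * N) + (N + js ! t)) = word_of_bit (G i (N + js ! t))" if "i < n" "t < g" for i t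
  proof -
    have "i < N" "N + js ! t < 2 * N" using that js(4)[of t] n by auto
    then show ?thesis using st index_less[of i N "N + js ! t" "2 * N"]
      by (simp add: stored_def index_div_mod)
  qed
  have ng: "n * g \<le> N * N" using n js(2) by (rule mult_le_mono)
  have kdiv: "k div g < n" "k mod g < g" if "k < n * g" for k
  proof -
    have "0 < g" using that by (cases g) auto
    then show "k div g < n" "k mod g < g" using that by (auto simp: less_mult_imp_div_less)
  qed
  define V where "V = (\<lambda>i t. G i (N + js ! t))"
  define Row where "Row i = (if length (S i) = p + 1 then map (\<lambda>t. word_of_bit (G i (N + js ! t))) [0..<g] else [])" for i
  define I :: invariant where "I = (\<lambda>l \<tau> xs' ys' us' vs'.
    \<tau> 5 0 = l \<and> \<tau> 1 0 = n \<and> \<tau> 9 0 = g \<and> \<tau> 0 0 = p \<and> stored (\<tau> 19) n g V \<and> (\<forall>i. \<tau> 10 i = length (S i)) \<and>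
    xs' = xs \<and> ys' = ys @ g # concat (map Row [0..<l]) \<and> us' = us \<and> vs' = vs)"
  have step: "wpb R output_body
     (real g * 30 + 40)
     (loop_post 5 l I)
     (State \<tau> xs' ys' us' vs')" if l: "l < n" and b: "bnd \<tau>" and inv: "I l \<tau> xs' ys' us' vs'" for l \<tau> xs' ys' us' vs'
  proof -
    have t: "\<tau> 5 0 = l" "\<tau> 1 0 = n" "\<tau> 9 0 = g" "\<tau> 0 0 = p" "stored (\<tau> 19) n g V" "\<And>i. \<tau> 10 i = length (S i)"
      and e: "xs' = xs" "ys' = ys @ g # concat (map Row [0..<l])" "us' = us" "vs' = vs" using inv by (simp_all add: I_def)
    have w: "\<tau> 19 (l * g + k) = word_of_bit (V l k)" if "k < g" for k
      using t(5) index_less[OF l that] that by (simp add: stored_def index_div_mod)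
    show ?thesis unfolding e
      apply (rule wpb_Cond[OF b], simp)
       apply (simp only: append_Cons append_Nil)
       apply (rule wpb_write_loop[where n = g and f = "\<lambda>t. word_of_bit (V l t)", OF b], simp add: t, simp, simp)
        apply (simp add: t w)
       apply (rule wpb_Nil, simp, simp)
       apply (use t(5) in \<open>simp add: I_def t t(2)[simplified] Row_def V_def\<close>)
      apply (simp only: append_Nil)
      apply (rule wpb_Nil, simp add: b, simp)
      apply (simp add: I_def t t(2)[simplified] Row_def)
      done
  qed
  have Rng: "real g * real n \<le> real N * real N" "real n \<le> real N"
    "0 \<le> real N * real N" "0 \<le> real N"
    using ng n by (simp_all only: of_nat_le_iff mult.commute[of g] flip: of_nat_mult)
  show ?thesis unfolding output_prog_def append_Cons append_Nil
    apply (rule wpb_assign_reg[where x = "n * g", OF b], simp, simp add: s s', use ng N in simp)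
    apply (rule wpb_map_stored[where r = n and c = g and M = V], assumption, simp, simp, simp)
     apply (simp add: s js kdiv stI V_def)
    apply (rule wpb_Write[where x = g], assumption, simp, simp add: s)
    apply (rule wpb_for[where I = I and n = n and Tb = "real g * 30 + 40"], assumption)
       apply (simp add: I_def s s' len)
      apply (rule step; assumption)
     apply (simp add: I_def)
    subgoal premises p for \<tau>1 \<tau> xs' ys' us' vs'
    proof -
      have t: "\<tau> 9 0 = g" "stored (\<tau> 19) n g V"
        and e: "xs' = xs" "ys' = ys @ g # concat (map Row [0..<n])" "us' = us" "vs' = vs" using p(6) by (simp_all add: I_def)
      show ?thesis unfolding e
        apply (rule wpb_mono)
          apply (rule cont[OF p(5) t[unfolded V_def], folded Row_def])
         apply (simp add: algebra_simps, use Rng in linarith)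
        by assumption
    qed
    done
qed

end

definition pre_prog :: "com \<Rightarrow> com" where
  "pre_prog P = block ([Read 0 (Num 0), Read 1 (Num 0)] @ parse_prog @ double_prog @ incidence_prog
     @ mats_prog P @ select_prog @ output_prog)"

text \<open>The rows and columns that pad the matrices to a power of two belong to the empty list, which is
  no facet and has none.\<close>

definition simplex_list :: "nat list list \<Rightarrow> nat \<Rightarrow> nat list" where
  "simplex_list Ks i = (if i < length Ks then Ks ! i else [])"

definition annot_cols :: "nat list list \<Rightarrow> nat \<Rightarrow> nat \<Rightarrow> nat list" where
  "annot_cols Ks p k = nonzero_cols (2 ^ k) (annot_mat (simplex_list Ks) p k) (2 ^ k)"

definition annot :: "nat list list \<Rightarrow> nat \<Rightarrow> nat \<Rightarrow> bmat" where
  "annot Ks p k = (\<lambda>i t. annot_mat (simplex_list Ks) p k i (2 ^ k + annot_cols Ks p k ! t))"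

definition pre_output :: "nat list list \<Rightarrow> nat \<Rightarrow> nat \<Rightarrow> nat list" where
  "pre_output Ks p k = (let g = length (annot_cols Ks p k) in
     g # concat (map (\<lambda>i. if length (simplex_list Ks i) = p + 1
       then map (\<lambda>t. word_of_bit (annot Ks p k i t)) [0..<g] else []) [0..<length Ks]))"

lemma length_annot_cols: "length (annot_cols Ks p k) \<le> 2 ^ k"
  unfolding annot_cols_def nonzero_cols_def using length_filter_le[of _ "[0..<2 ^ k]"] by simp

lemma annot_cols_less: "t < length (annot_cols Ks p k) \<Longrightarrow> annot_cols Ks p k ! t < 2 ^ k"
  using nth_mem[of t "annot_cols Ks p k"] by (simp add: annot_cols_def nonzero_cols_def)

context mul_machine begin

text \<open>The padded size comes out of the doubling loop and is known only to lie between
  \<open>n\<close> and 2 n; hence the time hypothesis for every such \<open>N\<close>, and the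
  existential exponent in the postcondition.\<close>

lemma wpb_pre:
  assumes n: "n = length Ks" "1 \<le> n" "2 * n \<le> Nmax"
    and D: "150 \<le> D" "5 * (C + 400) + 3000 \<le> D * (2 powr (\<omega> - 1) - 2)"
    and L: "\<And>vs. vs \<in> set Ks \<Longrightarrow> length vs \<le> L" "L \<le> n"
    and V: "\<And>vs x. vs \<in> set Ks \<Longrightarrow> x \<in> set vs \<Longrightarrow> x \<le> B" and p: "p \<le> B"
    and T: "\<And>N. n \<le> N \<Longrightarrow> N < 2 * n \<Longrightarrow>
      D * real N * real N powr (\<omega> - 1) + (C + 400) * real N powr \<omega> + D * real N * real (2 * N) powr (\<omega> - 1)
      + real (N * N) * (real L * 190 + 2000) \<le> T"
  shows "wpb (pre_prog P) (pre_prog P) T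
    (\<lambda>st. \<exists>k. n \<le> 2 ^ k \<and> out st = pre_output Ks p k \<and> store st 9 0 = length (annot_cols Ks p k) \<and>
        stored (store st 19) n (length (annot_cols Ks p k)) (annot Ks p k))
    (State zero_store (p # enc_complex Ks) [] [] [])"
proof -
  define S where "S = simplex_list Ks"
  have N2: "N * N \<le> B" "2 * (N * N) \<le> B" "2 * N \<le> B" "N \<le> B" if "N \<le> Nmax" for N
  proof -
    have "N * N \<le> Nmax * Nmax" using that by (intro mult_le_mono)
    then have "8 * (N * N) \<le> B" using Nmax by (simp add: power2_eq_square)
    moreover have "N \<le> N * N" by simp
    ultimately show "N * N \<le> B" "2 * (N * N) \<le> B" "2 * N \<le> B" "N \<le> B" by linarith+
  qed
  have nB: "n \<le> B" "2 * n \<le> B" using N2[of "2 * n"] n by auto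
  have S: "length (S i) \<le> L" "\<And>x. x \<in> set (S i) \<Longrightarrow> x \<le> B" for i
    using L(1)[of "Ks ! i"] V[of "Ks ! i"] by (auto simp: S_def simplex_list_def split: if_splits)
  have LB: "L \<le> B" using L(2) nB by simp
  show ?thesis
    apply (subst (2) pre_prog_def)
    apply (simp only: append_Cons append_Nil enc_complex_def)
    apply (rule wpb_read_reg, rule bnd_zero, rule p)
    apply (rule wpb_read_reg, assumption, use nB n in simp)
    apply (rule wpb_parse[where L = L], assumption, simp, simp add: zero_store_def, erule L(1), use L n in simp, rule LB, erule V, assumption)
    apply (rule wpb_double[where n = n], assumption, simp add: n, rule n, rule nB)
    subgoal premises p0 for \<tau> \<tau>' k
    proof -
      define N where "N = (2::nat) ^ k"
      have N: "1 \<le> N" "n \<le> N" "N < 2 * n" "N \<le> Nmax" "N = 2 ^ k" using p0 n by (auto simp: N_def)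
      note NB = N2[OF N(4)]
      have t: "\<tau>' 0 0 = p" "\<tau>' 1 0 = n" "\<tau>' (Suc 0) 0 = n" "\<tau>' 2 0 = N" using p0 by (simp_all add: n N_def)
      have len: "\<tau>' 10 i = length (S i)" for i using p0 by (simp add: S_def simplex_list_def)
      have vert: "\<tau>' 11 (i * n + x) = S i ! x" if "x < length (S i)" for i x
        using p0 that by (simp add: S_def simplex_list_def n(1) split: if_splits)
      have cols: "nonzero_cols N (annot_mat S p k) N = annot_cols Ks p k"
        by (simp add: annot_cols_def S_def N_def)
      have b': "bnd \<tau>'" using p0 by blast
      have nN: "real n \<le> real N * real N" "real N \<le> real N * real N" "real n * real L \<le> real N * real N * real L" "1 \<le> real N * real N"
      proof -
        have nN: "real n \<le> real N" using N(2) by (rule of_nat_mono)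
        have "1 \<le> real N" using of_nat_mono[OF N(1), where 'a = real] by simp
        then show NN: "real N \<le> real N * real N" by (simp add: mult_le_cancel_left1)
        show "real n \<le> real N * real N" using nN NN by linarith
        then show "real n * real L \<le> real N * real N * real L" by (rule mult_right_mono) simp
        show "1 \<le> real N * real N" using NN \<open>1 \<le> real N\<close> by linarith
      qed
      have annot: "annot_mat S p k i (N + annot_cols Ks p k ! t) = annot Ks p k i t" for i t
        by (simp add: annot_def S_def N_def)
      note TN = T[OF N(2,3)]
      show ?thesis
        apply (rule wpb_incidence[OF b' t(2,4) N(1) NB(1) len vert S(1) LB S(2)], assumption, assumption)
        apply (rule wpb_mats[where K = k and p = p and S = S, OF _ N(5,4) D], assumption, simp add: t, simp add: t, simp, simp add: len, assumption)
        apply (rule wpb_select[where N = N and G = "annot_mat S p k"], assumption, rule N, rule NB, simp add: t, simp, assumption)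
        apply (subst append_Nil2[of output_prog, symmetric])
        apply (rule wpb_output[where N = N and n = n and p = p and g = "length (annot_cols Ks p k)" and G = "annot_mat S p k" and S = S and js = "annot_cols Ks p k"],
          assumption, rule N, rule NB, rule N, simp add: t, simp add: t, simp add: t, simp, simp add: cols, simp, simp,
          use length_annot_cols[of Ks p k] in \<open>simp add: N_def\<close>, simp add: cols, use annot_cols_less[of _ Ks p k] in \<open>simp add: N_def\<close>, simp add: len)
        apply (rule wpb_Nil, simp)
         apply (use TN nN in \<open>simp add: algebra_simps n(1)\<close>)
        apply (rule exI[of _ k])
        apply (simp add: pre_output_def Let_def annot N(2) cong: if_cong flip: N_def n(1) S_def)
        done
    qed
    done
qed

end

section \<open>Correctness of the annotation\<close>

lemma sum_of_bool_bit:
  "finite A \<Longrightarrow> (\<Sum>x\<in>A. of_bool (Q x) :: bit) = of_bool (odd (card {x \<in> A. Q x}))"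
proof (induction A rule: finite_induct)
  case (insert x A)
  have "{y \<in> insert x A. Q y} = (if Q x then insert x {y \<in> A. Q y} else {y \<in> A. Q y})" by auto
  then show ?case using insert by auto
qed simp

lemma sum_tmul:
  "(\<Sum>j<m. tmul N G A i j * x j) = (\<Sum>t<N. G t i * (\<Sum>j<m. A t j * (x j :: 'a::comm_ring_1)))"
proof -
  have "(\<Sum>j<m. tmul N G A i j * x j) = (\<Sum>j<m. \<Sum>t<N. G t i * A t j * x j)"
    by (simp add: tmul_def sum_distrib_right)
  also have "\<dots> = (\<Sum>t<N. \<Sum>j<m. G t i * A t j * x j)" by (rule sum.swap)
  also have "\<dots> = (\<Sum>t<N. G t i * (\<Sum>j<m. A t j * x j))"
    by (simp add: sum_distrib_left mult.assoc)
  finally show ?thesis .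
qed

locale listed_complex =
  fixes K :: "nat set set" and Ks :: "nat list list" and p k :: nat
  assumes fin: "finite K" and complex: "simplicial_complex K" and listed: "lists_complex Ks K"
    and size: "length Ks \<le> 2 ^ k"
begin

abbreviation "n \<equiv> length Ks"
abbreviation "N \<equiv> (2::nat) ^ k"
abbreviation "S \<equiv> simplex_list Ks"
abbreviation "sx i \<equiv> set (Ks ! i)"

lemma sx_image: "sx ` {..<n} = K"
proof -
  have "set Ks = (!) Ks ` {..<n}" by (auto simp: set_conv_nth)
  then have "sx ` {..<n} = set (map set Ks)" by (simp add: image_image)
  then show ?thesis using listed by (simp add: lists_complex_def)
qed

lemma sx_in: "i < n \<Longrightarrow> sx i \<in> K"
  using sx_image by blast

lemma sx_inj: "inj_on sx {..<n}"
proof (rule inj_onI)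
  fix i j assume "i \<in> {..<n}" "j \<in> {..<n}" "sx i = sx j"
  then have "map set Ks ! i = map set Ks ! j" by simp
  then show "i = j" using listed \<open>i \<in> _\<close> \<open>j \<in> _\<close> nth_eq_iff_index_eq[of "map set Ks" i j]
    by (simp add: lists_complex_def)
qed

lemma sx_eq: "i < n \<Longrightarrow> j < n \<Longrightarrow> sx i = sx j \<longleftrightarrow> i = j"
  using sx_inj by (auto dest: inj_onD)

lemma sx_card: "i < n \<Longrightarrow> card (sx i) = length (Ks ! i)"
  using listed by (simp add: lists_complex_def distinct_card)

lemma sx_nonempty: "i < n \<Longrightarrow> Ks ! i \<noteq> []"
  using complex sx_in[of i] by (auto simp: simplicial_complex_def)

definition ind :: "nat set set \<Rightarrow> nat \<Rightarrow> bit" where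
  "ind z i = of_bool (i < n \<and> sx i \<in> z)"

definition chain_of :: "(nat \<Rightarrow> bit) \<Rightarrow> nat set set" where
  "chain_of x = sx ` {i. i < n \<and> x i = 1}"

lemma ind_chain_of: "i < n \<Longrightarrow> ind (chain_of x) i = x i"
  by (cases "x i") (auto simp: ind_def chain_of_def sx_eq)

lemma ind_ge: "n \<le> i \<Longrightarrow> ind z i = 0"
  by (simp add: ind_def)

lemma ind_inject:
  assumes "z \<subseteq> K" "z' \<subseteq> K" "\<And>i. i < n \<Longrightarrow> ind z i = ind z' i"
  shows "z = z'"
proof -
  have "sx i \<in> z \<longleftrightarrow> sx i \<in> z'" if "i < n" for i
    using assms(3)[OF that] that by (simp add: ind_def of_bool_eq_iff)
  then show ?thesis using assms(1,2) sx_image by blast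
qed

lemma ind_sym_diff: "ind (sym_diff a b) i = ind a i + ind b i"
  by (auto simp: ind_def)

text \<open>Both sides count, modulo 2, the simplices of \<open>c\<close> that have simplex
  \<open>i\<close> as a facet; positions and simplices correspond by the injection
  \<open>sx\<close>. In a padding row both sides are 0.\<close>

lemma ind_incidence:
  assumes c: "c \<subseteq> simplices K q" and i: "i < N"
  shows "(\<Sum>j<N. incidence S q i j * ind c j) = ind (boundary K c) i"
proof -
  define Q where "Q j \<longleftrightarrow> is_facet (S i) (S j) \<and> j < n \<and> sx j \<in> c" for j
  have cK: "card \<sigma> = q + 1 \<and> \<sigma> \<in> K" if "\<sigma> \<in> c" for \<sigma> using c that by (auto simp: simplices_def)
  have "(\<Sum>j<N. incidence S q i j * ind c j) = (\<Sum>j<N. of_bool (Q j))"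
  proof (rule sum.cong[OF refl])
    fix j
    show "incidence S q i j * ind c j = of_bool (Q j)"
      using cK[of "sx j"] sx_card[of j]
      by (auto simp: incidence_def ind_def Q_def simplex_list_def)
  qed
  also have "\<dots> = of_bool (odd (card {j \<in> {..<N}. Q j}))" by (rule sum_of_bool_bit) simp
  also have "\<dots> = ind (boundary K c) i"
  proof (cases "i < n")
    case False
    then have "{j \<in> {..<N}. Q j} = {}" by (auto simp: Q_def is_facet_def simplex_list_def)
    then show ?thesis using False by (simp only: ind_ge) simp
  next
    case True
    have "sx ` {j \<in> {..<N}. Q j} = {\<sigma> \<in> c. sx i \<subseteq> \<sigma> \<and> card \<sigma> = card (sx i) + 1}"
    proof (intro equalityI subsetI)
      fix \<sigma> assume "\<sigma> \<in> sx ` {j \<in> {..<N}. Q j}"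
      then show "\<sigma> \<in> {\<sigma> \<in> c. sx i \<subseteq> \<sigma> \<and> card \<sigma> = card (sx i) + 1}"
        using True by (auto simp: Q_def is_facet_def simplex_list_def sx_card)
    next
      fix \<sigma> assume s: "\<sigma> \<in> {\<sigma> \<in> c. sx i \<subseteq> \<sigma> \<and> card \<sigma> = card (sx i) + 1}"
      then obtain j where j: "j < n" "\<sigma> = sx j" using cK sx_image by blast
      then have "Q j" "j < N" using s True size sx_nonempty[OF True]
        by (auto simp: Q_def is_facet_def simplex_list_def sx_card)
      then show "\<sigma> \<in> sx ` {j \<in> {..<N}. Q j}" using j by blast
    qed
    moreover have "inj_on sx {j \<in> {..<N}. Q j}"
      by (rule inj_on_subset[OF sx_inj]) (auto simp: Q_def)
    ultimately have "card {j \<in> {..<N}. Q j} = card {\<sigma> \<in> c. sx i \<subseteq> \<sigma> \<and> card \<sigma> = card (sx i) + 1}"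
      by (metis card_image)
    then show ?thesis using True sx_in[OF True] by (simp add: ind_def boundary_def)
  qed
  finally show ?thesis .
qed

lemma cyclesD: "z \<in> cycles K p \<Longrightarrow> z \<subseteq> simplices K p" "z \<in> cycles K p \<Longrightarrow> boundary K z = {}"
  by (auto simp: cycles_def chain_space_def)

lemma simplices_sub: "simplices K q \<subseteq> K"
  by (auto simp: simplices_def)

abbreviation "D0 \<equiv> incidence S p"
abbreviation "D1 \<equiv> incidence S (p + 1)"
abbreviation "G0 \<equiv> gamma N k D0"
abbreviation "P2 \<equiv> kernel_projection S p k"
abbreviation "A \<equiv> glue N D1 P2"
abbreviation "\<Gamma> \<equiv> annot_mat S p k"
abbreviation "js \<equiv> annot_cols Ks p k"
abbreviation "g \<equiv> length js"

lemma ginverse_G0: "ginverse N N D0 G0"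
  by (rule ginverse_gamma)

lemma ginverse_\<Gamma>: "ginverse N (N + N) A \<Gamma>"
  using ginverse_gamma[of N "Suc k" A] by (simp add: annot_mat_def mult_2)

text \<open>D_p z = 0, so the correction term drops out; masking the columns does no harm, since z
  consists of \<open>p\<close>-simplices.\<close>

lemma P2_cycle:
  assumes "z \<in> cycles K p" "i < N"
  shows "(\<Sum>j<N. P2 i j * ind z j) = ind z i"
proof -
  have b: "(\<Sum>j<N. D0 t j * ind z j) = 0" if "t < N" for t
    using ind_incidence[OF cyclesD(1)[OF assms(1)] that] cyclesD(2)[OF assms(1)] by (simp add: ind_def)
  have "(\<Sum>j<N. P2 i j * ind z j) = (\<Sum>j<N. of_bool (i = j) * ind z j + tmul N G0 D0 i j * ind z j)"
  proof (rule sum.cong[OF refl])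
    fix j
    show "P2 i j * ind z j = of_bool (i = j) * ind z j + tmul N G0 D0 i j * ind z j"
    proof (cases "j < n \<and> sx j \<in> z")
      case True
      then have "length (S j) = p + 1"
        using cyclesD(1)[OF assms(1)] sx_card[of j] by (auto simp: simplices_def simplex_list_def)
      then show ?thesis unfolding kernel_projection_def by (simp only: simp_thms of_bool_eq mult_1_right distrib_right)
    qed (simp add: ind_def)
  qed
  also have "\<dots> = (\<Sum>j<N. of_bool (i = j) * ind z j) + (\<Sum>j<N. tmul N G0 D0 i j * ind z j)" by (rule sum.distrib)
  also have "(\<Sum>j<N. of_bool (i = j) * ind z j) = (\<Sum>j<N. if j = i then ind z j else 0)"
    by (rule sum.cong) auto
  also have "\<dots> = ind z i" using assms by (simp add: sum.delta)
  also have "(\<Sum>j<N. tmul N G0 D0 i j * ind z j) = 0"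
    unfolding sum_tmul by (rule sum.neutral) (simp only: b lessThan_iff mult_zero_right Ball_def cong: imp_cong, simp)
  finally show ?thesis by simp
qed

text \<open>This makes the columns of the projection \<open>p\<close>-chains. If \<open>i\<close> is
  no \<open>p\<close>-simplex, column \<open>i\<close> of \<open>D0\<close> is zero, so it is not
  sent to a unit vector; by the second clause of \<open>ginverse\<close>, column \<open>i\<close> of
  \<open>G0\<close> is then zero.\<close>

lemma P2_zero:
  assumes i: "i < N" and j: "j < N" and l: "length (S i) \<noteq> p + 1"
  shows "P2 i j = 0"
proof (cases "length (S j) = p + 1")
  case True
  have D: "D0 t i = 0" for t using l by (simp add: incidence_def)
  have "tmul N G0 D0 i i = 0" unfolding tmul_def by (rule sum.neutral) (simp add: D)
  then have "\<not> (\<forall>a<N. tmul N G0 D0 a i = of_bool (a = i))" using i by force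
  then have "\<forall>t<N. G0 t i = 0" using ginverse_G0 i unfolding ginverse_def by blast
  then have "tmul N G0 D0 i j = 0" unfolding tmul_def by (intro sum.neutral) simp
  moreover have "i \<noteq> j" using True l by blast
  ultimately show ?thesis by (simp add: kernel_projection_def)
next
  case False
  then show ?thesis by (simp add: kernel_projection_def)
qed

text \<open>D_p (I - G D_p) = D_p - D_p G D_p = 0, and \<open>P2_zero\<close> confines the columns
  to \<open>p\<close>-simplices.\<close>

lemma P2_column:
  assumes j: "j < N"
  defines "z \<equiv> chain_of (\<lambda>i. P2 i j)"
  shows "z \<in> cycles K p" "\<And>i. i < N \<Longrightarrow> ind z i = P2 i j"
proof -
  show ind: "ind z i = P2 i j" if "i < N" for i
  proof (cases "i < n")
    case False
    then show ?thesis using P2_zero[OF that j] by (simp add: ind_ge simplex_list_def)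
  qed (simp add: z_def ind_chain_of)
  have z: "z \<subseteq> simplices K p"
  proof
    fix \<sigma> assume "\<sigma> \<in> z"
    then obtain i where i: "i < n" "P2 i j = 1" "\<sigma> = sx i" by (auto simp: z_def chain_of_def)
    have "i < N" using i size by simp
    have "length (S i) = p + 1"
    proof (rule ccontr)
      assume "length (S i) \<noteq> p + 1"
      from P2_zero[OF \<open>i < N\<close> j this] i show False by simp
    qed
    then show "\<sigma> \<in> simplices K p" using i by (simp add: simplices_def sx_in sx_card simplex_list_def)
  qed
  have "ind (boundary K z) t = 0" if t: "t < N" for t
  proof -
    have "ind (boundary K z) t = (\<Sum>i<N. D0 t i * P2 i j)"
      unfolding ind_incidence[OF z t, symmetric] by (rule sum.cong) (simp_all add: ind)
    also have "\<dots> = 0"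
    proof (cases "length (S j) = p + 1")
      case True
      have "(\<Sum>i<N. D0 t i * P2 i j) = (\<Sum>i<N. D0 t i * of_bool (i = j) + D0 t i * tmul N G0 D0 i j)"
        unfolding kernel_projection_def using True by (simp only: simp_thms of_bool_eq mult_1_right distrib_left)
      also have "\<dots> = (\<Sum>i<N. D0 t i * of_bool (i = j)) + mmul N D0 (tmul N G0 D0) t j"
        unfolding mmul_def by (rule sum.distrib)
      also have "mmul N D0 (tmul N G0 D0) t j = D0 t j"
        using ginverse_G0 t j unfolding ginverse_def by blast
      also have "(\<Sum>i<N. D0 t i * of_bool (i = j)) = (\<Sum>i<N. if i = j then D0 t i else 0)"
        by (rule sum.cong) auto
      also have "\<dots> = D0 t j" using j by (simp add: sum.delta)
      finally show ?thesis by simp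
    qed (simp add: kernel_projection_def)
    finally show ?thesis .
  qed
  then have "boundary K z = {}"
    using size by (intro ind_inject) (auto simp: boundary_def ind_def)
  then show "z \<in> cycles K p" using z by (simp add: cycles_def chain_space_def)
qed

definition alpha :: "nat set set \<Rightarrow> nat \<Rightarrow> bit" where
  "alpha z t = (\<Sum>i<N. annot Ks p k i t * ind z i)"

text \<open>All coordinates of the image of z under the generalized inverse; \<open>alpha\<close>
  keeps those at the basis columns on the right.\<close>

definition coord :: "nat set set \<Rightarrow> nat \<Rightarrow> bit" where
  "coord z a = (\<Sum>i<N. \<Gamma> i a * ind z i)"

lemma alpha_coord: "alpha z t = coord z (N + js ! t)"
  by (simp add: alpha_def coord_def annot_def)

lemma set_js: "set js = {c. c < N \<and> (\<exists>i<N. \<Gamma> i (N + c) \<noteq> 0)}"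
  by (auto simp: annot_cols_def nonzero_cols_def)

lemma distinct_js: "distinct js"
  by (simp add: annot_cols_def nonzero_cols_def)

lemma coord_zero:
  assumes "\<And>t. t < g \<Longrightarrow> alpha z t = 0" "c < N"
  shows "coord z (N + c) = 0"
proof (cases "c \<in> set js")
  case True
  then show ?thesis using assms(1) by (auto simp: in_set_conv_nth alpha_coord)
next
  case False
  then have "\<And>i. i < N \<Longrightarrow> \<Gamma> i (N + c) = 0" using assms(2) by (auto simp: set_js)
  then show ?thesis unfolding coord_def by (intro sum.neutral) simp
qed

lemma coord_combination:
  assumes "\<And>i. i < N \<Longrightarrow> ind z i = (\<Sum>b<m. A i b * u b)"
  shows "coord z a = (\<Sum>b<m. tmul N \<Gamma> A a b * u b)"
  unfolding sum_tmul coord_def by (rule sum.cong) (simp_all add: assms)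

text \<open>If z = D_(p+1) c, then z = A (c, 0), and by the triangularity in \<open>ginverse\<close>
  its coordinates on the right vanish. Conversely z = A (0, z) by \<open>P2_cycle\<close>, so the
  coordinates y of z satisfy A y = z; if y vanishes on the right, only D_(p+1) contributes.\<close>

lemma boundary_iff:
  assumes z: "z \<in> cycles K p"
  shows "z \<in> boundaries K p \<longleftrightarrow> (\<forall>t<g. alpha z t = 0)"
proof
  assume "z \<in> boundaries K p"
  then obtain c where c: "c \<subseteq> simplices K (p + 1)" "z = boundary K c"
    by (auto simp: boundaries_def chain_space_def)
  have "ind z i = (\<Sum>b<N. A i b * ind c b)" if "i < N" for i
    unfolding c(2) ind_incidence[OF c(1) that, symmetric] by (rule sum.cong) (simp_all add: glue_def)
  from coord_combination[OF this]
  have y: "coord z a = (\<Sum>b<N. tmul N \<Gamma> A a b * ind c b)" for a .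
  show "\<forall>t<g. alpha z t = 0"
  proof (intro allI impI)
    fix t assume "t < g"
    then have "js ! t < N" by (rule annot_cols_less)
    then have "tmul N \<Gamma> A (N + js ! t) b = 0" if "b < N" for b
      using ginverse_\<Gamma> that unfolding ginverse_def by auto
    then show "alpha z t = 0" unfolding alpha_coord y by (intro sum.neutral) simp
  qed
next
  assume "\<forall>t<g. alpha z t = 0"
  then have zero: "coord z (N + c) = 0" if "c < N" for c using coord_zero that by blast
  define u where "u b = (if b < N then 0 else ind z (b - N))" for b
  have u: "ind z i = (\<Sum>b<N + N. A i b * u b)" if "i < N" for i
  proof -
    have "(\<Sum>b<N + N. A i b * u b) = (\<Sum>b<N. A i b * u b) + (\<Sum>b<N. P2 i b * ind z b)"
      unfolding sum_lessThan_add by (simp add: glue_def u_def)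
    also have "(\<Sum>b<N. A i b * u b) = 0" by (rule sum.neutral) (simp add: u_def)
    finally show ?thesis using P2_cycle[OF z that] by simp
  qed
  define y where "y = coord z"
  have y: "y a = (\<Sum>b<N + N. tmul N \<Gamma> A a b * u b)" for a
    unfolding y_def by (rule coord_combination) (rule u)
  have z_y: "ind z i = (\<Sum>a<N. D1 i a * y a)" if i: "i < N" for i
  proof -
    have "(\<Sum>a<N + N. A i a * y a) = (\<Sum>a<N + N. \<Sum>b<N + N. A i a * tmul N \<Gamma> A a b * u b)"
      unfolding y by (simp only: sum_distrib_left mult.assoc)
    also have "\<dots> = (\<Sum>b<N + N. \<Sum>a<N + N. A i a * tmul N \<Gamma> A a b * u b)" by (rule sum.swap)
    also have "\<dots> = (\<Sum>b<N + N. mmul (N + N) A (tmul N \<Gamma> A) i b * u b)"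
      unfolding mmul_def sum_distrib_right ..
    also have "\<dots> = (\<Sum>b<N + N. A i b * u b)"
      using ginverse_\<Gamma> i by (intro sum.cong) (simp_all add: ginverse_def)
    also have "\<dots> = ind z i" using u[OF i] by simp
    finally have "ind z i = (\<Sum>a<N. A i a * y a) + (\<Sum>a<N. A i (N + a) * y (N + a))"
      unfolding sum_lessThan_add by simp
    also have "(\<Sum>a<N. A i (N + a) * y (N + a)) = 0"
      by (rule sum.neutral) (simp add: y_def zero)
    also have "(\<Sum>a<N. A i a * y a) = (\<Sum>a<N. D1 i a * y a)"
      by (rule sum.cong) (simp_all add: glue_def)
    finally show ?thesis by simp
  qed
  \<comment> \<open>Entries of \<open>y\<close> at positions of other dimensions meet zero columns
    of D_(p+1); dropping them leaves a genuine (p+1)-chain.\<close>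
  define c where "c = chain_of (\<lambda>a. y a * of_bool (length (S a) = p + 1 + 1))"
  have c: "c \<subseteq> simplices K (p + 1)"
    by (auto simp: c_def chain_of_def simplices_def sx_in sx_card simplex_list_def)
  have "z = boundary K c"
  proof (rule ind_inject)
    show "z \<subseteq> K" using cyclesD(1)[OF z] simplices_sub by blast
    show "boundary K c \<subseteq> K" by (auto simp: boundary_def)
    fix i assume "i < n"
    then have i: "i < N" using size by simp
    have "ind (boundary K c) i = (\<Sum>a<N. D1 i a * y a)"
      unfolding ind_incidence[OF c i, symmetric]
    proof (rule sum.cong[OF refl])
      fix a
      show "D1 i a * ind c a = D1 i a * y a"
      proof (cases "a < n \<and> length (S a) = p + 1 + 1")
        case True
        then show ?thesis by (simp add: c_def ind_chain_of)
      next
        case False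
        then have "D1 i a = 0" by (auto simp: incidence_def simplex_list_def is_facet_def)
        then show ?thesis by simp
      qed
    qed
    then show "ind z i = ind (boundary K c) i" using z_y[OF i] by simp
  qed
  then show "z \<in> boundaries K p" using c by (auto simp: boundaries_def chain_space_def)
qed

lemma alpha_sym_diff: "alpha (sym_diff a b) t = alpha a t + alpha b t"
  unfolding alpha_def ind_sym_diff by (simp only: distrib_left sum.distrib)

text \<open>The selected columns are basis columns of \<open>A\<close>, which the generalized
  inverse sends to unit vectors. These cycles are thus dual to the coordinates, and every vector of
  length \<open>g\<close> will be attained.\<close>

lemma alpha_column:
  assumes t: "t < g" "t' < g"
  shows "alpha (chain_of (\<lambda>i. P2 i (js ! t))) t' = of_bool (t' = t)"
proof -
  have j: "js ! t < N" "js ! t' < N" using t by (auto intro: annot_cols_less)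
  have "js ! t \<in> set js" using t by simp
  then have "\<not> (\<forall>i<N. \<Gamma> i (N + js ! t) = 0)" unfolding set_js by blast
  moreover have lt: "N + js ! t < N + N" using j by simp
  ultimately have d: "\<forall>a<N + N. tmul N \<Gamma> A a (N + js ! t) = of_bool (a = N + js ! t)"
    using ginverse_\<Gamma>[unfolded ginverse_def, THEN conjunct2, THEN conjunct1, rule_format, of "N + js ! t"] lt by blast
  have "alpha (chain_of (\<lambda>i. P2 i (js ! t))) t' = tmul N \<Gamma> A (N + js ! t') (N + js ! t)"
    unfolding alpha_coord coord_def tmul_def
    by (rule sum.cong) (simp_all add: P2_column(2)[OF j(1)] glue_def)
  also have "\<dots> = of_bool (js ! t' = js ! t)" using d j by simp
  also have "\<dots> = of_bool (t' = t)" using t distinct_js by (simp add: nth_eq_iff_index_eq)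
  finally show ?thesis .
qed

end

section \<open>The boundary of a boundary is zero\<close>

lemma card_intermediate_even:
  assumes f: "finite \<sigma>" and sub: "\<rho> \<subseteq> \<sigma>" and card: "card \<sigma> = card \<rho> + 2"
  shows "card {\<tau>. \<rho> \<subseteq> \<tau> \<and> \<tau> \<subseteq> \<sigma> \<and> card \<tau> = card \<rho> + 1} = 2"
proof -
  have fr: "finite \<rho>" using f sub by (rule rev_finite_subset)
  have "card (\<sigma> - \<rho>) = 2" using card card_Diff_subset[OF fr sub] by simp
  then obtain x y where xy: "\<sigma> - \<rho> = {x, y}" "x \<noteq> y" by (auto simp: card_2_iff)
  have "{\<tau>. \<rho> \<subseteq> \<tau> \<and> \<tau> \<subseteq> \<sigma> \<and> card \<tau> = card \<rho> + 1} = {insert x \<rho>, insert y \<rho>}"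
  proof (intro equalityI subsetI)
    fix \<tau> assume t: "\<tau> \<in> {\<tau>. \<rho> \<subseteq> \<tau> \<and> \<tau> \<subseteq> \<sigma> \<and> card \<tau> = card \<rho> + 1}"
    have "card (\<tau> - \<rho>) = 1" using t card_Diff_subset[OF fr, of \<tau>] by simp
    then obtain w where w: "\<tau> - \<rho> = {w}" by (auto simp: card_1_singleton_iff)
    then have "w \<in> {x, y}" using t xy by blast
    moreover have "\<tau> = insert w \<rho>" using w t by blast
    ultimately show "\<tau> \<in> {insert x \<rho>, insert y \<rho>}" by blast
  next
    fix \<tau> assume "\<tau> \<in> {insert x \<rho>, insert y \<rho>}"
    moreover have "x \<notin> \<rho>" "y \<notin> \<rho>" "x \<in> \<sigma>" "y \<in> \<sigma>" using xy by auto
    ultimately show "\<tau> \<in> {\<tau>. \<rho> \<subseteq> \<tau> \<and> \<tau> \<subseteq> \<sigma> \<and> card \<tau> = card \<rho> + 1}"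
      using sub fr by auto
  qed
  moreover have "insert x \<rho> \<noteq> insert y \<rho>" using xy by blast
  ultimately show ?thesis by simp
qed

text \<open>Modulo 2, the coefficient of \<rho> counts pairs of a simplex \<sigma> of
  \<open>c\<close> and an intermediate \<tau>; by \<open>card_intermediate_even\<close> each
  \<sigma> admits two or no \<tau>.\<close>

lemma boundary_boundary:
  assumes K: "finite K" "simplicial_complex K" and c: "c \<subseteq> K"
  shows "boundary K (boundary K c) = {}"
proof -
  define F where "F \<tau> \<sigma> \<longleftrightarrow> \<tau> \<subseteq> \<sigma> \<and> card \<sigma> = card \<tau> + 1" for \<tau> \<sigma> :: "'a set"
  have fin: "finite c" using K(1) c by (rule rev_finite_subset)
  have mem: "of_bool (\<tau> \<in> boundary K d) = (of_bool (\<tau> \<in> K) * (\<Sum>\<sigma>\<in>d. of_bool (F \<tau> \<sigma>)) :: bit)" if "d \<subseteq> K" for d \<tau>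
  proof -
    have "finite d" using K(1) that by (rule rev_finite_subset)
    note sum = sum_of_bool_bit[OF this, of "F \<tau>"]
    have "{\<sigma> \<in> d. \<tau> \<subseteq> \<sigma> \<and> card \<sigma> = card \<tau> + 1} = {\<sigma> \<in> d. F \<tau> \<sigma>}" by (simp only: F_def)
    then show ?thesis
      by (cases "\<tau> \<in> K") (simp_all only: boundary_def mem_Collect_eq sum simp_thms of_bool_eq mult_1_left mult_zero_left)
  qed
  have "(of_bool (\<rho> \<in> boundary K (boundary K c)) :: bit) = 0" for \<rho>
  proof (cases "\<rho> \<in> K")
    case True
    have bs: "boundary K c \<subseteq> K" by (auto simp: boundary_def)
    have "(of_bool (\<rho> \<in> boundary K (boundary K c)) :: bit) = (\<Sum>\<tau>\<in>boundary K c. of_bool (F \<rho> \<tau>))"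
      unfolding mem[OF bs] using True by (simp only: of_bool_eq mult_1_left)
    also have "\<dots> = (\<Sum>\<tau>\<in>K. of_bool (\<tau> \<in> boundary K c) * of_bool (F \<rho> \<tau>))"
    proof (rule sum.mono_neutral_cong_left[OF K(1) bs])
      show "\<forall>\<tau>\<in>K - boundary K c. of_bool (\<tau> \<in> boundary K c) * (of_bool (F \<rho> \<tau>) :: bit) = 0"
      proof
        fix \<tau> assume "\<tau> \<in> K - boundary K c"
        then have "\<tau> \<notin> boundary K c" by blast
        then show "of_bool (\<tau> \<in> boundary K c) * (of_bool (F \<rho> \<tau>) :: bit) = 0"
          by (simp only: simp_thms of_bool_eq mult_zero_left)
      qed
      fix \<tau> assume "\<tau> \<in> boundary K c"
      then show "of_bool (F \<rho> \<tau>) = of_bool (\<tau> \<in> boundary K c) * (of_bool (F \<rho> \<tau>) :: bit)"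
        by (simp only: of_bool_eq mult_1_left)
    qed
    also have "\<dots> = (\<Sum>\<tau>\<in>K. (\<Sum>\<sigma>\<in>c. of_bool (F \<tau> \<sigma>)) * of_bool (F \<rho> \<tau>))"
    proof (rule sum.cong[OF refl])
      fix \<tau> assume "\<tau> \<in> K"
      then have "of_bool (\<tau> \<in> boundary K c) = (\<Sum>\<sigma>\<in>c. of_bool (F \<tau> \<sigma>) :: bit)"
        using mem[OF c, of \<tau>] by (simp only: of_bool_eq mult_1_left)
      then show "of_bool (\<tau> \<in> boundary K c) * of_bool (F \<rho> \<tau>) = (\<Sum>\<sigma>\<in>c. of_bool (F \<tau> \<sigma>)) * (of_bool (F \<rho> \<tau>) :: bit)"
        by (rule arg_cong)
    qed
    also have "\<dots> = (\<Sum>\<tau>\<in>K. \<Sum>\<sigma>\<in>c. of_bool (F \<tau> \<sigma> \<and> F \<rho> \<tau>))"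
      unfolding sum_distrib_right of_bool_conj ..
    also have "\<dots> = (\<Sum>\<sigma>\<in>c. \<Sum>\<tau>\<in>K. of_bool (F \<tau> \<sigma> \<and> F \<rho> \<tau>))" by (rule sum.swap)
    also have "\<dots> = (\<Sum>\<sigma>\<in>c. 0)"
    proof (rule sum.cong[OF refl])
      fix \<sigma> assume "\<sigma> \<in> c"
      then have s: "\<sigma> \<in> K" using c by blast
      then have fs: "finite \<sigma>" using K(2) unfolding simplicial_complex_def by blast
      \<comment> \<open>An intermediate set contains \<rho>, so it is nonempty and hence a simplex
        of \<open>K\<close>.\<close>
      have rn: "\<rho> \<noteq> {}" using True K(2) unfolding simplicial_complex_def by blast
      have "even (card {\<tau> \<in> K. F \<tau> \<sigma> \<and> F \<rho> \<tau>})"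
      proof (cases "\<rho> \<subseteq> \<sigma> \<and> card \<sigma> = card \<rho> + 2")
        case True
        have "{\<tau> \<in> K. F \<tau> \<sigma> \<and> F \<rho> \<tau>} = {\<tau>. \<rho> \<subseteq> \<tau> \<and> \<tau> \<subseteq> \<sigma> \<and> card \<tau> = card \<rho> + 1}"
        proof (intro equalityI subsetI)
          fix \<tau> assume t: "\<tau> \<in> {\<tau>. \<rho> \<subseteq> \<tau> \<and> \<tau> \<subseteq> \<sigma> \<and> card \<tau> = card \<rho> + 1}"
          then have "\<tau> \<noteq> {}" "\<tau> \<subseteq> \<sigma>" using rn by blast+
          then have "\<tau> \<in> K" using s K(2) unfolding simplicial_complex_def by blast
          then show "\<tau> \<in> {\<tau> \<in> K. F \<tau> \<sigma> \<and> F \<rho> \<tau>}" using t True by (simp add: F_def)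
        qed (simp add: F_def)
        then show ?thesis using card_intermediate_even[OF fs, of \<rho>] True by (simp only: even_numeral)
      next
        case False
        then have "\<not> (F \<tau> \<sigma> \<and> F \<rho> \<tau>)" for \<tau> unfolding F_def by force
        then have "{\<tau> \<in> K. F \<tau> \<sigma> \<and> F \<rho> \<tau>} = {}" by blast
        then show ?thesis by (simp only: card.empty dvd_0_right)
      qed
      then show "(\<Sum>\<tau>\<in>K. of_bool (F \<tau> \<sigma> \<and> F \<rho> \<tau>) :: bit) = 0"
        unfolding sum_of_bool_bit[OF K(1)] by (simp only: simp_thms of_bool_eq)
    qed
    finally show ?thesis by (simp only: sum.neutral_const)
  next
    case False
    then have "\<rho> \<notin> boundary K (boundary K c)" unfolding boundary_def by blast
    then show ?thesis by (simp only: simp_thms of_bool_eq)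
  qed
  then have "\<rho> \<notin> boundary K (boundary K c)" for \<rho> using of_bool_eq_0_iff by metis
  then show ?thesis by blast
qed

section \<open>Homology as the space of vectors of length g\<close>

context listed_complex begin

lemma boundary_sym_diff:
  assumes a: "a \<subseteq> simplices K q" and b: "b \<subseteq> simplices K q"
  shows "boundary K (sym_diff a b) = sym_diff (boundary K a) (boundary K b)"
proof (rule ind_inject)
  fix i assume "i < n"
  then have i: "i < N" using size by simp
  have ab: "sym_diff a b \<subseteq> simplices K q" using a b by blast
  show "ind (boundary K (sym_diff a b)) i = ind (sym_diff (boundary K a) (boundary K b)) i"
    unfolding ind_sym_diff ind_incidence[OF a i, symmetric] ind_incidence[OF b i, symmetric]
      ind_incidence[OF ab i, symmetric] by (simp only: distrib_left sum.distrib)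
qed (auto simp: boundary_def)

lemma cycles_sym_diff:
  assumes "a \<in> cycles K p" "b \<in> cycles K p"
  shows "sym_diff a b \<in> cycles K p"
proof -
  have "sym_diff a b \<subseteq> simplices K p" using assms[THEN cyclesD(1)] by blast
  then show ?thesis using boundary_sym_diff[of a p b] assms[THEN cyclesD(1)] assms[THEN cyclesD(2)]
    by (simp add: cycles_def chain_space_def)
qed

lemma empty_cycle: "{} \<in> cycles K p"
  by (auto simp: cycles_def chain_space_def boundary_def)

lemma boundaries_cycles: "boundaries K p \<subseteq> cycles K p"
proof
  fix z assume "z \<in> boundaries K p"
  then obtain c where c: "c \<subseteq> simplices K (p + 1)" "z = boundary K c"
    by (auto simp: boundaries_def chain_space_def)
  have cK: "c \<subseteq> K" using c(1) simplices_sub by blast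
  have "z \<subseteq> simplices K p"
  proof
    fix \<tau> assume t: "\<tau> \<in> z"
    then have "{\<sigma> \<in> c. \<tau> \<subseteq> \<sigma> \<and> card \<sigma> = card \<tau> + 1} \<noteq> {}"
      unfolding c(2) boundary_def by (metis (no_types, lifting) card.empty dvd_0_right mem_Collect_eq)
    then obtain \<sigma> where "\<sigma> \<in> c" "card \<sigma> = card \<tau> + 1" by blast
    then show "\<tau> \<in> simplices K p" using c t by (auto simp: simplices_def boundary_def)
  qed
  then show "z \<in> cycles K p" using boundary_boundary[OF fin complex cK] c(2)
    by (simp add: cycles_def chain_space_def)
qed

text \<open>A homology class is a fibre of \<open>phi\<close>, which makes homology isomorphic to the space of vectors of length \<open>g\<close>.\<close>

definition phi :: "nat set set \<Rightarrow> bit vec" where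
  "phi z = vec g (alpha z)"

definition fiber :: "bit vec \<Rightarrow> nat set set set" where
  "fiber v = {z \<in> cycles K p. phi z = v}"

lemma phi_carrier: "phi z \<in> carrier_vec g"
  by (simp add: phi_def)

lemma phi_sym_diff: "phi (sym_diff a b) = phi a + phi b"
  by (rule eq_vecI) (simp_all only: phi_def alpha_sym_diff index_vec index_add_vec dim_vec)

lemma phi_empty: "phi {} = 0\<^sub>v g"
  by (rule eq_vecI) (simp_all add: phi_def alpha_def ind_def)

lemma boundary_phi: "z \<in> cycles K p \<Longrightarrow> z \<in> boundaries K p \<longleftrightarrow> phi z = 0\<^sub>v g"
  unfolding boundary_iff phi_def by (auto simp: vec_eq_iff)

lemma add_self_vec: "v \<in> carrier_vec m \<Longrightarrow> w \<in> carrier_vec m \<Longrightarrow> v + (v + w) = (w :: bit vec)"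
proof (rule eq_vecI)
  fix i assume v: "v \<in> carrier_vec m" and w: "w \<in> carrier_vec m" and "i < dim_vec w"
  then show "(v + (v + w)) $ i = w $ i" by (cases "v $ i"; cases "w $ i") simp_all
qed auto

text \<open>The kernel of \<open>phi\<close> on the cycles is the space of boundaries, so cosets of
  the boundaries are fibres.\<close>

lemma homology_class_fiber:
  assumes z: "z \<in> cycles K p"
  shows "homology_class K p z = fiber (phi z)"
proof -
  have "homology_class K p z = (\<lambda>b. sym_diff b z) ` boundaries K p"
    by (simp add: homology_class_def a_r_coset_def' cycle_space_def chain_space_def) blast
  also have "\<dots> = fiber (phi z)"
  proof (intro equalityI subsetI)
    fix x assume "x \<in> (\<lambda>b. sym_diff b z) ` boundaries K p"
    then obtain b where b: "b \<in> boundaries K p" "x = sym_diff b z" by blast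
    then have bc: "b \<in> cycles K p" using boundaries_cycles by blast
    then have "phi b = 0\<^sub>v g" using boundary_phi b(1) by blast
    then have "phi x = phi z" unfolding b(2) phi_sym_diff using phi_carrier[of z] by simp
    then show "x \<in> fiber (phi z)" using cycles_sym_diff[OF bc z] b(2) by (simp add: fiber_def)
  next
    fix x assume "x \<in> fiber (phi z)"
    then have x: "x \<in> cycles K p" "phi x = phi z" by (auto simp: fiber_def)
    have c: "sym_diff x z \<in> cycles K p" by (rule cycles_sym_diff[OF x(1) z])
    have "phi (sym_diff x z) = 0\<^sub>v g"
      unfolding phi_sym_diff x(2) by (rule eq_vecI) (simp_all add: phi_def)
    then have "sym_diff x z \<in> boundaries K p" using boundary_phi[OF c] by blast
    moreover have "x = sym_diff (sym_diff x z) z" by blast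
    ultimately show "x \<in> (\<lambda>b. sym_diff b z) ` boundaries K p" by blast
  qed
  finally show ?thesis .
qed

text \<open>Coordinates are set one after the other: adding the cycle of column \<open>m\<close>
  switches coordinate \<open>m\<close> and no other, by \<open>alpha_column\<close>.\<close>

lemma phi_surj:
  assumes v: "v \<in> carrier_vec g"
  shows "\<exists>z\<in>cycles K p. phi z = v"
proof -
  have "m \<le> g \<Longrightarrow> \<exists>z\<in>cycles K p. \<forall>t<g. alpha z t = (if t < m then v $ t else 0)" for m
  proof (induction m)
    case 0
    show ?case by (rule bexI[OF _ empty_cycle]) (simp add: alpha_def ind_def)
  next
    case (Suc m)
    then obtain z where z: "z \<in> cycles K p" "\<And>t. t < g \<Longrightarrow> alpha z t = (if t < m then v $ t else 0)" by auto
    show ?case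
    proof (cases "v $ m = 0")
      case True
      then show ?thesis using z by (intro bexI[OF _ z(1)]) (auto simp: less_Suc_eq)
    next
      case False
      define w where "w = chain_of (\<lambda>i. P2 i (js ! m))"
      have m: "m < g" using Suc by simp
      have w: "w \<in> cycles K p" "\<And>t. t < g \<Longrightarrow> alpha w t = of_bool (t = m)"
        unfolding w_def using P2_column(1)[OF annot_cols_less[OF m]] alpha_column[OF m] by auto
      have "alpha (sym_diff z w) t = (if t < Suc m then v $ t else 0)" if "t < g" for t
        unfolding alpha_sym_diff z(2)[OF that] w(2)[OF that] using False by (auto simp: less_Suc_eq)
      then show ?thesis using cycles_sym_diff[OF z(1) w(1)] by blast
    qed
  qed
  from this[of g] obtain z where z: "z \<in> cycles K p" "\<forall>t<g. alpha z t = v $ t" by auto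
  have "phi z = v" by (rule eq_vecI) (use z v in \<open>auto simp: phi_def\<close>)
  then show ?thesis using z by blast
qed

lemma fiber_nonempty: "v \<in> carrier_vec g \<Longrightarrow> \<exists>z. z \<in> fiber v"
  using phi_surj by (auto simp: fiber_def)

lemma fiber_inject: "v \<in> carrier_vec g \<Longrightarrow> fiber v = fiber w \<Longrightarrow> v = w"
  using fiber_nonempty[of v] by (auto simp: fiber_def)

lemma fiber_class: "v \<in> carrier_vec g \<Longrightarrow> z \<in> fiber v \<Longrightarrow> homology_class K p z = fiber v"
  using homology_class_fiber by (auto simp: fiber_def)

lemma homology_carrier: "carrier (homology K p) = fiber ` carrier_vec g"
proof -
  have "carrier (homology K p) = homology_class K p ` cycles K p"
    by (auto simp: homology_def A_RCOSETS_def' homology_class_def cycle_space_def)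
  also have "\<dots> = fiber ` carrier_vec g"
  proof (intro equalityI subsetI)
    fix X assume "X \<in> homology_class K p ` cycles K p"
    then show "X \<in> fiber ` carrier_vec g" using homology_class_fiber phi_carrier by auto
  next
    fix X assume "X \<in> fiber ` carrier_vec g"
    then obtain v where v: "v \<in> carrier_vec g" "X = fiber v" by blast
    then obtain z where "z \<in> fiber v" using fiber_nonempty by blast
    then show "X \<in> homology_class K p ` cycles K p" using fiber_class[OF v(1)] v(2) by (auto simp: fiber_def)
  qed
  finally show ?thesis .
qed

lemma homology_zero: "\<zero>\<^bsub>homology K p\<^esub> = fiber (0\<^sub>v g)"
  using boundaries_cycles boundary_phi by (auto simp: homology_def fiber_def)

lemma homology_add:
  assumes v: "v \<in> carrier_vec g" and w: "w \<in> carrier_vec g"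
  shows "fiber v \<oplus>\<^bsub>homology K p\<^esub> fiber w = fiber (v + w)"
proof -
  have "fiber v \<oplus>\<^bsub>homology K p\<^esub> fiber w = {sym_diff a b | a b. a \<in> fiber v \<and> b \<in> fiber w}"
    by (auto simp: homology_def set_add_def' cycle_space_def chain_space_def)
  also have "\<dots> = fiber (v + w)"
  proof (intro equalityI subsetI)
    fix x assume "x \<in> {sym_diff a b | a b. a \<in> fiber v \<and> b \<in> fiber w}"
    then obtain a b where ab: "a \<in> fiber v" "b \<in> fiber w" "x = sym_diff a b" by blast
    then have "a \<in> cycles K p" "b \<in> cycles K p" "phi a = v" "phi b = w" by (simp_all add: fiber_def)
    then show "x \<in> fiber (v + w)" unfolding fiber_def ab(3) using cycles_sym_diff[of a b] phi_sym_diff[of a b] by simp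
  next
    fix x assume "x \<in> fiber (v + w)"
    then have x: "x \<in> cycles K p" "phi x = v + w" by (auto simp: fiber_def)
    obtain a where a: "a \<in> cycles K p" "phi a = v" using phi_surj[OF v] by blast
    have "sym_diff a x \<in> fiber w"
      using cycles_sym_diff[OF a(1) x(1)] by (simp add: fiber_def phi_sym_diff a x add_self_vec[OF v w])
    moreover have "x = sym_diff a (sym_diff a x)" by blast
    moreover have "a \<in> fiber v" using a by (simp add: fiber_def)
    ultimately show "x \<in> {sym_diff a b | a b. a \<in> fiber v \<and> b \<in> fiber w}" by blast
  qed
  finally show ?thesis .
qed

lemma homology_smult:
  assumes v: "v \<in> carrier_vec g"
  shows "r \<odot>\<^bsub>homology K p\<^esub> fiber v = fiber (r \<cdot>\<^sub>v v)"
proof -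
  have "r \<odot>\<^bsub>homology K p\<^esub> fiber v = (\<Union>z\<in>fiber v. homology_class K p (if r = 1 then z else {}))"
    by (simp add: homology_def cycle_space_def chain_space_def)
  also have "\<dots> = fiber (r \<cdot>\<^sub>v v)"
  proof (cases "r = 1")
    case True
    then show ?thesis using fiber_nonempty[OF v] fiber_class[OF v] by auto
  next
    case False
    then have "r = 0" by simp
    then have "r \<cdot>\<^sub>v v = phi {}" using v unfolding phi_empty by (intro eq_vecI) auto
    then show ?thesis using False fiber_nonempty[OF v] homology_class_fiber[OF empty_cycle] by auto
  qed
  finally show ?thesis .
qed

text \<open>The axioms are carried over along \<open>fiber\<close> from the space of vectors; every
  class is its own negative.\<close>

lemma vectorspace_homology: "vectorspace class_ring (homology K p)"
proof -
  interpret V: vec_space "TYPE(bit)" g .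
  have op: "x \<in> carrier (homology K p) \<longleftrightarrow> (\<exists>v\<in>carrier_vec g. x = fiber v)" for x
    by (auto simp: homology_carrier)
  have ab: "abelian_group (homology K p)"
  proof (rule abelian_groupI)
    fix x y assume "x \<in> carrier (homology K p)" "y \<in> carrier (homology K p)"
    then obtain u v where uv: "u \<in> carrier_vec g" "v \<in> carrier_vec g" "x = fiber u" "y = fiber v"
      unfolding op by blast
    then show "x \<oplus>\<^bsub>homology K p\<^esub> y \<in> carrier (homology K p)"
      unfolding op by (metis homology_add add_carrier_vec)
    show "x \<oplus>\<^bsub>homology K p\<^esub> y = y \<oplus>\<^bsub>homology K p\<^esub> x"
      unfolding uv(3,4) homology_add[OF uv(1,2)] homology_add[OF uv(2,1)] comm_add_vec[OF uv(1,2)] ..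
    fix z assume "z \<in> carrier (homology K p)"
    then obtain w where w: "w \<in> carrier_vec g" "z = fiber w" unfolding op by blast
    show "x \<oplus>\<^bsub>homology K p\<^esub> y \<oplus>\<^bsub>homology K p\<^esub> z = x \<oplus>\<^bsub>homology K p\<^esub> (y \<oplus>\<^bsub>homology K p\<^esub> z)"
      unfolding uv(3,4) w(2) homology_add[OF uv(1,2)] homology_add[OF uv(2) w(1)]
        homology_add[OF add_carrier_vec[OF uv(1,2)] w(1)] homology_add[OF uv(1) add_carrier_vec[OF uv(2) w(1)]]
        assoc_add_vec[OF uv(1,2) w(1)] ..
  next
    show "\<zero>\<^bsub>homology K p\<^esub> \<in> carrier (homology K p)" unfolding op homology_zero by auto
    fix x assume x: "x \<in> carrier (homology K p)"
    then obtain v where v: "v \<in> carrier_vec g" "x = fiber v" unfolding op by blast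
    show "\<zero>\<^bsub>homology K p\<^esub> \<oplus>\<^bsub>homology K p\<^esub> x = x"
      unfolding v(2) homology_zero homology_add[OF zero_carrier_vec v(1)] left_zero_vec[OF v(1)] ..
    have "v + v = 0\<^sub>v g" using v(1) by (intro eq_vecI) auto
    then have "x \<oplus>\<^bsub>homology K p\<^esub> x = \<zero>\<^bsub>homology K p\<^esub>"
      unfolding v(2) homology_add[OF v(1) v(1)] homology_zero by simp
    then show "\<exists>y\<in>carrier (homology K p). y \<oplus>\<^bsub>homology K p\<^esub> x = \<zero>\<^bsub>homology K p\<^esub>" using x by blast
  qed
  have "Module.module class_ring (homology K p)"
  proof (rule moduleI)
    show "cring (class_ring :: bit ring)" by (rule domain.axioms(1)[OF field.axioms(1)[OF class_field]])
    show "abelian_group (homology K p)" by (rule ab)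
    fix r x assume "x \<in> carrier (homology K p)"
    then obtain v where v: "v \<in> carrier_vec g" "x = fiber v" unfolding op by blast
    then show "r \<odot>\<^bsub>homology K p\<^esub> x \<in> carrier (homology K p)"
      unfolding op by (metis homology_smult smult_carrier_vec)
    have "(1::bit) \<cdot>\<^sub>v v = v" by (rule one_smult_vec)
    then show "\<one>\<^bsub>class_ring\<^esub> \<odot>\<^bsub>homology K p\<^esub> x = x"
      unfolding v(2) class_ring_simps homology_smult[OF v(1)] by (rule arg_cong)
    fix t
    have "(r + t) \<cdot>\<^sub>v v = r \<cdot>\<^sub>v v + t \<cdot>\<^sub>v v" by (rule add_smult_distrib_vec)
    then show "(r \<oplus>\<^bsub>class_ring\<^esub> t) \<odot>\<^bsub>homology K p\<^esub> x = r \<odot>\<^bsub>homology K p\<^esub> x \<oplus>\<^bsub>homology K p\<^esub> t \<odot>\<^bsub>homology K p\<^esub> x"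
      unfolding v(2) class_ring_simps homology_smult[OF v(1)]
        homology_add[OF smult_carrier_vec[THEN iffD2, OF v(1)] smult_carrier_vec[THEN iffD2, OF v(1)]] by (rule arg_cong)
    have "(r * t) \<cdot>\<^sub>v v = r \<cdot>\<^sub>v (t \<cdot>\<^sub>v v)" by (rule smult_smult_assoc[symmetric])
    then show "(r \<otimes>\<^bsub>class_ring\<^esub> t) \<odot>\<^bsub>homology K p\<^esub> x = r \<odot>\<^bsub>homology K p\<^esub> (t \<odot>\<^bsub>homology K p\<^esub> x)"
      unfolding v(2) class_ring_simps homology_smult[OF v(1)] homology_smult[OF smult_carrier_vec[THEN iffD2, OF v(1)]] by (rule arg_cong)
    fix y assume "y \<in> carrier (homology K p)"
    then obtain w where w: "w \<in> carrier_vec g" "y = fiber w" unfolding op by blast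
    show "r \<odot>\<^bsub>homology K p\<^esub> (x \<oplus>\<^bsub>homology K p\<^esub> y) = r \<odot>\<^bsub>homology K p\<^esub> x \<oplus>\<^bsub>homology K p\<^esub> r \<odot>\<^bsub>homology K p\<^esub> y"
      unfolding v(2) w(2) homology_add[OF v(1) w(1)] homology_smult[OF v(1)] homology_smult[OF w(1)]
        homology_smult[OF add_carrier_vec[OF v(1) w(1)]]
        homology_add[OF smult_carrier_vec[THEN iffD2, OF v(1)] smult_carrier_vec[THEN iffD2, OF w(1)]]
      by (rule arg_cong, rule smult_add_distrib_vec[OF v(1) w(1)])
  qed
  then show ?thesis
    unfolding vectorspace_def using class_field by blast
qed

text \<open>\<open>fiber\<close> is a linear bijection, so the number of selected columns is the
  dimension of homology.\<close>

lemma betti_eq: "betti K p = g"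
proof -
  interpret V: vec_space "TYPE(bit)" g .
  have "linear_map class_ring (module_vec TYPE(bit) g) (homology K p) fiber"
    unfolding linear_map_def mod_hom_def mod_hom_axioms_def LinearCombinations.module_hom_def
    using vectorspace_homology V.vectorspace_axioms vectorspace_homology[unfolded vectorspace_def]
      V.vectorspace_axioms[unfolded vectorspace_def]
    by (simp only: module_vec_simps homology_carrier homology_add homology_smult mem_Collect_eq simp_thms Pi_iff) (auto simp: homology_add homology_smult)
  moreover have "inj_on fiber (carrier (module_vec TYPE(bit) g))"
    using fiber_inject by (intro inj_onI) (simp only: module_vec_simps)
  moreover have "fiber ` carrier (module_vec TYPE(bit) g) = carrier (homology K p)"
    by (simp only: module_vec_simps homology_carrier)
  ultimately have "vectorspace.dim class_ring (module_vec TYPE(bit) g) = vectorspace.dim class_ring (homology K p)"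
    by (rule linear_map.dim_eq[OF _ V.fin_dim])
  then show ?thesis unfolding betti_def V.dim_is_n by (rule sym)
qed

lemma homologous_iff: "z \<in> cycles K p \<Longrightarrow> z' \<in> cycles K p \<Longrightarrow> homologous K p z z' \<longleftrightarrow> phi z = phi z'"
  unfolding homologous_def homology_class_fiber using fiber_inject phi_carrier by metis

lemma null_homologous_iff: "z \<in> cycles K p \<Longrightarrow> null_homologous K p z \<longleftrightarrow> phi z = 0\<^sub>v g"
  unfolding null_homologous_def homology_class_fiber homology_zero using fiber_inject phi_carrier by metis

text \<open>An annotation is a function of the simplex, whereas rows are addressed by position; the
  inverse of \<open>sx\<close> mediates.\<close>

definition vector_of :: "nat set \<Rightarrow> bit vec" where
  "vector_of \<sigma> = vec g (annot Ks p k (the_inv_into {..<n} (\<lambda>i. sx i) \<sigma>))"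

lemma vector_of_sx: "i < n \<Longrightarrow> vector_of (sx i) = vec g (annot Ks p k i)"
  unfolding vector_of_def using the_inv_into_f_f[OF sx_inj, of i] by simp

lemma sum_over_chain:
  assumes "z \<subseteq> K"
  shows "(\<Sum>\<sigma>\<in>z. f \<sigma>) = (\<Sum>i | i < n \<and> sx i \<in> z. f (sx i))"
proof -
  have "z = sx ` {i. i < n \<and> sx i \<in> z}" using assms sx_image by blast
  moreover have "inj_on sx {i. i < n \<and> sx i \<in> z}" by (rule inj_on_subset[OF sx_inj]) auto
  ultimately show ?thesis using sum.reindex[of sx "{i. i < n \<and> sx i \<in> z}" f] by (simp add: comp_def)
qed

lemma annotation_vector_of: "annotation K p vector_of"
proof -
  have phi: "finsum_vec TYPE(bit) g vector_of z = phi z" if z: "z \<in> cycles K p" for z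
  proof (rule eq_vecI)
    have zK: "z \<subseteq> K" using cyclesD(1)[OF z] simplices_sub by blast
    then have fz: "finite z" using fin by (rule finite_subset)
    have c: "vector_of \<in> z \<rightarrow> carrier_vec g" by (simp add: vector_of_def)
    show "dim_vec (finsum_vec TYPE(bit) g vector_of z) = dim_vec (phi z)"
      using finsum_vec_closed[OF c] by (simp add: phi_def)
    fix t assume "t < dim_vec (phi z)"
    then have t: "t < g" by (simp add: phi_def)
    have "finsum_vec TYPE(bit) g vector_of z $ t = (\<Sum>\<sigma>\<in>z. vector_of \<sigma> $ t)"
      by (rule index_finsum_vec[OF fz t c])
    also have "\<dots> = (\<Sum>i | i < n \<and> sx i \<in> z. annot Ks p k i t)"
      unfolding sum_over_chain[OF zK] by (rule sum.cong) (auto simp: vector_of_sx t)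
    also have "\<dots> = (\<Sum>i<N. annot Ks p k i t * ind z i)"
      using size by (intro sum.mono_neutral_cong_left) (auto simp: ind_def)
    finally show "finsum_vec TYPE(bit) g vector_of z $ t = phi z $ t"
      using t by (simp add: phi_def alpha_def)
  qed
  show ?thesis unfolding annotation_def betti_eq
    by (auto simp: homologous_iff phi) (simp_all add: vector_of_def)
qed

lemma pre_output_eq: "pre_output Ks p k = betti K p # enc_annotation Ks p vector_of"
proof -
  have filter: "concat (map f (filter Q xs)) = concat (map (\<lambda>x. if Q x then f x else []) xs)" for f :: "nat set \<Rightarrow> nat list" and Q xs
    by (induction xs) auto
  have "enc_annotation Ks p vector_of =
      concat (map (\<lambda>\<sigma>. if card \<sigma> = p + 1 then map word_of_bit (list_of_vec (vector_of \<sigma>)) else []) (map set Ks))"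
    unfolding enc_annotation_def by (rule filter)
  also have "map set Ks = map sx [0..<n]"
    by (rule nth_equalityI) auto
  also have "concat (map (\<lambda>\<sigma>. if card \<sigma> = p + 1 then map word_of_bit (list_of_vec (vector_of \<sigma>)) else []) (map sx [0..<n])) =
      concat (map (\<lambda>i. if length (S i) = p + 1 then map (\<lambda>t. word_of_bit (annot Ks p k i t)) [0..<g] else []) [0..<n])"
    by (intro arg_cong[of _ _ concat]) (auto simp: sx_card simplex_list_def vector_of_sx list_of_vec_vec)
  finally show ?thesis by (simp add: pre_output_def Let_def betti_eq)
qed

end

section \<open>The query programs\<close>

abbreviation test_body :: "com" where
  "test_body \<equiv> block [Assign 7 (Num 0) (Num 0),
         for_loop 4 1 (Assign 7 (Num 0) (Bin OAdd (reg 7) (Cell 19 (Bin OAdd (Bin OMul (Cell 10 (reg 4)) (reg 9)) (reg 6))))),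
         Cond (Bin OMod (reg 7) (Num 2)) (block [Assign 5 (Num 0) (Num 0)]) (block [])]"

text \<open>An empty chain is answered without the loop over the g coordinates, since for t = 0 the
  bound 1 + t g leaves only constant time.\<close>

definition test_prog :: "com list" where
  "test_prog = [Cond (reg 1)
     (block [Assign 5 (Num 0) (Num 1),
       for_loop 6 9 test_body,
       Write (reg 5)])
     (block [Write (Num 1)])]"

text \<open>For \<open>g = 0\<close> the time bound is constant, so that the answer is given without reading the input.\<close>

definition null_prog :: com where
  "null_prog = block [Cond (reg 9)
     (block ([Read 1 (Num 0), for_loop 4 1 (Read 10 (reg 4))] @ test_prog)) (block [Write (Num 1)])]"

text \<open>Over Z_2 two cycles are homologous iff their sum is a boundary. The lists are simply
  concatenated: a simplex in both occurs twice and cancels modulo 2.\<close>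

definition homologous_prog :: com where
  "homologous_prog = block [Cond (reg 9)
     (block ([Read 1 (Num 0), for_loop 4 1 (Read 10 (reg 4)), Read 2 (Num 0),
       for_loop 4 2 (Read 10 (Bin OAdd (reg 1) (reg 4))), Assign 1 (Num 0) (Bin OAdd (reg 1) (reg 2))] @ test_prog))
     (block [Write (Num 1)])]"

context machine begin

text \<open>The hypothesis on \<open>Q\<close> records that register 9 and array 19 are untouched,
  so that further queries can be asked on the memory left behind.\<close>

lemma wpb_test:
  assumes b: "bnd \<sigma>" and s: "\<sigma> 9 0 = g" "\<sigma> 1 0 = length ns" and st: "stored (\<sigma> 19) n g V"
    and l: "\<And>k. k < length ns \<Longrightarrow> \<sigma> 10 k = ns ! k" "set ns \<subseteq> {..<n}" "length ns \<le> B"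
    and T: "50 \<le> T" "ns \<noteq> [] \<Longrightarrow> real g * (real (length ns) * 40 + 60) + 60 \<le> T"
    and Q: "\<And>\<tau> xs'. \<tau> 9 = \<sigma> 9 \<Longrightarrow> \<tau> 19 = \<sigma> 19 \<Longrightarrow> bnd \<tau> \<Longrightarrow>
      Q (State \<tau> xs [of_bool (\<forall>t<g. (\<Sum>k<length ns. V (ns ! k) t) = 0)] us vs)"
  shows "wpb R (block (test_prog @ [])) T Q (State \<sigma> xs [] us vs)"
proof -
  define m where "m = length ns"
  define E where "E t i = (\<Sum>k<i. V (ns ! k) t)" for t i
  have s': "\<sigma> (Suc 0) 0 = m" using s by (simp add: m_def)
  define I :: invariant where "I = (\<lambda>t \<tau> xs' ys' us' vs'.
    \<tau> 6 0 = t \<and> \<tau> 5 0 = of_bool (\<forall>t'<t. E t' m = 0) \<and> (\<forall>k. k \<notin> {4, 5, 6, 7} \<longrightarrow> \<tau> k = \<sigma> k) \<and>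
    xs' = xs \<and> ys' = [] \<and> us' = us \<and> vs' = vs)"
  have step: "wpb R test_body
      (real m * 40 + 48)
     (loop_post 6 t I)
     (State \<tau> xs' ys' us' vs')" if t: "t < g" and b: "bnd \<tau>" and inv: "I t \<tau> xs' ys' us' vs'" for t \<tau> xs' ys' us' vs'
  proof -
    have r: "\<tau> 6 0 = t" "\<tau> 5 0 = of_bool (\<forall>t'<t. E t' m = 0)" "\<And>k. k \<notin> {4, 5, 6, 7} \<Longrightarrow> \<tau> k = \<sigma> k"
      and e: "xs' = xs" "ys' = []" "us' = us" "vs' = vs" using inv by (simp_all add: I_def)
    \<comment> \<open>The sum is reduced modulo 2 only after the loop; the bound by \<open>i\<close>
      keeps it within a word.\<close>
    define J :: invariant where "J = (\<lambda>i \<tau>' xs' ys' us' vs'.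
      \<tau>' 4 0 = i \<and> \<tau>' 7 0 \<le> i \<and> \<tau>' 7 0 mod 2 = word_of_bit (E t i) \<and>
      (\<forall>k. k \<notin> {4, 7} \<longrightarrow> \<tau>' k = \<tau> k) \<and> xs' = xs \<and> ys' = [] \<and> us' = us \<and> vs' = vs)"
    have step': "wpb R (Assign 7 (Num 0) (Bin OAdd (reg 7) (Cell 19 (Bin OAdd (Bin OMul (Cell 10 (reg 4)) (reg 9)) (reg 6))))) 28
        (loop_post 4 i J)
        (State \<tau>' xs'' ys'' us'' vs'')" if i: "i < m" and b: "bnd \<tau>'" and inv: "J i \<tau>' xs'' ys'' us'' vs''" for i \<tau>' xs'' ys'' us'' vs''
    proof -
      have r': "\<tau>' 4 0 = i" "\<tau>' 7 0 \<le> i" "\<tau>' 7 0 mod 2 = word_of_bit (E t i)" "\<And>k. k \<notin> {4, 7} \<Longrightarrow> \<tau>' k = \<tau> k"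
        and e: "xs'' = xs" "ys'' = []" "us'' = us" "vs'' = vs" using inv by (simp_all add: J_def)
      have in_n: "ns ! i < n" using l(2) i by (metis lessThan_iff m_def nth_mem subsetD)
      have "\<sigma> 19 (ns ! i * g + t) = word_of_bit (V (ns ! i) t)"
        using st index_less[OF in_n t] t by (simp add: stored_def index_div_mod)
      then have v: "ev (Bin OAdd (reg 7) (Cell 19 (Bin OAdd (Bin OMul (Cell 10 (reg 4)) (reg 9)) (reg 6)))) \<tau>' =
          \<tau>' 7 0 + word_of_bit (V (ns ! i) t)"
        using l(1)[of i] i by (simp add: r' r s m_def)
      have "(\<tau>' 7 0 + word_of_bit (V (ns ! i) t)) mod 2 = (\<tau>' 7 0 mod 2 + word_of_bit (V (ns ! i) t)) mod 2"
        by (simp only: mod_add_left_eq)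
      also have "\<dots> = word_of_bit (E t (Suc i))"
        unfolding r'(3) by (rule word_of_bit_add) (simp only: E_def sum.lessThan_Suc)
      finally have md: "(\<tau>' 7 0 + word_of_bit (V (ns ! i) t)) mod 2 = word_of_bit (E t (Suc i))" .
      have le: "\<tau>' 7 0 + word_of_bit (V (ns ! i) t) \<le> Suc i"
        using r'(2) word_of_bit_le[of "V (ns ! i) t"] by simp
      show ?thesis unfolding e
      proof (rule wpb_Assign1[OF b _ _ refl v])
        show "\<tau>' 7 0 + word_of_bit (V (ns ! i) t) \<le> B" using le i l(3) by (simp add: m_def)
      qed (use md le r' in \<open>simp_all add: J_def\<close>)
    qed
    show ?thesis unfolding e
      apply (rule wpb_assign_reg[OF b], simp, simp, simp)
      apply (rule wpb_for[where I = J and n = m and Tb = 28], assumption)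
         apply (simp add: J_def E_def)
        apply (rule step'; assumption)
       apply (simp add: J_def r s')
      subgoal premises p for \<tau>' xs'' ys'' us'' vs''
      proof -
        have r': "\<tau>' 7 0 mod 2 = word_of_bit (E t m)" "\<And>k. k \<notin> {4, 7} \<Longrightarrow> \<tau>' k = \<tau> k"
          and e: "xs'' = xs" "ys'' = []" "us'' = us" "vs'' = vs" using p(3) by (simp_all add: J_def)
        have b': "bnd \<tau>'" by (rule p(2))
        have 1: "I (Suc t) (set_reg 6 (Suc t) (set_reg 5 0 \<tau>')) xs [] us vs" if "\<tau>' 7 0 mod 2 \<noteq> 0"
          using that unfolding I_def r'(1) by (auto simp: r' r)
        have 2: "I (Suc t) (set_reg 6 (Suc t) \<tau>') xs [] us vs" if "\<tau>' 7 0 mod 2 = 0"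
          using that unfolding I_def r'(1) by (auto simp: r' r less_Suc_eq)
        show ?thesis unfolding e
          apply (rule wpb_Cond[OF b'], simp)
           apply (simp only: append_Cons append_Nil)
           apply (rule wpb_assign_reg[OF b'], simp, simp, simp)
           apply (rule wpb_Nil, simp, simp, use 1 in \<open>simp add: r' r\<close>)
          apply (simp only: append_Nil)
          apply (rule wpb_Nil, simp add: b', simp, use 2 in \<open>simp add: r' r\<close>)
          done
      qed
      done
  qed
  show ?thesis unfolding test_prog_def append_Cons append_Nil
    apply (rule wpb_Cond[OF b], simp)
    subgoal premises ne
      apply (simp only: append_Cons append_Nil)
      apply (rule wpb_assign_reg[OF b], simp, simp, use two_le_B in simp)
      apply (rule wpb_for[where I = I and n = g and Tb = "real m * 40 + 48"], assumption)
         apply (simp add: I_def)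
        apply (rule step; assumption)
       apply (simp add: I_def s)
      subgoal premises p for \<tau> xs' ys' us' vs'
      proof -
        have r: "\<tau> 5 0 = of_bool (\<forall>t'<g. E t' m = 0)" "\<And>k. k \<notin> {4, 5, 6, 7} \<Longrightarrow> \<tau> k = \<sigma> k"
          and e: "xs' = xs" "ys' = []" "us' = us" "vs' = vs" using p(3) by (simp_all add: I_def)
        have "ns \<noteq> []" using ne s by auto
        note TT = T(2)[OF this]
        show ?thesis unfolding e
          apply (rule wpb_Write[OF p(2)], simp, rule refl)
          apply (rule wpb_Nil, simp add: p(2))
           apply (use TT in \<open>simp add: m_def algebra_simps\<close>)
          using Q[of \<tau>] p(2) r by (simp add: E_def m_def)
      qed
      done
    subgoal premises z
      apply (simp only: append_Cons append_Nil)
      apply (rule wpb_Write[OF b], simp, simp)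
      apply (rule wpb_Nil, simp add: b)
       apply (use T(1) in simp)
      using Q[of \<sigma>] b z s by simp
    done
qed

lemma wpb_null:
  assumes b: "bnd M" and s: "M 9 0 = g" and st: "stored (M 19) n g V"
    and l: "set ns \<subseteq> {..<n}" "length ns \<le> B" "n \<le> B"
  shows "wpb R null_prog (300 * (1 + real (length ns) * real g))
    (\<lambda>s'. out s' = [of_bool (\<forall>t<g. (\<Sum>k<length ns. V (ns ! k) t) = 0)] \<and>
       store s' 9 0 = g \<and> stored (store s' 19) n g V)
    (State M (enc_chain ns) [] [] [])"
  unfolding null_prog_def
  apply (rule wpb_Cond[OF b], simp)
  subgoal premises g
  proof -
    have g1: "1 \<le> g" using g s by simp
    have time: "real (length ns) \<le> real (length ns) * real g" "0 \<le> real (length ns) * real g"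
      and TT: "ns \<noteq> [] \<Longrightarrow> real g * (real (length ns) * 40 + 60) + 60 \<le> 300 * (1 + real (length ns) * real g) - 100 - real (length ns) * 15"
    proof -
      have g': "1 \<le> real g" using g1 by simp
      show le: "real (length ns) \<le> real (length ns) * real g" using mult_left_mono[OF g', of "real (length ns)"] by simp
      show ge: "0 \<le> real (length ns) * real g" by simp
      \<comment> \<open>A nonempty chain has g \<le> t g, which absorbs the fixed cost per
        coordinate; g \<ge> 1 has absorbed the reading.\<close>
      assume "ns \<noteq> []"
      then have "1 \<le> real (length ns)" by (cases ns) simp_all
      from mult_right_mono[OF this, of "real g"] have "real g \<le> real (length ns) * real g" by simp
      with le ge have "40 * (real (length ns) * real g) + 60 * real g + 60 \<le> 300 * (1 + real (length ns) * real g) - 100 - real (length ns) * 15"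
        unfolding distrib_left by linarith
      moreover have "real g * (real (length ns) * 40 + 60) = 40 * (real (length ns) * real g) + 60 * real g" by (simp add: algebra_simps)
      ultimately show "real g * (real (length ns) * 40 + 60) + 60 \<le> 300 * (1 + real (length ns) * real g) - 100 - real (length ns) * 15"
        by (simp only:)
    qed
    have lB: "ns ! k \<le> B" if "k < length ns" for k
      using l(1,3) nth_mem[OF that] by auto
    show ?thesis
      apply (simp only: append_Cons append_Nil enc_chain_def append_assoc)
      apply (rule wpb_read_reg[OF b], rule l)
      apply (rule wpb_read_array[where n = "length ns"], assumption, simp, simp, erule lB, simp)
      apply (rule wpb_test[where g = g and n = n and V = V and ns = ns], assumption, simp add: s, simp, simp add: st, simp, rule l, rule l)
        apply (use time(1,2) in simp)
       apply (rule order_trans, erule TT, simp)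
      apply (simp add: s st)
      done
  qed
  subgoal premises g
    apply (simp only: append_Cons append_Nil)
    apply (rule wpb_Write[OF b], simp, simp)
    apply (rule wpb_Nil, simp add: b)
    using g s st by simp_all
  done

lemma wpb_homologous:
  assumes b: "bnd M" and s: "M 9 0 = g" and st: "stored (M 19) n g V"
    and l: "set ns \<subseteq> {..<n}" "set ns' \<subseteq> {..<n}" "length ns + length ns' \<le> B" "n \<le> B"
  shows "wpb R homologous_prog (300 * (1 + (real (length ns) + real (length ns')) * real g))
    (\<lambda>s'. out s' = [of_bool (\<forall>t<g. (\<Sum>k<length (ns @ ns'). V ((ns @ ns') ! k) t) = 0)] \<and>
       store s' 9 0 = g \<and> stored (store s' 19) n g V)
    (State M (enc_chain ns @ enc_chain ns') [] [] [])"
  unfolding homologous_prog_def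
  apply (rule wpb_Cond[OF b], simp)
  subgoal premises g
  proof -
    have g1: "1 \<le> g" using g s by simp
    define m where "m = length ns + length ns'"
    have time: "real m \<le> real m * real g" "0 \<le> real m * real g"
      and TT: "ns @ ns' \<noteq> [] \<Longrightarrow> real g * (real m * 40 + 60) + 60 \<le> 300 * (1 + real m * real g) - 100 - real m * 30"
    proof -
      have g': "1 \<le> real g" using g1 by simp
      show le: "real m \<le> real m * real g" using mult_left_mono[OF g', of "real m"] by simp
      show ge: "0 \<le> real m * real g" by simp
      assume "ns @ ns' \<noteq> []"
      then have "1 \<le> real m" unfolding m_def by (cases ns; cases ns') simp_all
      from mult_right_mono[OF this, of "real g"] have "real g \<le> real m * real g" by simp
      with le ge have "40 * (real m * real g) + 60 * real g + 60 \<le> 300 * (1 + real m * real g) - 100 - real m * 30"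
        unfolding distrib_left by linarith
      moreover have "real g * (real m * 40 + 60) = 40 * (real m * real g) + 60 * real g" by (simp add: algebra_simps)
      ultimately show "real g * (real m * 40 + 60) + 60 \<le> 300 * (1 + real m * real g) - 100 - real m * 30"
        by (simp only:)
    qed
    have m: "real (length ns) + real (length ns') = real m" "real (length (ns @ ns')) = real m" by (simp_all add: m_def)
    have m': "real (length ns) \<le> real m" "real (length ns') \<le> real m" by (simp_all add: m_def)
    have lB: "ns ! k \<le> B" if "k < length ns" for k
      using l(1,4) nth_mem[OF that] by auto
    have lB': "ns' ! k \<le> B" if "k < length ns'" for k
      using l(2,4) nth_mem[OF that] by auto
    have LB: "length ns \<le> B" "length ns' \<le> B" using l by simp_all
    define I :: invariant where "I = (\<lambda>j \<tau> xs' ys' us' vs'.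
      \<tau> 4 0 = j \<and> (\<forall>k<length ns + j. \<tau> 10 k = (ns @ ns') ! k) \<and> \<tau> 9 0 = g \<and> \<tau> 1 0 = length ns \<and>
      \<tau> 2 0 = length ns' \<and> stored (\<tau> 19) n g V \<and> xs' = drop j ns' \<and> ys' = [] \<and> us' = [] \<and> vs' = [])"
    have step: "wpb R (Read 10 (Bin OAdd (reg 1) (reg 4))) 10
       (loop_post 4 j I)
       (State \<tau> xs' ys' us' vs')" if j: "j < length ns'" and b: "bnd \<tau>" and inv: "I j \<tau> xs' ys' us' vs'" for j \<tau> xs' ys' us' vs'
    proof -
      have xs: "xs' = ns' ! j # drop (Suc j) ns'" using inv j by (simp add: I_def Cons_nth_drop_Suc)
      show ?thesis unfolding xs
        by (rule wpb_Read1[OF b _ refl lB'[OF j]]) (use inv in \<open>auto simp: I_def less_Suc_eq nth_append\<close>)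
    qed
    show ?thesis
      apply (simp only: append_Cons append_Nil enc_chain_def append_assoc)
      apply (rule wpb_read_reg[OF b], rule LB)
      apply (rule wpb_read_array[where n = "length ns"], assumption, simp, simp, simp add: nth_append lB, simp)
      apply (simp only: drop_append drop_all le_refl diff_self_eq_0 drop_0 append_Nil)
      apply (rule wpb_read_reg, assumption, rule LB)
      apply (rule wpb_for[where I = I and n = "length ns'" and Tb = 10], assumption)
         apply (simp add: I_def s st nth_append)
        apply (rule step; assumption)
       apply (simp add: I_def)
      subgoal premises p for \<tau> xs' ys' us' vs'
      proof -
        have r: "\<And>k. k < length ns + length ns' \<Longrightarrow> \<tau> 10 k = (ns @ ns') ! k" "\<tau> 9 0 = g" "\<tau> 1 0 = length ns"
          "\<tau> (Suc 0) 0 = length ns" "\<tau> 2 0 = length ns'" "stored (\<tau> 19) n g V"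
          and e: "ys' = []" "us' = []" "vs' = []" using p(5) by (simp_all add: I_def)
        show ?thesis unfolding e
          apply (rule wpb_assign_reg[OF p(4)], simp, simp add: r, use l(3) in simp)
          apply (rule wpb_test[where g = g and n = n and V = V and ns = "ns @ ns'"], assumption, simp add: r, simp, simp add: r, simp add: r, use l in simp, use l in simp)
            apply (unfold m, use time m(1) in simp)
          subgoal premises q
          proof -
            have "real (2 + cost (reg 9)) = 4" "real (2 + cost (Bin OAdd (reg 1) (reg 2))) = 7"
              "real (length ns') * (10 + 12) = 22 * real (length ns')" by simp_all
            then show ?thesis using TT[OF q(2)] m(1) m' by linarith
          qed
          apply (simp add: r)
          done
      qed
      done
  qed
  subgoal premises g
    apply (simp only: append_Cons append_Nil)
    apply (rule wpb_Write[OF b], simp, simp)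
    apply (rule wpb_Nil, simp add: b)
    using g s st by simp_all
  done

end

section \<open>Query answers in terms of homology\<close>

context listed_complex begin

lemma alpha_list:
  assumes "lists_chain Ks ns z"
  shows "(\<Sum>l<length ns. annot Ks p k (ns ! l) t) = alpha z t" "card z = length ns"
proof -
  have ns: "distinct ns" "set ns \<subseteq> {..<n}" "z = sx ` set ns"
    using assms by (auto simp: lists_chain_def)
  have inj: "inj_on sx (set ns)" using sx_inj ns(2) by (rule inj_on_subset)
  show "card z = length ns" using card_image[OF inj] ns by (simp add: distinct_card)
  have mem: "i < n \<and> sx i \<in> z \<longleftrightarrow> i \<in> set ns" for i
  proof
    assume i: "i < n \<and> sx i \<in> z"
    then obtain j where "j \<in> set ns" "sx i = sx j" using ns(3) by auto
    then show "i \<in> set ns" using sx_eq[of i j] i ns(2) by auto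
  qed (use ns in auto)
  have "(\<Sum>l<length ns. annot Ks p k (ns ! l) t) = sum_list (map (\<lambda>i. annot Ks p k i t) ns)"
    by (simp add: sum_list_sum_nth atLeast0LessThan)
  also have "\<dots> = (\<Sum>i\<in>set ns. annot Ks p k i t)"
    using ns(1) by (rule sum_list_distinct_conv_sum_set)
  also have "\<dots> = (\<Sum>i<N. annot Ks p k i t * ind z i)"
    using ns(2) size by (intro sum.mono_neutral_cong_left) (auto simp: ind_def mem)
  finally show "(\<Sum>l<length ns. annot Ks p k (ns ! l) t) = alpha z t" by (simp only: alpha_def)
qed

lemma null_homologous_list:
  assumes "z \<in> cycles K p" "lists_chain Ks ns z"
  shows "null_homologous K p z \<longleftrightarrow> (\<forall>t<g. (\<Sum>l<length ns. annot Ks p k (ns ! l) t) = 0)"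
  unfolding null_homologous_iff[OF assms(1)] alpha_list(1)[OF assms(2)]
  by (auto simp: phi_def vec_eq_iff)

lemma homologous_list:
  assumes "z \<in> cycles K p" "lists_chain Ks ns z" "z' \<in> cycles K p" "lists_chain Ks ns' z'"
  shows "homologous K p z z' \<longleftrightarrow>
    (\<forall>t<g. (\<Sum>l<length (ns @ ns'). annot Ks p k ((ns @ ns') ! l) t) = 0)"
proof -
  have "(\<Sum>l<length (ns @ ns'). annot Ks p k ((ns @ ns') ! l) t) = alpha z t + alpha z' t" for t
    unfolding length_append sum_lessThan_add alpha_list(1)[OF assms(2), symmetric]
      alpha_list(1)[OF assms(4), symmetric]
    by (rule arg_cong2[where f = "(+)"]) (rule sum.cong[OF refl], simp add: nth_append)+
  moreover have "(a :: bit) + b = 0 \<longleftrightarrow> a = b" for a b by (cases a; cases b) simp_all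
  moreover have "phi z = phi z' \<longleftrightarrow> (\<forall>t<g. alpha z t = alpha z' t)"
    by (auto simp: phi_def vec_eq_iff)
  ultimately show ?thesis unfolding homologous_iff[OF assms(1,3)] by (simp only:)
qed

end

text \<open>All nonempty faces of a simplex lie in the complex. Hence its vertices are
  logarithmically few, which bounds each facet test.\<close>

lemma two_power_length:
  assumes "finite K" "simplicial_complex K" "lists_complex Ks K" "vs \<in> set Ks"
  shows "2 ^ length vs \<le> length Ks + 1"
proof -
  have d: "set vs \<in> K" "card (set vs) = length vs" "card K = length Ks"
    using assms(3,4) distinct_card[of "map set Ks"] by (auto simp: lists_complex_def distinct_card)
  have "Pow (set vs) - {{}} \<subseteq> K" using assms(2) d(1) unfolding simplicial_complex_def by blast
  then have "card (Pow (set vs) - {{}}) \<le> card K" using assms(1) by (intro card_mono)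
  moreover have "card (Pow (set vs) - {{}}) = 2 ^ length vs - 1"
    using d(2) by (simp add: card_Diff_subset card_Pow)
  ultimately show ?thesis using d(3) by simp
qed

text \<open>Padding to N < 2 n costs constant factors only. The facet tests contribute N^2 L, and L
  is O(log n), hence O(n^\<delta>) with \<delta> = \<omega> - 2 > 0, by ln x \<le> x^\<delta> /
  \<delta>.\<close>

lemma preprocessing_time:
  fixes \<omega> C D :: real
  assumes w: "2 < \<omega>" and C: "0 \<le> C" and D: "0 \<le> D"
  obtains E where "\<And>n N L :: nat. 1 \<le> n \<Longrightarrow> n \<le> N \<Longrightarrow> N < 2 * n \<Longrightarrow> 2 ^ L \<le> n + 1 \<Longrightarrow>
    D * real N * real N powr (\<omega> - 1) + (C + 400) * real N powr \<omega> + D * real N * real (2 * N) powr (\<omega> - 1)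
      + real (N * N) * (real L * 190 + 2000) \<le> E * real n powr \<omega>"
proof
  define \<delta> where "\<delta> = \<omega> - 2"
  define A where "A = (2::real) powr \<omega>"
  define A' where "A' = (2::real) powr (\<omega> - 1)"
  define H where "H = 2 powr \<delta> / (\<delta> * ln 2)"
  fix n N L :: nat assume n: "1 \<le> n" "n \<le> N" "N < 2 * n" "2 ^ L \<le> n + 1"
  have d: "0 < \<delta>" using w by (simp add: \<delta>_def)
  define F where "F = real n powr \<omega>"
  define G where "G = real N powr \<omega>"
  have N1: "1 \<le> real N" "1 \<le> real n" "real N \<le> 2 * real n" using n by simp_all
  have G: "G \<le> A * F"
    using powr_mono2[of \<omega> "real N" "2 * real n"] N1 w by (simp add: G_def A_def F_def powr_mult)
  have G1: "real N * real N powr (\<omega> - 1) = G"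
    using powr_add[of "real N" 1 "\<omega> - 1"] N1 by (simp add: G_def)
  have G2: "real N * real (2 * N) powr (\<omega> - 1) = A' * G"
    using G1 by (simp add: A'_def powr_mult mult.left_commute)
  have sq: "real N * real N \<le> G"
  proof -
    have "real N powr 2 \<le> real N powr \<omega>" using N1 w by (intro powr_mono) auto
    then show ?thesis using N1 by (simp add: G_def power2_eq_square)
  qed
  have L: "real L \<le> H * real n powr \<delta>"
  proof -
    have "(2::real) ^ L \<le> 2 * real n" using n(1) of_nat_mono[OF n(4), where 'a = real] by simp
    then have "ln ((2::real) ^ L) \<le> ln (2 * real n)" using N1 by (subst ln_le_cancel_iff) auto
    then have "real L * ln 2 \<le> ln (2 * real n)" by (simp add: ln_realpow)
    also have "\<dots> \<le> (2 * real n) powr \<delta> / \<delta>" using N1 d by (intro ln_powr_bound) auto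
    also have "\<dots> = 2 powr \<delta> * real n powr \<delta> / \<delta>" by (simp add: powr_mult)
    finally have "real L * ln 2 \<le> 2 powr \<delta> * real n powr \<delta> / \<delta>" .
    moreover have "0 < ln (2::real)" by simp
    ultimately have "real L \<le> 2 powr \<delta> * real n powr \<delta> / \<delta> / ln 2" by (simp only: pos_le_divide_eq)
    then show ?thesis using d by (simp add: H_def)
  qed
  have nn: "real n * real n * real n powr \<delta> = F"
    using powr_add[of "real n" 2 \<delta>] N1 by (simp add: F_def \<delta>_def power2_eq_square)
  have NL: "real N * real N * real L \<le> 4 * H * F"
  proof -
    have "real N * real N \<le> (2 * real n) * (2 * real n)" by (rule mult_mono[OF N1(3,3)]) simp_all
    then have "real N * real N * real L \<le> (2 * real n) * (2 * real n) * (H * real n powr \<delta>)"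
      by (rule mult_mono[OF _ L]) simp_all
    also have "\<dots> = 4 * H * (real n * real n * real n powr \<delta>)" by (simp add: mult_ac)
    finally show ?thesis unfolding nn .
  qed
  have A0: "0 \<le> A'" by (simp add: A'_def)
  have "D * real N * real N powr (\<omega> - 1) + (C + 400) * real N powr \<omega> + D * real N * real (2 * N) powr (\<omega> - 1)
      + real (N * N) * (real L * 190 + 2000) =
      (D + (C + 400) + D * A') * G + 190 * (real N * real N * real L) + 2000 * (real N * real N)"
    unfolding mult.assoc[of D] G1 G2 by (simp add: G_def algebra_simps)
  also have "\<dots> \<le> (D + (C + 400) + D * A') * (A * F) + 190 * (4 * H * F) + 2000 * (A * F)"
    using G sq NL C D A0 by (intro add_mono mult_left_mono) (auto intro: add_nonneg_nonneg)
  also have "\<dots> = ((D + (C + 400) + D * A') * A + 760 * H + 2000 * A) * F" by (simp add: algebra_simps)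
  finally show "D * real N * real N powr (\<omega> - 1) + (C + 400) * real N powr \<omega> + D * real N * real (2 * N) powr (\<omega> - 1)
      + real (N * N) * (real L * 190 + 2000)
      \<le> ((D + (C + 400) + D * 2 powr (\<omega> - 1)) * 2 powr \<omega> + 760 * (2 powr (\<omega> - 2) / ((\<omega> - 2) * ln 2)) + 2000 * 2 powr \<omega>) * real n powr \<omega>"
    by (simp only: F_def A_def A'_def H_def \<delta>_def)
qed

section \<open>Assembly of the word bound and the constants\<close>

lemma (in machine) wpb_runs:
  assumes "wpb c c T Q (State M xs [] [] [])"
  obtains t s' where "runs W c M xs t (out s') (store s')" "real t \<le> T" "bnd (store s')" "Q s'"
  using assms unfolding wpb_def runs_def start_def by blast

lemma word_bound_mono:
  assumes "c1 * (d * X\<^sup>2) ^ k1 \<le> Wmax" "1 + length ys + sum_list ys \<le> d * X\<^sup>2"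
  shows "word_bound c1 k1 ys \<le> Wmax"
  unfolding word_bound_def using mult_le_mono2[OF power_mono[OF assms(2)], of c1 k1] assms(1) by linarith

lemma sum_list_enc_le: "sum_list (enc r c M) \<le> r * c"
proof -
  have "sum_list (enc r c M) \<le> (\<Sum>k\<leftarrow>[0..<r * c]. 1)"
    unfolding enc_def by (intro sum_list_mono) (use word_of_bit_le in auto)
  then show ?thesis by (simp add: sum_list_triv)
qed

theorem mainTheorem5:
  fixes \<omega> :: real
  assumes "\<omega> > 2" and "matmul_in_time \<omega>"
  shows "\<exists>(Pre :: com) (Null :: com) (Homol :: com) (C :: real) (c :: nat) (k :: nat).
    \<forall>(K :: nat set set) (p :: nat) (Ks :: nat list list).
      finite K \<and> simplicial_complex K \<and> connected_complex K \<and> lists_complex Ks K \<longrightarrow>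
      (let n = card K; g = betti K p; xs = p # enc_complex Ks; W = word_bound c k xs in
       \<exists>(a :: nat set \<Rightarrow> bit vec) (D :: store set).
         annotation K p a \<and>
         (\<exists>t. \<exists>M\<in>D. runs W Pre zero_store xs t (g # enc_annotation Ks p a) M \<and>
            real t \<le> C * real n powr \<omega>) \<and>
         (\<forall>M\<in>D.
            (\<forall>z zs. z \<in> cycles K p \<and> lists_chain Ks zs z \<longrightarrow>
              (\<exists>t. \<exists>M'\<in>D.
                 runs W Null M (enc_chain zs) t [of_bool (null_homologous K p z)] M' \<and>
                 real t \<le> C * (1 + real (card z) * real g))) \<and>
            (\<forall>z1 zs1 z2 zs2.
              z1 \<in> cycles K p \<and> lists_chain Ks zs1 z1 \<and>
              z2 \<in> cycles K p \<and> lists_chain Ks zs2 z2 \<longrightarrow>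
              (\<exists>t. \<exists>M'\<in>D.
                 runs W Homol M (enc_chain zs1 @ enc_chain zs2) t
                   [of_bool (homologous K p z1 z2)] M' \<and>
                 real t \<le> C * (1 + (real (card z1) + real (card z2)) * real g)))))"
proof -
  obtain P C0 c0 k0 where mm: "\<And>n A M. n \<ge> 1 \<Longrightarrow> A \<in> carrier_mat n n \<Longrightarrow> M \<in> carrier_mat n n \<Longrightarrow>
      \<exists>t M'. runs (word_bound c0 k0 (n # enc_mat A @ enc_mat M)) P zero_store (n # enc_mat A @ enc_mat M) t (enc_mat (A * M)) M' \<and>
        real t \<le> C0 * real n powr \<omega>"
    using assms(2) unfolding matmul_in_time_def Let_def by blast
  define C1 where "C1 = max 0 C0"
  \<comment> \<open>Halving the width divides the claimed time by more than the number 2 of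
    recursive calls; \<open>D\<close> is chosen by dividing by this gap.\<close>
  have gap: "0 < 2 powr (\<omega> - 1) - (2::real)"
    using powr_less_mono[of 1 "\<omega> - 1" "2::real"] assms(1) by simp
  define D where "D = max 150 ((5 * (C1 + 400) + 3000) / (2 powr (\<omega> - 1) - 2))"
  have D: "150 \<le> D" "5 * (C1 + 400) + 3000 \<le> D * (2 powr (\<omega> - 1) - 2)" "0 \<le> D" "0 \<le> C1"
    using gap by (auto simp: D_def C1_def simp flip: pos_divide_le_eq)
  obtain E where E: "\<And>n N L :: nat. 1 \<le> n \<Longrightarrow> n \<le> N \<Longrightarrow> N < 2 * n \<Longrightarrow> 2 ^ L \<le> n + 1 \<Longrightarrow>
    D * real N * real N powr (\<omega> - 1) + (C1 + 400) * real N powr \<omega> + D * real N * real (2 * N) powr (\<omega> - 1)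
      + real (N * N) * (real L * 190 + 2000) \<le> E * real n powr \<omega>"
    using preprocessing_time[OF assms(1) D(4,3)] by blast
  \<comment> \<open>One summand dominates B^40 with B = 72 X^2, the other the word bound of the
    multiplication program on inputs of weight at most 28 X^2, where X measures the whole input;
    \<open>k\<close> adds up the exponents 80 and 2 k0.\<close>
  define c where "c = 72 ^ 40 + c0 * 28 ^ k0"
  define k where "k = 80 + 2 * k0"
  define Cf where "Cf = max 300 E"
  show ?thesis
  proof (rule exI[of _ "pre_prog P"], rule exI[of _ null_prog], rule exI[of _ homologous_prog],
      rule exI[of _ Cf], rule exI[of _ c], rule exI[of _ k], intro allI impI)
    fix K :: "nat set set" and p :: nat and Ks :: "nat list list"
    assume A: "finite K \<and> simplicial_complex K \<and> connected_complex K \<and> lists_complex Ks K"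
    define n where "n = length Ks"
    define xs where "xs = p # enc_complex Ks"
    define X where "X = 1 + length xs + sum_list xs"
    define W where "W = word_bound c k xs"
    \<comment> \<open>72 is 8 times 3^2: dimensions are at most 2 n, and 2 n + 1 \<le> 3 X.\<close>
    define B where "B = 72 * X\<^sup>2"
    have cK: "card K = n" using A distinct_card[of "map set Ks"] by (simp add: lists_complex_def n_def)
    have "K \<noteq> {}" using A by (simp add: connected_complex_def)
    then have n1: "1 \<le> n" using A cK by (metis One_nat_def Suc_leI card_gt_0_iff)
    have mem: "x \<le> X" if "x \<in> set xs" for x using member_le_sum_list[OF that] by (simp add: X_def)
    have X1: "1 \<le> X" by (simp add: X_def)
    have nX: "n \<le> X" "p \<le> X" by (rule mem, simp add: xs_def enc_complex_def n_def)+
    have XB: "x \<le> B" if "x \<le> X" for x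
    proof -
      have "X \<le> X * X" using X1 by simp
      then show ?thesis using that unfolding B_def power2_eq_square by linarith
    qed
    have W: "W = (72 ^ 40 + c0 * 28 ^ k0) * X ^ (80 + 2 * k0)"
      by (simp only: W_def word_bound_def c_def k_def X_def)
    have Xp: "X ^ 80 \<le> X ^ (80 + 2 * k0)" "X ^ (2 * k0) \<le> X ^ (80 + 2 * k0)"
      using X1 by (auto intro: power_increasing)
    have BW: "B ^ 40 \<le> W"
    proof -
      have "B ^ 40 = 72 ^ 40 * X ^ 80" unfolding B_def power_mult_distrib power_mult[symmetric] by simp
      also have "\<dots> \<le> W" unfolding W using Xp(1) by (intro mult_mono) auto
      finally show ?thesis .
    qed
    have PW: "c0 * (28 * X\<^sup>2) ^ k0 \<le> W"
    proof -
      have "c0 * (28 * X\<^sup>2) ^ k0 = c0 * 28 ^ k0 * X ^ (2 * k0)"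
        unfolding power_mult_distrib power_mult[symmetric] by simp
      also have "\<dots> \<le> W" unfolding W using Xp(2) by (intro mult_mono) auto
      finally show ?thesis .
    qed
    interpret machine W B
      by standard (use BW X1 in \<open>auto simp: B_def intro: order_trans[of 2 72]\<close>)
    interpret mul_machine W B P C1 \<omega> "2 * n"
    proof
      show "2 < \<omega>" "0 \<le> C1" by (fact assms(1), fact D(4))
      have "2 * n + 1 \<le> 3 * X" using nX X1 by simp
      then have "(2 * n + 1)\<^sup>2 \<le> (3 * X)\<^sup>2" by (rule power_mono) simp
      then show "8 * (2 * n + 1)\<^sup>2 \<le> B" by (simp add: B_def power_mult_distrib)
      fix s :: nat and M M' :: bmat assume s: "1 \<le> s" "s \<le> 2 * n"
      define Q Q' where "Q = mat s s (\<lambda>(i, j). M i j)" and "Q' = mat s s (\<lambda>(i, j). M' i j)"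
      have Q: "Q \<in> carrier_mat s s" "Q' \<in> carrier_mat s s" by (auto simp: Q_def Q'_def)
      have kd: "i div s < s \<and> i mod s < s" if "i < s * s" for i
        using that s by (auto simp: less_mult_imp_div_less)
      have eQ: "enc_mat Q = enc s s M" "enc_mat Q' = enc s s M'"
        unfolding enc_mat_eq[OF Q(1)] enc_mat_eq[OF Q(2)] enc_def by (auto simp: Q_def Q'_def kd)
      have eQQ: "enc_mat (Q * Q') = enc s s (mmul s M M')"
      proof -
        have "mmul s (\<lambda>i j. Q $$ (i, j)) (\<lambda>i j. Q' $$ (i, j)) a b = mmul s M M' a b" if "a < s" "b < s" for a b
          unfolding mmul_def by (rule sum.cong) (simp_all only: Q_def Q'_def index_mat lessThan_iff that prod.case)
        then show ?thesis unfolding enc_mat_times[OF Q] enc_def by (intro map_cong refl arg_cong[of _ _ word_of_bit]) (simp add: kd)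
      qed
      let ?ys = "s # enc s s M @ enc s s M'"
      obtain t M'' where r: "runs (word_bound c0 k0 ?ys) P zero_store ?ys t (enc s s (mmul s M M')) M''"
        "real t \<le> C0 * real s powr \<omega>" using mm[OF s(1) Q] unfolding eQ eQQ by blast
      have "word_bound c0 k0 ?ys \<le> W"
      proof (rule word_bound_mono[OF PW])
        \<comment> \<open>The input has 1 + 2 s^2 words with sum at most s + 2 s^2; with the extra 1
          this is at most 7 s^2 \<le> 28 X^2.\<close>
        have "s * s \<le> (2 * X) * (2 * X)" using s(2) nX(1) by (intro mult_le_mono) auto
        moreover have "s \<le> s * s" "1 \<le> s * s" using s(1) by auto
        ultimately show "1 + length ?ys + sum_list ?ys \<le> 28 * X\<^sup>2"
          using sum_list_enc_le[of s s M] sum_list_enc_le[of s s M'] unfolding power2_eq_square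
          by (simp only: list.size length_append length_enc sum_list.Cons sum_list_append)
      qed
      then have "\<exists>s'. exec W P P (start zero_store ?ys) t s' \<and> out s' = enc s s (mmul s M M')"
        using r(1) exec_mono unfolding runs_def by blast
      moreover have "C0 * real s powr \<omega> \<le> C1 * real s powr \<omega>" by (intro mult_right_mono) (auto simp: C1_def)
      ultimately show "proc P ?ys (C1 * real s powr \<omega>) (enc s s (mmul s M M'))"
        unfolding proc_def using r(2) order_trans by blast
    qed
    define L where "L = Max (length ` set Ks)"
    have ne: "length ` set Ks \<noteq> {}" using n1 by (auto simp: n_def)
    have L: "length vs \<le> L" if "vs \<in> set Ks" for vs using that by (simp add: L_def)
    have "L \<in> length ` set Ks" unfolding L_def using ne by (intro Max_in) auto
    then have L2: "2 ^ L \<le> n + 1" using two_power_length[of K Ks] A by (auto simp: n_def)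
    have "L < 2 ^ L" by (rule less_exp)
    then have Ln: "L \<le> n" using L2 by linarith
    have V: "x \<le> B" if "vs \<in> set Ks" "x \<in> set vs" for vs x
      by (rule XB, rule mem) (use that in \<open>auto simp: xs_def enc_complex_def\<close>)
    have "wpb (pre_prog P) (pre_prog P) (E * real n powr \<omega>)
      (\<lambda>st. \<exists>k. n \<le> 2 ^ k \<and> out st = pre_output Ks p k \<and> store st 9 0 = length (annot_cols Ks p k) \<and>
        stored (store st 19) n (length (annot_cols Ks p k)) (annot Ks p k))
      (State zero_store xs [] [] [])"
      unfolding xs_def
      by (rule wpb_pre[OF n_def n1 le_refl D(1,2) L Ln V XB[OF nX(2)] E[OF n1 _ _ L2]])
    then obtain t and s' :: state where pre: "runs W (pre_prog P) zero_store xs t (out s') (store s')"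
        "real t \<le> E * real n powr \<omega>" "bnd (store s')"
      and ex: "\<exists>k. n \<le> 2 ^ k \<and> out s' = pre_output Ks p k \<and> store s' 9 0 = length (annot_cols Ks p k) \<and>
        stored (store s' 19) n (length (annot_cols Ks p k)) (annot Ks p k)"
      by (rule wpb_runs)
    obtain \<kappa> where kap: "n \<le> 2 ^ \<kappa>" "out s' = pre_output Ks p \<kappa>" "store s' 9 0 = length (annot_cols Ks p \<kappa>)"
        "stored (store s' 19) n (length (annot_cols Ks p \<kappa>)) (annot Ks p \<kappa>)"
      using ex by blast
    interpret listed_complex K Ks p \<kappa>
      using A kap(1) by unfold_locales (auto simp: n_def)
    \<comment> \<open>Besides the word bound only register 9 and array 19 are fixed. So the set is
      closed under both queries, which may follow each other in any order while scratch cells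
      change.\<close>
    define Dom where "Dom = {M. bnd M \<and> M 9 0 = length (annot_cols Ks p \<kappa>) \<and>
      stored (M 19) n (length (annot_cols Ks p \<kappa>)) (annot Ks p \<kappa>)}"
    have chain: "set zs \<subseteq> {..<n}" "length zs \<le> n" if "lists_chain Ks zs z" for zs z
    proof -
      show "set zs \<subseteq> {..<n}" using that by (simp add: lists_chain_def n_def)
      then have "card (set zs) \<le> n" using card_mono[of "{..<n}" "set zs"] by simp
      then show "length zs \<le> n" using that by (simp add: lists_chain_def distinct_card)
    qed
    have nB: "n \<le> B" "2 * n \<le> B" using small_le_B[of "2 * n" n] by auto
    have time: "300 * y \<le> Cf * y" if "0 \<le> y" for y using that by (simp add: Cf_def mult_right_mono)
    have Pre: "\<exists>t. \<exists>M\<in>Dom. runs W (pre_prog P) zero_store xs t (betti K p # enc_annotation Ks p vector_of) M \<and>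
        real t \<le> Cf * real n powr \<omega>"
    proof (intro exI bexI conjI)
      show "runs W (pre_prog P) zero_store xs t (betti K p # enc_annotation Ks p vector_of) (store s')"
        using pre(1) kap(2) by (simp add: pre_output_eq)
      have "E * real n powr \<omega> \<le> Cf * real n powr \<omega>" by (intro mult_right_mono) (auto simp: Cf_def)
      then show "real t \<le> Cf * real n powr \<omega>" using pre(2) by linarith
      show "store s' \<in> Dom" using pre(3) kap by (simp add: Dom_def)
    qed
    have Null: "\<exists>t. \<exists>M'\<in>Dom. runs W null_prog M (enc_chain zs) t [of_bool (null_homologous K p z)] M' \<and>
        real t \<le> Cf * (1 + real (card z) * real (betti K p))"
      if M: "M \<in> Dom" and z: "z \<in> cycles K p" "lists_chain Ks zs z" for M z zs
    proof -
      have "length zs \<le> B" using chain[OF z(2)] nB by simp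
      with M chain(1)[OF z(2)] nB(1)
      have "wpb null_prog null_prog (300 * (1 + real (length zs) * real (length (annot_cols Ks p \<kappa>))))
        (\<lambda>s'. out s' = [of_bool (\<forall>t<length (annot_cols Ks p \<kappa>). (\<Sum>k<length zs. annot Ks p \<kappa> (zs ! k) t) = 0)] \<and>
          store s' 9 0 = length (annot_cols Ks p \<kappa>) \<and> stored (store s' 19) n (length (annot_cols Ks p \<kappa>)) (annot Ks p \<kappa>))
        (State M (enc_chain zs) [] [] [])"
        by (intro wpb_null) (auto simp: Dom_def)
      then obtain t and s' :: state where r: "runs W null_prog M (enc_chain zs) t (out s') (store s')"
        "real t \<le> 300 * (1 + real (length zs) * real (length (annot_cols Ks p \<kappa>)))" "bnd (store s')"
        and o: "out s' = [of_bool (\<forall>t<length (annot_cols Ks p \<kappa>). (\<Sum>k<length zs. annot Ks p \<kappa> (zs ! k) t) = 0)]"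
          "store s' 9 0 = length (annot_cols Ks p \<kappa>)" "stored (store s' 19) n (length (annot_cols Ks p \<kappa>)) (annot Ks p \<kappa>)"
        by (rule wpb_runs) blast
      have "store s' \<in> Dom" using r(3) o by (simp add: Dom_def)
      moreover have "real t \<le> Cf * (1 + real (card z) * real (betti K p))"
        using order_trans[OF r(2) time] unfolding betti_eq alpha_list(2)[OF z(2)] by simp
      moreover have "runs W null_prog M (enc_chain zs) t [of_bool (null_homologous K p z)] (store s')"
        using r(1) unfolding o(1) null_homologous_list[OF z] .
      ultimately show ?thesis by blast
    qed
    have Homol: "\<exists>t. \<exists>M'\<in>Dom. runs W homologous_prog M (enc_chain zs1 @ enc_chain zs2) t [of_bool (homologous K p z1 z2)] M' \<and>
        real t \<le> Cf * (1 + (real (card z1) + real (card z2)) * real (betti K p))"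
      if M: "M \<in> Dom" and z: "z1 \<in> cycles K p" "lists_chain Ks zs1 z1" "z2 \<in> cycles K p" "lists_chain Ks zs2 z2"
      for M z1 zs1 z2 zs2
    proof -
      have "length zs1 + length zs2 \<le> B" using chain[OF z(2)] chain[OF z(4)] nB by simp
      with M chain(1)[OF z(2)] chain(1)[OF z(4)] nB(1)
      have "wpb homologous_prog homologous_prog (300 * (1 + (real (length zs1) + real (length zs2)) * real (length (annot_cols Ks p \<kappa>))))
        (\<lambda>s'. out s' = [of_bool (\<forall>t<length (annot_cols Ks p \<kappa>). (\<Sum>k<length (zs1 @ zs2). annot Ks p \<kappa> ((zs1 @ zs2) ! k) t) = 0)] \<and>
          store s' 9 0 = length (annot_cols Ks p \<kappa>) \<and> stored (store s' 19) n (length (annot_cols Ks p \<kappa>)) (annot Ks p \<kappa>))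
        (State M (enc_chain zs1 @ enc_chain zs2) [] [] [])"
        by (intro wpb_homologous) (auto simp: Dom_def)
      then obtain t and s' :: state where r: "runs W homologous_prog M (enc_chain zs1 @ enc_chain zs2) t (out s') (store s')"
        "real t \<le> 300 * (1 + (real (length zs1) + real (length zs2)) * real (length (annot_cols Ks p \<kappa>)))" "bnd (store s')"
        and o: "out s' = [of_bool (\<forall>t<length (annot_cols Ks p \<kappa>). (\<Sum>k<length (zs1 @ zs2). annot Ks p \<kappa> ((zs1 @ zs2) ! k) t) = 0)]"
          "store s' 9 0 = length (annot_cols Ks p \<kappa>)" "stored (store s' 19) n (length (annot_cols Ks p \<kappa>)) (annot Ks p \<kappa>)"
        by (rule wpb_runs) blast
      have "store s' \<in> Dom" using r(3) o by (simp add: Dom_def)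
      moreover have "real t \<le> Cf * (1 + (real (card z1) + real (card z2)) * real (betti K p))"
        using order_trans[OF r(2) time] unfolding betti_eq alpha_list(2)[OF z(2)] alpha_list(2)[OF z(4)] by simp
      moreover have "runs W homologous_prog M (enc_chain zs1 @ enc_chain zs2) t [of_bool (homologous K p z1 z2)] (store s')"
        using r(1) unfolding o(1) homologous_list[OF z] .
      ultimately show ?thesis by blast
    qed
    show "let n = card K; g = betti K p; xs = p # enc_complex Ks; W = word_bound c k xs in
       \<exists>(a :: nat set \<Rightarrow> bit vec) (D :: store set).
         annotation K p a \<and>
         (\<exists>t. \<exists>M\<in>D. runs W (pre_prog P) zero_store xs t (g # enc_annotation Ks p a) M \<and>
            real t \<le> Cf * real n powr \<omega>) \<and>
         (\<forall>M\<in>D.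
            (\<forall>z zs. z \<in> cycles K p \<and> lists_chain Ks zs z \<longrightarrow>
              (\<exists>t. \<exists>M'\<in>D.
                 runs W null_prog M (enc_chain zs) t [of_bool (null_homologous K p z)] M' \<and>
                 real t \<le> Cf * (1 + real (card z) * real g))) \<and>
            (\<forall>z1 zs1 z2 zs2.
              z1 \<in> cycles K p \<and> lists_chain Ks zs1 z1 \<and>
              z2 \<in> cycles K p \<and> lists_chain Ks zs2 z2 \<longrightarrow>
              (\<exists>t. \<exists>M'\<in>D.
                 runs W homologous_prog M (enc_chain zs1 @ enc_chain zs2) t
                   [of_bool (homologous K p z1 z2)] M' \<and>
                 real t \<le> Cf * (1 + (real (card z1) + real (card z2)) * real g))))"
      unfolding Let_def cK xs_def[symmetric] W_def[symmetric]
      by (rule exI[of _ vector_of], rule exI[of _ Dom])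
        (intro conjI ballI allI impI annotation_vector_of Pre Null Homol; elim conjE; assumption)
  qed
qed

end
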